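(* Let $p>2$ be an odd prime number, $G$ a transitive group of degree $p^{2}$, and $H$ a corresponding subgroup of $G$. We further assume that $G$ is a $p$-group. (i) If $\text{Ш}_{\omega}^{2}(G,J_{G/H})\neq 0$, then we have $G\cong P'_{n}$ for some $n\in \{1,2\}$. (ii) Assume $G\cong P'_{n}$ for some $n\in \{1,2\}$. For an admissible set $\mathcal{D}$ of subgroups in $G$, there is an isomorphism \[ \text{Ш}_{\mathcal{D}}^{2}(G,J_{G/H})\cong \begin{cases} 0&\text{if $(C_{p})^{2}<D$ for some $D\in \mathcal{D}$;}\\ \mathbb{Z}/p&\text{otherwise.} \end{cases} \]
   Context: A transitive group of degree $n$ is a subgroup $G\le\mathfrak{S}_n$ acting transitively on $\mathbb{Z}/n$; a corresponding subgroup is $G\cap\mathrm{Stab}_{\mathfrak{S}_n}(i)$. Identify $\mathbb{Z}/p^2$ with $\mathbb{F}_p\times\mathbb{F}_p$ via $a+pb\mapsto(a,b)$. Let $\rho_1(i,j)=(i,j+1)$, $\rho_2(i,j)=(i+1,j)$, $z_{i_0}(i,j)=(i_0,j+1)$ if $i=i_0$ and $(i,j)$ otherwise, and $\gamma_n=\prod_{j=0}^{p-1}z_j^{a_{p-n,j}}$ with $a_{i,j}=(-1)^{i-j}\binom{i}{j}$ for $i\ge j$ and $0$ otherwise. Put $P'_n:=\langle\rho_1,\rho_2,\gamma_n\rangle\le\mathfrak{S}_{p^2}$; thus $P'_1\cong(C_p)^2$ (regular) and $P'_2$ is the nonabelian group of order $p^3$ and exponent $p$. $J_{G/H}$ is defined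 by $0\to\mathbb{Z}\to\operatorname{Ind}_H^G\mathbb{Z}\to J_{G/H}\to0$. For a $G$-module $M$ and a set $\mathcal{D}$ of subgroups, $\text{Ш}^2_{\mathcal{D}}(G,M):=\ker\big(H^2(G,M)\to\bigoplus_{D\in\mathcal{D}}H^2(D,M)\big)$, $\text{Ш}^2_\omega:=\text{Ш}^2_{\mathcal{C}_G}$ with $\mathcal{C}_G$ the set of cyclic subgroups; $\mathcal{D}$ is admissible if it contains $\mathcal{C}_G$ and is closed under conjugation. *)

theory Defs
  imports "HOL-Algebra.Algebra" "HOL-Combinatorics.Permutations"
begin

definition perm_grp :: "nat \<Rightarrow> (nat \<Rightarrow> nat) monoid" where
  "perm_grp N = \<lparr>carrier = {\<sigma>. \<sigma> permutes {..<N}}, monoid.mult = (\<circ>), one = id\<rparr>"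

definition transitive_on :: "nat \<Rightarrow> (nat \<Rightarrow> nat) set \<Rightarrow> bool" where
  "transitive_on N G \<longleftrightarrow> (\<forall>x<N. \<forall>y<N. \<exists>\<sigma>\<in>G. \<sigma> x = y)"

text \<open>Z/p^2 = F_p x F_p via a + p b |-> (a,b); so a point x < p^2 has coordinates
  (x mod p, x div p).\<close>

definition rho1 :: "nat \<Rightarrow> nat \<Rightarrow> nat" where
  "rho1 p x = (if x < p^2 then x mod p + p * ((x div p + 1) mod p) else x)"

definition rho2 :: "nat \<Rightarrow> nat \<Rightarrow> nat" where
  "rho2 p x = (if x < p^2 then (x mod p + 1) mod p + p * (x div p) else x)"

definition zz :: "nat \<Rightarrow> nat \<Rightarrow> nat \<Rightarrow> nat" where
  "zz p i0 x = (if x < p^2 \<and> x mod p = i0 then i0 + p * ((x div p + 1) mod p) else x)"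

definition acoef :: "nat \<Rightarrow> nat \<Rightarrow> int" where
  "acoef i j = (if j \<le> i then (-1) ^ (i - j) * int (i choose j) else 0)"

definition gamma :: "nat \<Rightarrow> nat \<Rightarrow> nat \<Rightarrow> nat" where
  "gamma p n = foldr (\<lambda>j g. zz p j [^]\<^bsub>perm_grp (p^2)\<^esub> acoef (p - n) j \<otimes>\<^bsub>perm_grp (p^2)\<^esub> g)
                     [0..<p] \<one>\<^bsub>perm_grp (p^2)\<^esub>"

definition P' :: "nat \<Rightarrow> nat \<Rightarrow> (nat \<Rightarrow> nat) monoid" where
  "P' p n = (perm_grp (p^2))\<lparr>carrier := generate (perm_grp (p^2)) {rho1 p, rho2 p, gamma p n}\<rparr>"

text \<open>Ind_H^G Z = Z[G/H] is modelled as integer-valued functions on the set of left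
  cosets G/H (zero off G/H); g acts by (g.u)(C) = u(g^{-1} C).  J_{G/H} = Ind/Z, where Z is
  the constant functions; cochains with values in J are represented by Ind-valued
  cochains, with all identities required modulo constants.\<close>


definition ind_act :: "('a, 'b) monoid_scheme \<Rightarrow> 'a set \<Rightarrow> 'a \<Rightarrow> ('a set \<Rightarrow> int) \<Rightarrow> ('a set \<Rightarrow> int)" where
  "ind_act G H g u = (\<lambda>C. if C \<in> lcosets\<^bsub>G\<^esub> H then u (l_coset G (inv\<^bsub>G\<^esub> g) C) else 0)"

definition const_on :: "'a set set \<Rightarrow> ('a set \<Rightarrow> int) \<Rightarrow> bool" where
  "const_on S f \<longleftrightarrow> (\<exists>n. \<forall>A\<in>S. f A = n)"

definition cochains2 :: "('a, 'b) monoid_scheme \<Rightarrow> 'a set \<Rightarrow> 'a set \<Rightarrow> ('a \<Rightarrow> 'a \<Rightarrow> 'a set \<Rightarrow> int) set" where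
  "cochains2 G H D = {c. (\<forall>g h. (g \<notin> D \<or> h \<notin> D) \<longrightarrow> c g h = (\<lambda>_. 0))
                         \<and> (\<forall>g h C. C \<notin> lcosets\<^bsub>G\<^esub> H \<longrightarrow> c g h C = 0)}"

definition cochain_grp :: "('a, 'b) monoid_scheme \<Rightarrow> 'a set \<Rightarrow> 'a set \<Rightarrow> ('a \<Rightarrow> 'a \<Rightarrow> 'a set \<Rightarrow> int) monoid" where
  "cochain_grp G H D = \<lparr>carrier = cochains2 G H D,
      monoid.mult = (\<lambda>c d g h C. c g h C + d g h C), one = (\<lambda>_ _ _. 0)\<rparr>"

definition Z2 :: "('a, 'b) monoid_scheme \<Rightarrow> 'a set \<Rightarrow> 'a set \<Rightarrow> ('a \<Rightarrow> 'a \<Rightarrow> 'a set \<Rightarrow> int) set" where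
  "Z2 G H D = {c \<in> cochains2 G H D. \<forall>g\<in>D. \<forall>h\<in>D. \<forall>k\<in>D.
      const_on (lcosets\<^bsub>G\<^esub> H)
        (\<lambda>C. ind_act G H g (c h k) C - c (g \<otimes>\<^bsub>G\<^esub> h) k C + c g (h \<otimes>\<^bsub>G\<^esub> k) C - c g h C)}"

definition B2 :: "('a, 'b) monoid_scheme \<Rightarrow> 'a set \<Rightarrow> 'a set \<Rightarrow> ('a \<Rightarrow> 'a \<Rightarrow> 'a set \<Rightarrow> int) set" where
  "B2 G H D = {c \<in> cochains2 G H D. \<exists>b :: 'a \<Rightarrow> 'a set \<Rightarrow> int. \<forall>g\<in>D. \<forall>h\<in>D.
      const_on (lcosets\<^bsub>G\<^esub> H)
        (\<lambda>C. c g h C - (ind_act G H g (b h) C - b (g \<otimes>\<^bsub>G\<^esub> h) C + b g C))}"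

definition restr2 :: "'a set \<Rightarrow> ('a \<Rightarrow> 'a \<Rightarrow> 'a set \<Rightarrow> int) \<Rightarrow> ('a \<Rightarrow> 'a \<Rightarrow> 'a set \<Rightarrow> int)" where
  "restr2 D c = (\<lambda>g h. if g \<in> D \<and> h \<in> D then c g h else (\<lambda>_. 0))"

definition H2J :: "('a, 'b) monoid_scheme \<Rightarrow> 'a set \<Rightarrow> ('a \<Rightarrow> 'a \<Rightarrow> 'a set \<Rightarrow> int) set monoid" where
  "H2J G H = (cochain_grp G H (carrier G))\<lparr>carrier := Z2 G H (carrier G)\<rparr> Mod B2 G H (carrier G)"

definition Sha2 :: "('a, 'b) monoid_scheme \<Rightarrow> 'a set \<Rightarrow> 'a set set \<Rightarrow> ('a \<Rightarrow> 'a \<Rightarrow> 'a set \<Rightarrow> int) set monoid" where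
  "Sha2 G H DD = (H2J G H)\<lparr>carrier := {x \<in> carrier (H2J G H).
       \<forall>c\<in>x. \<forall>D\<in>DD. restr2 D c \<in> B2 G H D}\<rparr>"

definition cyclic_subgroups :: "('a, 'b) monoid_scheme \<Rightarrow> 'a set set" where
  "cyclic_subgroups G = (\<lambda>g. generate G {g}) ` carrier G"

definition admissible :: "('a, 'b) monoid_scheme \<Rightarrow> 'a set set \<Rightarrow> bool" where
  "admissible G DD \<longleftrightarrow> (\<forall>D\<in>DD. subgroup D G) \<and> cyclic_subgroups G \<subseteq> DD
     \<and> (\<forall>D\<in>DD. \<forall>g\<in>carrier G. r_coset G (l_coset G g D) (inv\<^bsub>G\<^esub> g) \<in> DD)"

definition contains_Cp2 :: "('a, 'b) monoid_scheme \<Rightarrow> nat \<Rightarrow> 'a set \<Rightarrow> bool" where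
  "contains_Cp2 G p D \<longleftrightarrow> (\<exists>K. K \<subseteq> D \<and> subgroup K G \<and>
      G\<lparr>carrier := K\<rparr> \<cong> integer_mod_group p \<times>\<times> integer_mod_group p)"

end

theory Submission
  imports Defs Complex_Main "HOL-Number_Theory.Residues"
begin

text \<open>
  Since \<open>J \<otimes> \<rat>\<close> is cohomologically trivial, a class in \<open>H\<^sup>2(G, J)\<close> is a projective representation \<open>W\<close> of \<open>G\<close>
  by monomial matrices over the given permutation action, up to conjugation by diagonal matrices and
  scalars; it vanishes on \<open>D\<close> iff \<open>W\<close> restricted to \<open>D\<close> has a common eigenvector without zero entries. If it
  vanishes on cyclic subgroups, then \<open>W g\<close> is constant on the fixed points of \<open>g\<close>.

  Let \<open>z\<close> be central of order \<open>p\<close> and \<open>M\<close> the kernel of the action on the \<open>p\<close> orbits of \<open>z\<close> (blocks). Then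
  \<open>G = \<langle>t\<rangle> M\<close> for any \<open>t\<close> outside \<open>M\<close>, and \<open>m \<in> M\<close> acts on block \<open>i\<close> as \<open>z\<close> to the power \<open>f i m\<close>. Constancy on
  fixed points makes \<open>W z\<close> commute with \<open>W m\<close>, and the commutator \<open>c\<close> of \<open>W t\<close> and \<open>W z\<close>, a \<open>p\<close>-th root of
  unity, is the only obstruction to triviality. It vanishes if \<open>t\<^sup>p \<noteq> 1\<close>, because then \<open>z\<close> is a power of \<open>t\<close>,
  and if some \<open>m\<close> fixes blocks 0 and 2 but not block 1 pointwise. Otherwise \<open>f i m\<close> is affine in \<open>i\<close>, so that \<open>G\<close>
  is conjugate to \<open>P'\<^sub>1\<close> or \<open>P'\<^sub>2\<close>. For these two groups the obstruction takes all values, and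
  it is killed by any subgroup containing \<open>(C\<^sub>p)\<^sup>2\<close>.
\<close>

section \<open>The block system of a central element of order \<open>p\<close>\<close>

text \<open>Why second differences of \<open>f\<close> decide: choose the gauge in which the matrix
  over \<open>z\<close> is a scalar times a permutation matrix. For \<open>m\<close> in
  \<open>M\<close> the scalar of \<open>W m\<close> on block \<open>i + 1\<close> divided by the one
  on block \<open>i\<close> is a character of \<open>M\<close>, trivial where
  \<open>f (i + 1) m = f i m\<close>. So it can be written as a root of unity e(i) to the power
  \<open>f (i + 1) m - f i m\<close>. Conjugation with \<open>t\<close> gives e(i + 1) = c e(i). If
  \<open>m\<close> fixes points of blocks 0 and 2, the product of the first two quotients is 1, but
  these formulas make it \<open>c\<close> to the power \<open>- f 1 m\<close>. Affine shifts have no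
  second difference, so they put no constraint on \<open>c\<close>.

  The converse half knows \<open>G\<close> only up to abstract isomorphism. It keeps two
  consequences: class at most two, which makes the shifts affine, and exponent \<open>p\<close>,
  which lets partial sums of shifts close up after \<open>p\<close> blocks, so that a nontrivial
  class can be written down. To see the obstruction on a subgroup \<open>D\<close>, \<open>t\<close>
  is chosen again, inside \<open>D\<close> whenever \<open>D\<close> moves blocks.\<close>

abbreviation pinv :: "('a \<Rightarrow> 'a) \<Rightarrow> 'a \<Rightarrow> 'a" where
  "pinv f \<equiv> inv_into UNIV f"

lemma carrier_perm_grp [simp]: "\<sigma> \<in> carrier (perm_grp N) \<longleftrightarrow> \<sigma> permutes {..<N}"
  by (simp add: perm_grp_def)

lemma mult_perm_grp [simp]: "\<sigma> \<otimes>\<^bsub>perm_grp N\<^esub> \<tau> = \<sigma> \<circ> \<tau>"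
  by (simp add: perm_grp_def)

lemma one_perm_grp [simp]: "\<one>\<^bsub>perm_grp N\<^esub> = id"
  by (simp add: perm_grp_def)

lemma group_perm_grp: "group (perm_grp N)"
proof (rule groupI)
  fix x assume "x \<in> carrier (perm_grp N)"
  then have "pinv x permutes {..<N}" "pinv x \<circ> x = id"
    by (simp_all add: permutes_inv permutes_inv_o)
  then show "\<exists>y\<in>carrier (perm_grp N). y \<otimes>\<^bsub>perm_grp N\<^esub> x = \<one>\<^bsub>perm_grp N\<^esub>"
    by auto
qed (auto simp: permutes_compose permutes_id comp_assoc)

lemma inv_perm_grp:
  assumes "\<sigma> permutes {..<N}"
  shows "inv\<^bsub>perm_grp N\<^esub> \<sigma> = pinv \<sigma>"
  using assms by (intro group.inv_equality[OF group_perm_grp]) (auto simp: permutes_inv_o permutes_inv)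

lemma nat_pow_perm_grp: "\<sigma> [^]\<^bsub>perm_grp N\<^esub> (n::nat) = \<sigma> ^^ n"
proof (induction n)
  case 0
  then show ?case by (simp add: nat_pow_def)
next
  case (Suc n)
  have "\<sigma> [^]\<^bsub>perm_grp N\<^esub> (Suc n) = (\<sigma> [^]\<^bsub>perm_grp N\<^esub> n) \<otimes>\<^bsub>perm_grp N\<^esub> \<sigma>"
    by (simp add: nat_pow_def)
  then show ?case using Suc by (simp add: fun_eq_iff funpow_swap1)
qed

lemma funpow_swap:
  assumes "f \<circ> g = g \<circ> f"
  shows "(f ^^ n) (g x) = g ((f ^^ n) x)"
  using assms by (induction n) (auto simp: fun_eq_iff)

lemma funpow_swap2:
  assumes "f \<circ> g = g \<circ> f"
  shows "(f ^^ n) ((g ^^ m) x) = (g ^^ m) ((f ^^ n) x)"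
  by (induction m) (use funpow_swap[OF assms] in auto)

lemma inverse_mod_prime:
  assumes "Factorial_Ring.prime p" "\<not> p dvd (a::nat)"
  obtains b where "[a * b = Suc 0] (mod p)"
  using assms cong_solve_coprime_nat prime_imp_coprime coprime_commute by metis

lemma funpow_cong_mod:
  fixes a :: "'a \<Rightarrow> 'a"
  assumes "a ^^ p = id" "[n = m] (mod p)" shows "a ^^ n = a ^^ m"
proof
  fix x
  have "(a ^^ (k mod p)) x = (a ^^ k) x" for k using assms(1) by (intro funpow_mod_eq) simp
  then show "(a ^^ n) x = (a ^^ m) x" using assms(2) unfolding cong_def by metis
qed

lemma funpow_eq_id_prime:
  fixes a :: "'a \<Rightarrow> 'a"
  assumes p: "Factorial_Ring.prime p" and a: "a ^^ p = id" and n: "a ^^ n = id" "\<not> p dvd n"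
  shows "a = id"
proof -
  obtain b where "[n * b = Suc 0] (mod p)" using inverse_mod_prime[OF p n(2)] by blast
  then have "a ^^ (n * b) = a ^^ Suc 0" by (rule funpow_cong_mod[OF a])
  moreover have "a ^^ (n * b) = id" using n(1) by (simp flip: funpow_mult)
  ultimately show ?thesis by simp
qed

lemma card_fibers_const:
  assumes "finite A" and "\<And>a. a \<in> A \<Longrightarrow> card {x \<in> A. f x = f a} = c"
  shows "card A = card (f ` A) * c"
proof -
  have "card A = (\<Sum>y\<in>f ` A. card {x \<in> A. f x = y})"
    using sum.image_gen[OF assms(1), of "\<lambda>_. 1::nat" f] by simp
  also have "\<dots> = (\<Sum>y\<in>f ` A. c)"
    using assms(2) by (intro sum.cong) auto
  finally show ?thesis by simp
qed

section \<open>Transitive \<open>p\<close>-groups of degree \<open>p^2\<close>\<close>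

locale perm_pgroup =
  fixes p :: nat and G :: "(nat \<Rightarrow> nat) set"
  assumes prime_p: "Factorial_Ring.prime p"
    and sub: "subgroup G (perm_grp (p^2))"
    and G_transitive: "transitive_on (p^2) G"
    and card_G: "\<exists>k. card G = p ^ k"
begin

lemma p_gt_1: "p > 1" using prime_p prime_gt_1_nat by blast
lemma p_pos [simp]: "p > 0" using p_gt_1 by simp

lemma G_perm: "g \<in> G \<Longrightarrow> g permutes {..<p^2}"
  using subgroup.subset[OF sub] by auto

lemma G_id: "id \<in> G"
  using subgroup.one_closed[OF sub] by simp

lemma G_comp: "g \<in> G \<Longrightarrow> h \<in> G \<Longrightarrow> g \<circ> h \<in> G"
  using subgroup.m_closed[OF sub] by simp

lemma G_inv: "g \<in> G \<Longrightarrow> pinv g \<in> G"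
  using subgroup.m_inv_closed[OF sub] inv_perm_grp G_perm by metis

lemma G_pow: "g \<in> G \<Longrightarrow> g ^^ n \<in> G"
  by (induction n) (auto simp: G_id G_comp)

lemma finite_G: "finite G"
  by (rule finite_subset[of _ "{\<sigma>. \<sigma> permutes {..<p^2}}"]) (auto simp: G_perm finite_permutations)

lemma G_bij: "g \<in> G \<Longrightarrow> bij g"
  using G_perm permutes_bij by blast

lemma G_inj: "g \<in> G \<Longrightarrow> g x = g y \<longleftrightarrow> x = y"
  using G_bij bij_is_inj inj_eq by metis

lemma G_less: "g \<in> G \<Longrightarrow> g x < p^2 \<longleftrightarrow> x < p^2"
  using permutes_in_image[OF G_perm, of g x] by simp

lemma G_inv_f [simp]: "g \<in> G \<Longrightarrow> pinv g (g x) = x"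
  using G_bij bij_is_inj inv_f_f by metis

lemma G_f_inv [simp]: "g \<in> G \<Longrightarrow> g (pinv g x) = x"
  using G_bij bij_is_surj surj_f_inv_f by metis

lemma G_inv_comp [simp]: "g \<in> G \<Longrightarrow> pinv g \<circ> g = id" "g \<in> G \<Longrightarrow> g \<circ> pinv g = id"
  by (auto simp: fun_eq_iff)

lemma G_eqI: "g \<in> G \<Longrightarrow> h \<in> G \<Longrightarrow> (\<And>x. x < p^2 \<Longrightarrow> g x = h x) \<Longrightarrow> g = h"
  using permutes_not_in[OF G_perm] by (metis ext lessThan_iff)

lemma G_trans: "x < p^2 \<Longrightarrow> y < p^2 \<Longrightarrow> \<exists>g\<in>G. g x = y"
  using G_transitive by (auto simp: transitive_on_def)

lemma group_G: "group ((perm_grp (p^2))\<lparr>carrier := G\<rparr>)"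
  by (rule subgroup.subgroup_is_group[OF sub group_perm_grp])

lemma G_pow_card: 
  assumes "g \<in> G" shows "g ^^ (card G) = id"
proof -
  let ?\<Gamma> = "(perm_grp (p^2))\<lparr>carrier := G\<rparr>"
  have "g [^]\<^bsub>?\<Gamma>\<^esub> order ?\<Gamma> = \<one>\<^bsub>?\<Gamma>\<^esub>"
    by (rule group.pow_order_eq_1[OF group_G]) (use assms in simp)
  then have "g [^]\<^bsub>perm_grp (p^2)\<^esub> card G = id"
    by (simp add: order_def nat_pow_def)
  then show ?thesis by (simp add: nat_pow_perm_grp)
qed

text \<open>\<open>act\<close> will be either the natural action or conjugation.\<close>

lemma orbit_card_prime_power:
  fixes act :: "(nat \<Rightarrow> nat) \<Rightarrow> 'a \<Rightarrow> 'a"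
  assumes K: "subgroup K (perm_grp (p^2))" "K \<subseteq> G"
    and act: "\<And>g h y. g \<in> K \<Longrightarrow> h \<in> K \<Longrightarrow> act (g \<circ> h) y = act g (act h y)" "\<And>y. act id y = y"
  shows "\<exists>m. card ((\<lambda>g. act g x) ` K) = p ^ m"
proof -
  have fin: "finite K" using K(2) finite_G finite_subset by blast
  have cl: "g \<circ> h \<in> K" "pinv g \<in> K" "id \<in> K" if "g \<in> K" "h \<in> K" for g h
  proof -
    show "g \<circ> h \<in> K" using subgroup.m_closed[OF K(1) that] by simp
    have "inv\<^bsub>perm_grp (p^2)\<^esub> g = pinv g" using that K(2) by (intro inv_perm_grp G_perm) auto
    then show "pinv g \<in> K" using subgroup.m_inv_closed[OF K(1) that(1)] by simp
    show "id \<in> K" using subgroup.one_closed[OF K(1)] by simp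
  qed
  \<comment> \<open>Composition with \<open>a\<close> carries the stabilizer of \<open>x\<close>
    onto this fibre. So the orbit map has fibres of equal size, and the orbit length divides
    \<open>card K\<close>.\<close>
  have fib: "card {g \<in> K. act g x = act a x} = card {g \<in> K. act g x = x}" if a: "a \<in> K" for a
  proof -
    have aG: "a \<in> G" using a K(2) by auto
    have "bij_betw (\<lambda>g. pinv a \<circ> g) {g \<in> K. act g x = act a x} {g \<in> K. act g x = x}"
    proof (rule bij_betwI[where g = "\<lambda>g. a \<circ> g"])
      show "(\<lambda>g. pinv a \<circ> g) \<in> {g \<in> K. act g x = act a x} \<rightarrow> {g \<in> K. act g x = x}"
      proof
        fix g assume g: "g \<in> {g \<in> K. act g x = act a x}"
        then have "act (pinv a \<circ> g) x = act (pinv a) (act a x)" using act(1) cl a by auto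
        also have "\<dots> = act (pinv a \<circ> a) x" using act(1) cl a by metis
        finally show "pinv a \<circ> g \<in> {g \<in> K. act g x = x}" using act(2) cl g a aG by auto
      qed
      show "(\<lambda>g. a \<circ> g) \<in> {g \<in> K. act g x = x} \<rightarrow> {g \<in> K. act g x = act a x}"
        using act cl a by auto
    qed (use aG in \<open>auto simp: comp_assoc[symmetric]\<close>)
    then show ?thesis by (rule bij_betw_same_card)
  qed
  have "card K = card ((\<lambda>g. act g x) ` K) * card {g \<in> K. act g x = x}"
    by (rule card_fibers_const[OF fin]) (use fib in auto)
  moreover have "card K dvd card G"
  proof -
    interpret g: group "(perm_grp (p^2))\<lparr>carrier := G\<rparr>" by (rule group_G)
    have "subgroup K ((perm_grp (p^2))\<lparr>carrier := G\<rparr>)"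
      using group.subgroup_incl[OF group_perm_grp K(1) sub K(2)] .
    then have "card (rcosets\<^bsub>(perm_grp (p^2))\<lparr>carrier := G\<rparr>\<^esub> K) * card K = card G"
      using g.lagrange by (simp add: order_def)
    then show ?thesis by (metis dvd_triv_right)
  qed
  ultimately have "card ((\<lambda>g. act g x) ` K) dvd card G"
    using dvd_trans[OF dvd_triv_left] by simp
  then have "\<exists>k. card ((\<lambda>g. act g x) ` K) dvd p ^ k"
    using card_G by metis
  then show ?thesis using divides_primepow_nat[OF prime_p] by auto
qed

text \<open>Class equation: without a central element other than \<open>id\<close>, every conjugacy
  class in \<open>G - {id}\<close> would have length divisible by \<open>p\<close>, and
  \<open>p\<close> would divide both \<open>card G - 1\<close> and \<open>card G\<close>.\<close>

lemma exists_central_prime_order: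
  "\<exists>z\<in>G. z \<noteq> id \<and> z ^^ p = id \<and> (\<forall>g\<in>G. z \<circ> g = g \<circ> z)"
proof -
  have "\<exists>y\<in>G. y \<noteq> id \<and> (\<forall>g\<in>G. y \<circ> g = g \<circ> y)"
  proof (rule ccontr)
    assume neg: "\<not> ?thesis"
    define orb where "orb y = (\<lambda>g. g \<circ> y \<circ> pinv g) ` G" for y :: "nat \<Rightarrow> nat"
    have mem: "y \<in> orb y" for y 
      unfolding orb_def by (rule image_eqI[of _ _ id]) (simp_all add: G_id)
    have invc: "pinv (g \<circ> h) = pinv h \<circ> pinv g" if "g \<in> G" "h \<in> G" for g h
      using that by (intro o_inv_distrib G_bij)
    have orbG: "orb y \<subseteq> G" if "y \<in> G" for y
      using that by (auto simp: orb_def intro!: G_comp G_inv)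
    have id_orb: "y = id" if in_orb: "id \<in> orb y" for y
    proof -
      obtain g where g: "g \<in> G" and "id = g \<circ> y \<circ> pinv g"
        using in_orb unfolding orb_def by blast
      then have "g \<circ> y \<circ> pinv g = id" by simp
      then have "pinv g \<circ> (g \<circ> y \<circ> pinv g) \<circ> g = pinv g \<circ> g" by simp
      then show ?thesis using g by (simp add: fun_eq_iff)
    qed
    have orb_sub: "orb w \<subseteq> orb y" if w: "w \<in> orb y" for w y
    proof
      fix u assume "u \<in> orb w"
      then obtain g h where gh: "g \<in> G" "h \<in> G" "u = g \<circ> (h \<circ> y \<circ> pinv h) \<circ> pinv g"
        using w by (auto simp: orb_def)
      then have "u = (g \<circ> h) \<circ> y \<circ> pinv (g \<circ> h)" by (simp add: invc comp_assoc)
      then show "u \<in> orb y" unfolding orb_def using G_comp gh by blast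
    qed
    have orb_sym: "y \<in> orb w" if w: "w \<in> orb y" for w y
    proof -
      obtain g where g: "g \<in> G" "w = g \<circ> y \<circ> pinv g" using w by (auto simp: orb_def)
      then have "y = pinv g \<circ> w \<circ> pinv (pinv g)"
        using G_bij[OF g(1)] by (simp add: fun_eq_iff inv_inv_eq)
      then show ?thesis unfolding orb_def using G_inv g by blast
    qed
    have disj: "orb y = orb w" if "u \<in> orb y" "u \<in> orb w" for u y w
      using orb_sub orb_sym that by blast
    define C where "C = orb ` (G - {id})"
    have U: "\<Union>C = G - {id}"
    proof
      show "\<Union>C \<subseteq> G - {id}" unfolding C_def using orbG id_orb by fastforce
      show "G - {id} \<subseteq> \<Union>C" unfolding C_def using mem by blast
    qed
    have pdvd: "p dvd card (orb y)" if y: "y \<in> G - {id}" for y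
    proof -
      obtain m where m: "card (orb y) = p ^ m"
        using orbit_card_prime_power[OF sub subset_refl, of "\<lambda>g y. g \<circ> y \<circ> pinv g" y] invc
        by (auto simp: orb_def comp_assoc)
      have "m \<noteq> 0"
      proof
        assume "m = 0"
        then have "card (orb y) = 1" using m by simp
        then have eq: "orb y = {y}" using mem[of y] by (metis card_1_singletonE singletonD)
        have "y \<circ> g = g \<circ> y" if g: "g \<in> G" for g
        proof -
          have "g \<circ> y \<circ> pinv g = y" using eq g by (auto simp: orb_def)
          then have "g \<circ> y \<circ> pinv g \<circ> g = y \<circ> g" by simp
          then show ?thesis using g by (simp add: comp_assoc)
        qed
        then show False using neg y by auto
      qed
      then show ?thesis using m by (simp add: dvd_power)
    qed
    have "p dvd card (\<Union>C)"
    proof (rule dvd_partition)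
      show "finite (\<Union>C)" unfolding U using finite_G by simp
      show "\<forall>c\<in>C. p dvd card c" unfolding C_def using pdvd by blast
      show "\<forall>c1\<in>C. \<forall>c2\<in>C. c1 \<noteq> c2 \<longrightarrow> c1 \<inter> c2 = {}"
        unfolding C_def using disj by fast
    qed
    then have "p dvd card G - 1" using U G_id finite_G by simp
    moreover have "p dvd card G"
    proof -
      obtain k where k: "card G = p ^ k" using card_G by blast
      have "k \<noteq> 0"
      proof
        assume "k = 0"
        then have "card G = 1" using k by simp
        then have "G = {id}" using G_id by (metis card_1_singletonE singletonD)
        moreover have "0 < p^2" "1 < p^2" using one_less_power[OF p_gt_1, of 2] by auto
        ultimately show False using G_trans[of 0 1] by auto
      qed
      then show ?thesis using k by (simp add: dvd_power)
    qed
    moreover have "card G > 0" using finite_G G_id card_gt_0_iff by blast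
    ultimately have "p dvd 1"
      by (metis One_nat_def Suc_leI dvd_diffD1)
    then show False using p_gt_1 by simp
  qed
  then obtain y where y: "y \<in> G" "y \<noteq> id" "\<And>g. g \<in> G \<Longrightarrow> y \<circ> g = g \<circ> y" by blast
  obtain k where k: "card G = p ^ k" using card_G by blast
  \<comment> \<open>\<open>y\<close> has \<open>p\<close>-power order; in the chain of its iterated
    \<open>p\<close>-th powers the last one before \<open>id\<close> has order
    \<open>p\<close>.\<close>
  define a where "a = (LEAST a. y ^^ (p ^ a) = id)"
  have a: "y ^^ (p ^ a) = id"
    unfolding a_def by (rule LeastI[of _ k]) (use G_pow_card[OF y(1)] k in simp)
  have "a \<noteq> 0" using a y(2) by (cases a) auto
  then have nid: "y ^^ (p ^ (a - 1)) \<noteq> id"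
    using not_less_Least[of "a - 1" "\<lambda>a. y ^^ (p ^ a) = id"] unfolding a_def[symmetric] by auto
  let ?z = "y ^^ (p ^ (a - 1))"
  have "p ^ (a - 1) * p = p ^ a" using \<open>a \<noteq> 0\<close> by (cases a) auto
  then have "?z ^^ p = y ^^ (p ^ a)" by (simp only: funpow_mult)
  moreover have "?z \<circ> g = g \<circ> ?z" if "g \<in> G" for g
    using funpow_swap[OF y(3)[OF that]] by auto
  ultimately show ?thesis using nid a G_pow[OF y(1)] by auto
qed

end


locale tower = perm_pgroup +
  fixes x0 :: nat and z t :: "nat \<Rightarrow> nat"
  assumes x0: "x0 < p^2"
    and z_in: "z \<in> G" and z_id: "z \<noteq> id" and z_p: "z ^^ p = id"
    and z_central: "\<And>g. g \<in> G \<Longrightarrow> z \<circ> g = g \<circ> z"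
    and t_in: "t \<in> G" and t_block: "\<And>j. t x0 \<noteq> (z ^^ j) x0"
begin

lemma z_comm: "g \<in> G \<Longrightarrow> (z ^^ j) (g x) = g ((z ^^ j) x)"
  using funpow_swap[OF z_central] .

text \<open>A power of \<open>z\<close> with one fixed point fixes every point, since it commutes
  with a transitive group. So all cycles of \<open>z\<close> have length \<open>p\<close>.\<close>

lemma z_pow_fix:
  assumes "x < p^2" "(z ^^ j) x = x"
  shows "p dvd j"
proof (rule ccontr)
  assume "\<not> p dvd j"
  moreover have "z ^^ j = id"
  proof (rule G_eqI[OF G_pow[OF z_in] G_id])
    fix y assume "y < p^2"
    then obtain g where "g \<in> G" "g x = y" using G_trans assms(1) by blast
    then show "(z ^^ j) y = id y" using z_comm assms(2) by auto
  qed
  ultimately show False using funpow_eq_id_prime[OF prime_p z_p] z_id by blast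
qed

lemma z_pow_mod: "(z ^^ (j mod p)) x = (z ^^ j) x"
  using z_p by (intro funpow_mod_eq) simp

lemma z_pow_less: "(z ^^ j) x < p^2 \<longleftrightarrow> x < p^2"
  using G_less[OF G_pow[OF z_in]] .

lemma z_pow_eq:
  assumes "x < p^2"
  shows "(z ^^ j) x = (z ^^ l) x \<longleftrightarrow> [j = l] (mod p)"
proof
  show "[j = l] (mod p)" if "(z ^^ j) x = (z ^^ l) x" for j l
    using that
  proof (induction j l rule: linorder_wlog)
    case (le j l)
    then have "(z ^^ j) x = (z ^^ j) ((z ^^ (l - j)) x)"
      by (metis comp_apply funpow_add le_add_diff_inverse)
    then have "(z ^^ (l - j)) x = x" using G_inj[OF G_pow[OF z_in]] by metis
    then have "p dvd l - j" using z_pow_fix assms by blast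
    then show ?case using le by (metis cong_altdef_nat cong_sym_eq)
  qed (auto simp: cong_sym_eq)
  show "[j = l] (mod p) \<Longrightarrow> (z ^^ j) x = (z ^^ l) x"
    by (metis cong_def z_pow_mod)
qed

section \<open>The block system of \<open>z\<close> and the kernel of the action on it\<close>

definition blk :: "nat \<Rightarrow> nat \<Rightarrow> bool" where
  "blk x y \<longleftrightarrow> (\<exists>j. y = (z ^^ j) x)"

lemma blk_refl: "blk x x"
  unfolding blk_def by (rule exI[of _ 0]) simp

lemma blk_sym: "blk x y \<Longrightarrow> blk y x"
proof -
  assume "blk x y"
  then obtain j where j: "y = (z ^^ j) x" by (auto simp: blk_def)
  have "j + (p - 1) * j = p * j" using p_gt_1 by (cases p) auto
  then have "(z ^^ ((p - 1) * j)) y = (z ^^ (p * j)) x"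
    unfolding j by (metis comp_apply funpow_add add.commute)
  also have "\<dots> = x" using z_p by (simp flip: funpow_mult)
  finally show ?thesis unfolding blk_def by metis
qed

lemma blk_trans: "blk x y \<Longrightarrow> blk y w \<Longrightarrow> blk x w"
  unfolding blk_def by (metis comp_apply funpow_add)

lemma blk_map: "g \<in> G \<Longrightarrow> blk x y \<Longrightarrow> blk (g x) (g y)"
  unfolding blk_def using z_comm by metis

lemma blk_less: "blk x y \<Longrightarrow> y < p^2 \<longleftrightarrow> x < p^2"
  unfolding blk_def using z_pow_less by auto

lemma blk_set: "{y. blk x y} = (\<lambda>j. (z ^^ j) x) ` {..<p}"
  unfolding blk_def using z_pow_mod[symmetric] by (auto simp: image_iff Bex_def) (metis mod_less_divisor p_pos)

lemma blk_card:
  assumes "x < p^2" shows "card {y. blk x y} = p"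
proof -
  have "inj_on (\<lambda>j. (z ^^ j) x) {..<p}"
    by (intro inj_onI) (auto simp: z_pow_eq assms cong_def)
  then show ?thesis unfolding blk_set by (simp add: card_image)
qed

definition M :: "(nat \<Rightarrow> nat) set" where
  "M = {g \<in> G. \<forall>x<p^2. blk x (g x)}"

lemma M_G: "m \<in> M \<Longrightarrow> m \<in> G" by (simp add: M_def)

lemma M_id: "id \<in> M" by (simp add: M_def G_id blk_refl)

lemma M_comp: "m \<in> M \<Longrightarrow> n \<in> M \<Longrightarrow> m \<circ> n \<in> M"
  by (auto simp: M_def G_comp G_less intro: blk_trans)

lemma M_inv: "m \<in> M \<Longrightarrow> pinv m \<in> M"
proof -
  assume m: "m \<in> M"
  have "blk x (pinv m x)" if "x < p^2" for x
    using m that G_less[OF G_inv[of m]] blk_sym[of "pinv m x" x]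
    by (auto simp: M_def dest!: spec[of _ "pinv m x"])
  then show ?thesis using m by (simp add: M_def G_inv)
qed

lemma M_pow: "m \<in> M \<Longrightarrow> m ^^ n \<in> M"
  by (induction n) (auto simp: M_id M_comp)

lemma z_M: "z \<in> M"
  unfolding M_def blk_def using z_in by (auto intro: exI[of _ 1])

lemma M_conj: "m \<in> M \<Longrightarrow> g \<in> G \<Longrightarrow> g \<circ> m \<circ> pinv g \<in> M"
proof -
  assume m: "m \<in> M" and g: "g \<in> G"
  have "blk x (g (m (pinv g x)))" if "x < p^2" for x
    using m g that G_less[OF G_inv[OF g]] blk_map[OF g, of "pinv g x" "m (pinv g x)"]
    by (simp add: M_def)
  then show ?thesis using m g by (simp add: M_def G_inv G_comp)
qed

text \<open>The stabilizer of one block has orbits of \<open>p\<close>-power length on the fewer than \<open>p\<^sup>2\<close> points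
  outside of it, and these orbits are unions of blocks; so each of them is a block.\<close>

lemma M_I:
  assumes g: "g \<in> G" and x: "x < p^2" and gx: "blk x (g x)"
  shows "g \<in> M"
proof -
  define K where "K = {g \<in> G. blk x (g x)}"
  have K: "subgroup K (perm_grp (p^2))"
  proof (rule group.subgroupI[OF group_perm_grp])
    show "K \<subseteq> carrier (perm_grp (p^2))" using G_perm by (auto simp: K_def)
    show "K \<noteq> {}" using G_id blk_refl by (auto simp: K_def intro!: exI[of _ id])
    fix a b assume a: "a \<in> K" and b: "b \<in> K"
    have "blk x (pinv a x)" using a blk_map[OF G_inv, of a x "a x"] blk_sym by (auto simp: K_def)
    then show "inv\<^bsub>perm_grp (p^2)\<^esub> a \<in> K"
      using a by (simp add: K_def inv_perm_grp G_perm G_inv)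
    show "a \<otimes>\<^bsub>perm_grp (p^2)\<^esub> b \<in> K"
      using a b blk_map[of a x "b x"] blk_trans by (auto simp: K_def G_comp)
  qed
  have "blk y (h y)" if y: "y < p^2" and h: "h \<in> K" for y h
  proof (cases "blk x y")
    case True
    then show ?thesis using h blk_map[of h x y] blk_sym blk_trans unfolding K_def by blast
  next
    case False
    define Ob where "Ob = (\<lambda>g. g y) ` K"
    obtain m where m: "card Ob = p ^ m"
      using orbit_card_prime_power[OF K, of "\<lambda>g y. g y" y] by (auto simp: Ob_def K_def)
    have sub: "Ob \<subseteq> {..<p^2}" using y by (auto simp: Ob_def K_def G_less)
    have fin: "finite Ob" using sub finite_subset by blast
    have disj: "Ob \<inter> {w. blk x w} = {}"
    proof -
      have False if a: "a \<in> G" "blk x (a x)" "blk x (a y)" for a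
      proof -
        have "blk (a x) (a y)" using a blk_sym blk_trans by blast
        then have "blk (pinv a (a x)) (pinv a (a y))" using a G_inv blk_map by blast
        then show False using False a by simp
      qed
      then show ?thesis by (auto simp: Ob_def K_def)
    qed
    have finb: "finite {w. blk u w}" for u unfolding blk_set by simp
    have "Ob \<union> {w. blk x w} \<subseteq> {..<p^2}" using sub x blk_less by auto
    then have "card (Ob \<union> {w. blk x w}) \<le> p^2"
      using card_mono[OF finite_lessThan] by (metis card_lessThan)
    then have "p ^ m + p \<le> p^2"
      using card_Un_disjoint[OF fin finb disj] m blk_card[OF x] by simp
    \<comment> \<open>The orbit \<open>Ob\<close> leaves room for the block of \<open>x\<close>;
      this makes the inequality strict.\<close>
    then have "p ^ m < p ^ 2" using p_pos by linarith
    then have "m < 2" using p_gt_1 power_less_imp_less_exp by blast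
    then have "card Ob \<le> p" using m p_gt_1 by (cases m) (auto simp: less_Suc_eq)
    moreover have sub2: "{w. blk y w} \<subseteq> Ob"
    proof
      fix w assume "w \<in> {w. blk y w}"
      then obtain j where j: "w = (z ^^ j) y" by (auto simp: blk_def)
      have "z ^^ j \<in> K" using G_pow z_in by (auto simp: K_def blk_def)
      then show "w \<in> Ob" using j by (auto simp: Ob_def)
    qed
    ultimately have "{w. blk y w} = Ob"
      using card_seteq[OF fin sub2] blk_card[OF y] by simp
    then show ?thesis using h by (auto simp: Ob_def)
  qed
  then show ?thesis using g gx by (auto simp: M_def K_def)
qed

text \<open>The row index is not reduced modulo \<open>p\<close>: if \<open>t ^^ p = z ^^ k\<close>,
  then \<open>P p j = P 0 (j + k)\<close>, so the rows close up with a twist. With unbounded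
  \<open>i\<close>, the action of \<open>t\<close> is \<open>i + 1\<close> without a case
  distinction.\<close>

definition P :: "nat \<Rightarrow> nat \<Rightarrow> nat" where
  "P i j = (t ^^ i) ((z ^^ j) x0)"

lemma P_less [simp]: "P i j < p^2"
  unfolding P_def using G_less[OF G_pow[OF t_in]] z_pow_less x0 by simp

lemma z_P: "(z ^^ n) (P i j) = P i (j + n)"
  unfolding P_def z_comm[OF G_pow[OF t_in]] by (metis add.commute comp_apply funpow_add)

lemma z_P1: "z (P i j) = P i (Suc j)"
  using z_P[of 1] by simp

lemma t_P: "(t ^^ n) (P i j) = P (i + n) j"
  unfolding P_def by (metis add.commute comp_apply funpow_add)

lemma t_P1: "t (P i j) = P (Suc i) j"
  using t_P[of 1] by simp

lemma P_eq: "P i j = P i j' \<longleftrightarrow> [j = j'] (mod p)"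
  unfolding P_def using G_inj[OF G_pow[OF t_in]] z_pow_eq[OF x0] by simp

lemma P_mod: "P i (j mod p) = P i j"
  unfolding P_eq by (simp add: cong_def)

lemma blk_P: "blk (P i j) x \<longleftrightarrow> (\<exists>j'. x = P i j')"
proof
  assume "\<exists>j'. x = P i j'"
  then obtain j' where j': "x = P i j'" by blast
  have "j + (j' + (p - 1) * j) = j' + p * j" using p_gt_1 by (cases p) auto
  then have "[j' = j + (j' + (p - 1) * j)] (mod p)" by (simp only: cong_def mod_mult_self2)
  then have "x = (z ^^ (j' + (p - 1) * j)) (P i j)"
    unfolding z_P j' P_eq .
  then show "blk (P i j) x" unfolding blk_def by blast
qed (auto simp: blk_def z_P)

text \<open>One count gives both facts. Let \<open>d\<close> be the least positive exponent with
  \<open>t ^^ d\<close> in \<open>M\<close>. It divides \<open>card G\<close>, hence is a power of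
  \<open>p\<close>, and it is not 1. The rows below \<open>d\<close> are disjoint, and
  \<open>d * p\<close> points fit into \<open>p^2\<close> only if \<open>d = p\<close>.\<close>

lemma t_pow_M: "t ^^ n \<in> M \<longleftrightarrow> p dvd n"
  and P_inj: "i < p \<Longrightarrow> i' < p \<Longrightarrow> P i j = P i' j' \<Longrightarrow> i = i'"
proof -
  define d where "d = (LEAST d. d > 0 \<and> t ^^ d \<in> M)"
  have cG: "card G > 0" using finite_G G_id card_gt_0_iff by blast
  have "d > 0 \<and> t ^^ d \<in> M"
    unfolding d_def by (rule LeastI[of _ "card G"]) (simp add: cG G_pow_card[OF t_in] M_id)
  then have d: "d > 0" "t ^^ d \<in> M" by auto
  have min: "\<not> (0 < n \<and> t ^^ n \<in> M)" if "n < d" for n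
    using not_less_Least that unfolding d_def by blast
  have dvd: "d dvd n" if n: "t ^^ n \<in> M" for n
  proof -
    have 1: "t ^^ (d * (n div d)) \<in> M" using M_pow[OF d(2)] by (simp flip: funpow_mult)
    have "t ^^ n = t ^^ (d * (n div d)) \<circ> t ^^ (n mod d)"
      by (simp flip: funpow_add)
    then have "pinv (t ^^ (d * (n div d))) \<circ> t ^^ n = t ^^ (n mod d)"
      using M_G[OF 1] by (simp add: fun_eq_iff)
    then have "t ^^ (n mod d) \<in> M" using 1 n M_inv M_comp by metis
    then show ?thesis using min[of "n mod d"] d(1) by auto
  qed
  have "d dvd card G" by (rule dvd) (simp add: G_pow_card[OF t_in] M_id)
  then obtain s where s: "d = p ^ s"
    using card_G divides_primepow_nat[OF prime_p] by auto
  have tM: "t \<notin> M" using x0 t_block by (auto simp: M_def blk_def)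
  have "s \<noteq> 0" using s d(2) tM by (cases s) auto
  have inj: "i = i'" if "i < d" "i' < d" "P i j = P i' j'" for i i' j j'
    using that
  proof (induction i i' arbitrary: j j' rule: linorder_wlog)
    case (le i i')
    have "(t ^^ i) ((z ^^ j) x0) = (t ^^ i) ((t ^^ (i' - i)) ((z ^^ j') x0))"
      using le(4) unfolding P_def using le(1) by (metis comp_apply funpow_add le_add_diff_inverse)
    then have "(z ^^ j) x0 = (t ^^ (i' - i)) ((z ^^ j') x0)" 
      using G_inj[OF G_pow[OF t_in]] by blast
    then have "(z ^^ j) x0 = (z ^^ j') ((t ^^ (i' - i)) x0)" using z_comm[OF G_pow[OF t_in]] by simp
    then have "blk x0 ((t ^^ (i' - i)) x0)"
      using blk_sym blk_trans unfolding blk_def by metis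
    then have "t ^^ (i' - i) \<in> M" using M_I G_pow t_in x0 by blast
    then have "d dvd i' - i" by (rule dvd)
    then show ?case using le(1,3) by (auto dest!: dvd_imp_le)
  next
    case (sym i i')
    then show ?case by metis
  qed
  have "inj_on (\<lambda>(i, j). P i j) ({..<d} \<times> {..<p})"
  proof (rule inj_onI, clarify)
    fix i j i' j' assume a: "i < d" "j < p" "i' < d" "j' < p" "P i j = P i' j'"
    then have "i = i'" using inj by blast
    then show "i = i' \<and> j = j'" using a P_eq by (auto simp: cong_def)
  qed
  then have "card ((\<lambda>(i, j). P i j) ` ({..<d} \<times> {..<p})) = d * p" by (simp add: card_image)
  moreover have "(\<lambda>(i, j). P i j) ` ({..<d} \<times> {..<p}) \<subseteq> {..<p^2}" by auto
  ultimately have "d * p \<le> p^2" by (metis card_lessThan card_mono finite_lessThan)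
  then have "p ^ s \<le> p ^ 1" using s p_pos by (simp add: power2_eq_square)
  then have "s \<le> 1" using p_gt_1 power_le_imp_le_exp by blast
  then have "d = p" using s \<open>s \<noteq> 0\<close> by (cases s) auto
  show "t ^^ n \<in> M \<longleftrightarrow> p dvd n"
  proof
    assume "p dvd n"
    then obtain q where "n = d * q" using \<open>d = p\<close> by auto
    then show "t ^^ n \<in> M" using M_pow[OF d(2), of q] by (simp add: funpow_mult)
  qed (use dvd \<open>d = p\<close> in auto)
  show "i < p \<Longrightarrow> i' < p \<Longrightarrow> P i j = P i' j' \<Longrightarrow> i = i'" using inj \<open>d = p\<close> by blast
qed

lemma P_surj:
  assumes "x < p^2"
  obtains i j where "i < p" "j < p" "x = P i j"
proof -
  have "inj_on (\<lambda>(i, j). P i j) ({..<p} \<times> {..<p})"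
  proof (rule inj_onI, clarify)
    fix i j i' j' assume a: "i < p" "j < p" "i' < p" "j' < p" "P i j = P i' j'"
    then have "i = i'" using P_inj by blast
    then show "i = i' \<and> j = j'" using a P_eq by (auto simp: cong_def)
  qed
  then have "card ((\<lambda>(i, j). P i j) ` ({..<p} \<times> {..<p})) = card {..<p^2}"
    by (simp add: card_image power2_eq_square)
  moreover have "(\<lambda>(i, j). P i j) ` ({..<p} \<times> {..<p}) \<subseteq> {..<p^2}" by auto
  ultimately have "(\<lambda>(i, j). P i j) ` ({..<p} \<times> {..<p}) = {..<p^2}"
    using card_subset_eq[OF finite_lessThan] by blast
  then have "x \<in> (\<lambda>(i, j). P i j) ` ({..<p} \<times> {..<p})" using assms by simp
  then show ?thesis using that by auto
qed

definition row :: "nat \<Rightarrow> nat" where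
  "row x = (SOME i. i < p \<and> (\<exists>j. x = P i j))"

definition col :: "nat \<Rightarrow> nat" where
  "col x = (SOME j. j < p \<and> x = P (row x) j)"

lemma row_less: "x < p^2 \<Longrightarrow> row x < p"
  and col_less: "x < p^2 \<Longrightarrow> col x < p"
  and P_row_col: "x < p^2 \<Longrightarrow> P (row x) (col x) = x"
proof -
  assume x: "x < p^2"
  obtain i j where ij: "i < p" "j < p" "x = P i j" using P_surj x by blast
  have "row x < p \<and> (\<exists>j. x = P (row x) j)"
    unfolding row_def by (rule someI[of _ i]) (use ij in blast)
  then obtain j' where j': "row x < p" "x = P (row x) j'" by blast
  have "col x < p \<and> x = P (row x) (col x)"
    unfolding col_def by (rule someI[of _ "j' mod p"]) (use j' P_mod in auto)
  then show "row x < p" "col x < p" "P (row x) (col x) = x" using j' by auto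
qed

lemma row_P: "i < p \<Longrightarrow> row (P i j) = i"
  using P_inj row_less P_row_col P_less by metis

lemma col_P: "i < p \<Longrightarrow> col (P i j) = j mod p"
  using P_row_col[of "P i j"] row_P[of i j] P_eq[of i "col (P i j)" j] col_less[of "P i j"]
  by (simp add: cong_def)

lemma G_decomp:
  assumes "g \<in> G"
  obtains a m where "a < p" "m \<in> M" "g = t ^^ a \<circ> m"
proof -
  obtain a b where ab: "a < p" "b < p" "g x0 = P a b"
    using P_surj[of "g x0"] G_less assms x0 by blast
  define m where "m = pinv (t ^^ a) \<circ> g"
  have mG: "m \<in> G" unfolding m_def using assms G_inv G_comp G_pow t_in by blast
  have "m x0 = (z ^^ b) x0" unfolding m_def using ab(3) G_pow[OF t_in] by (simp add: P_def)
  then have "m \<in> M" using M_I[OF mG x0] by (auto simp: blk_def)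
  moreover have "g = t ^^ a \<circ> m" unfolding m_def using G_pow[OF t_in] by (simp add: fun_eq_iff)
  ultimately show ?thesis using that ab(1) by blast
qed

text \<open>\<open>LEAST\<close> selects the representative below \<open>p\<close> (see
  \<open>f_less\<close>), so congruent values are equal. As in \<open>P\<close>, the index
  \<open>i\<close> may be \<open>p\<close> or larger.\<close>

definition f :: "nat \<Rightarrow> (nat \<Rightarrow> nat) \<Rightarrow> nat" where
  "f i m = (LEAST j. m (P i 0) = P i j)"

lemma M_P:
  assumes "m \<in> M" shows "m (P i j) = P i (j + f i m)"
proof -
  have "blk (P i 0) (m (P i 0))" using assms by (simp add: M_def)
  then have "\<exists>j. m (P i 0) = P i j" unfolding blk_P .
  then have 0: "m (P i 0) = P i (f i m)" unfolding f_def by (rule LeastI_ex)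
  have "m (P i j) = m ((z ^^ j) (P i 0))" by (simp add: z_P)
  also have "\<dots> = (z ^^ j) (m (P i 0))" using z_comm M_G assms by metis
  finally show ?thesis using 0 by (simp add: z_P add.commute)
qed

lemma f_cong: "m \<in> M \<Longrightarrow> [f i m = n] (mod p) \<longleftrightarrow> m (P i 0) = P i n"
  using M_P[of m i 0] P_eq by auto

lemma f_less: "m \<in> M \<Longrightarrow> f i m < p"
proof -
  assume m: "m \<in> M"
  have "m (P i 0) = P i (f i m mod p)" using M_P[OF m, of i 0] P_mod by simp
  then have "f i m \<le> f i m mod p" unfolding f_def by (rule Least_le)
  then show ?thesis using mod_less_divisor[OF p_pos, of "f i m"] by linarith
qed

lemma f_eqI: "m \<in> M \<Longrightarrow> n < p \<Longrightarrow> m (P i 0) = P i n \<Longrightarrow> f i m = n"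
  using f_cong f_less by (metis cong_less_modulus_unique_nat)

lemma f_comp:
  assumes "m \<in> M" "n \<in> M" shows "[f i (m \<circ> n) = f i m + f i n] (mod p)"
  unfolding f_cong[OF M_comp[OF assms]] using M_P[OF assms(1)] M_P[OF assms(2)] by (simp add: add.commute)

lemma f_z: "f i z = 1"
  by (rule f_eqI[OF z_M p_gt_1]) (simp add: z_P1)

lemma f_id: "f i id = 0"
  by (rule f_eqI[OF M_id p_pos]) simp

lemma f_pow:
  assumes "m \<in> M" shows "[f i (m ^^ n) = n * f i m] (mod p)"
proof (induction n)
  case (Suc n)
  have "[f i (m \<circ> m ^^ n) = f i m + f i (m ^^ n)] (mod p)"
    using f_comp assms M_pow by blast
  also have "[f i m + f i (m ^^ n) = f i m + n * f i m] (mod p)"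
    using Suc by (intro cong_add) auto
  finally show ?case by (simp only: funpow.simps mult_Suc)
qed (simp add: f_id[unfolded id_def] f_id)

text \<open>\<open>t\<close> carries \<open>P i j\<close> to \<open>P (Suc i) j\<close> and thus
  transports shifts from each block to the next. Iterated, this reduces statements about all blocks
  to the first ones.\<close>

lemma f_conj:
  assumes "m \<in> M" shows "f (Suc i) (t \<circ> m \<circ> pinv t) = f i m"
proof (rule f_eqI[OF M_conj[OF assms t_in] f_less[OF assms]])
  show "(t \<circ> m \<circ> pinv t) (P (Suc i) 0) = P (Suc i) (f i m)"
    using M_P[OF assms, of i 0] t_in by (simp flip: t_P1)
qed

lemma f_conj':
  assumes "m \<in> M" shows "f i (pinv t \<circ> m \<circ> t) = f (Suc i) m"
proof -
  have "pinv t \<circ> m \<circ> t \<in> M"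
    using M_conj[OF assms G_inv[OF t_in]] G_bij[OF t_in] by (simp add: inv_inv_eq)
  moreover have "t \<circ> (pinv t \<circ> m \<circ> t) \<circ> pinv t = m" using t_in by (simp add: fun_eq_iff)
  ultimately show ?thesis using f_conj by metis
qed

lemma M_conj': "m \<in> M \<Longrightarrow> pinv t \<circ> m \<circ> t \<in> M"
  using M_conj[OF _ G_inv[OF t_in]] G_bij[OF t_in] by (simp add: inv_inv_eq)

section \<open>The shifts embed \<open>M\<close> into a power of Z/p\<close>

lemma M_eqI:
  assumes "m \<in> M" "n \<in> M" "\<And>i. i < p \<Longrightarrow> f i m = f i n"
  shows "m = n"
proof (rule G_eqI)
  fix x assume "x < p^2"
  then obtain i j where "i < p" "x = P i j" using P_surj by blast
  then show "m x = n x" using M_P[OF assms(1)] M_P[OF assms(2)] assms(3) by simp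
qed (use assms M_G in auto)

text \<open>By \<open>f_conj\<close>, commuting with \<open>t\<close> makes the shift the same on
  every block, and such elements are powers of \<open>z\<close>. This will be applied to
  \<open>t ^^ p\<close> and to commutators with \<open>t\<close>.\<close>

lemma centralizer_t:
  assumes m: "m \<in> M" and tm: "t \<circ> m = m \<circ> t"
  shows "f i m = f 0 m" and "m = z ^^ f 0 m"
proof -
  have "t \<circ> m \<circ> pinv t = m" unfolding tm comp_assoc G_inv_comp(2)[OF t_in] by simp
  then have "f (Suc i) m = f i m" for i
    using f_conj[OF m, of i] by metis
  then have 1: "f i m = f 0 m" for i
    by (induction i) simp_all
  then show "f i m = f 0 m" .
  have "f i (z ^^ f 0 m) = f 0 m" for i
    by (rule f_eqI) (simp_all add: M_pow z_M f_less m z_P)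
  then have "f i m = f i (z ^^ f 0 m)" for i using 1[of i] by metis
  then show "m = z ^^ f 0 m" by (intro M_eqI m M_pow z_M)
qed

lemma t_p: obtains k where "t ^^ p = z ^^ k"
proof -
  have "t ^^ p \<in> M" by (simp add: t_pow_M)
  moreover have "t \<circ> t ^^ p = t ^^ p \<circ> t" by (simp add: fun_eq_iff funpow_swap1)
  ultimately show ?thesis using that centralizer_t(2) by blast
qed

lemma M_p: assumes "m \<in> M" shows "m ^^ p = id"
proof (rule M_eqI[OF M_pow[OF assms] M_id])
  fix i
  have "[f i (m ^^ p) = 0] (mod p)" using f_pow[OF assms, of i p] by (simp add: cong_def)
  then show "f i (m ^^ p) = f i id"
    using f_less[OF M_pow[OF assms], of i p] by (simp add: f_id cong_def)
qed

lemma M_commute: assumes "m \<in> M" "n \<in> M" shows "m \<circ> n = n \<circ> m"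
proof (rule G_eqI)
  fix x assume "x < p^2"
  then obtain i j where "x = P i j" using P_surj by blast
  then show "(m \<circ> n) x = (n \<circ> m) x" using M_P[OF assms(1)] M_P[OF assms(2)] by (simp add: add_ac)
qed (use assms M_G G_comp in auto)

text \<open>\<open>f 1 - f 0\<close> is additive on \<open>M\<close> modulo \<open>p\<close>, so a
  suitable power brings a nonzero value to 1. Such an element acts as a normalized shear.\<close>

lemma shear_exists:
  assumes h: "h \<in> M" "f 1 h \<noteq> f 0 h"
  obtains k where "[f 1 (h ^^ k) = f 0 (h ^^ k) + 1] (mod p)"
proof -
  define d where "d = f 1 h + p - f 0 h"
  have d: "[f 1 h = f 0 h + d] (mod p)"
    unfolding d_def using f_less[OF h(1), of 0] by (simp add: cong_def)
  have "\<not> p dvd d"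
  proof
    assume "p dvd d"
    then have "[f 0 h + d = f 0 h + 0] (mod p)" by (intro cong_add cong_refl) (simp add: cong_0_iff)
    then have "[f 1 h = f 0 h] (mod p)" using d cong_trans by fastforce
    then show False using h f_less[OF h(1)] by (simp add: cong_def)
  qed
  then obtain b where b: "[d * b = Suc 0] (mod p)" using inverse_mod_prime[OF prime_p] by blast
  show ?thesis
  proof (rule that[of b])
    have "[f 1 (h ^^ b) = b * f 1 h] (mod p)" using f_pow h(1) by blast
    also have "[b * f 1 h = b * (f 0 h + d)] (mod p)" using d cong_scalar_left by blast
    also have "b * (f 0 h + d) = b * f 0 h + d * b" by (simp add: algebra_simps)
    also have "[b * f 0 h + d * b = f 0 (h ^^ b) + 1] (mod p)"
      using cong_add[OF cong_sym[OF f_pow[OF h(1), of 0 b]] b] by simp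
    finally show "[f 1 (h ^^ b) = f 0 (h ^^ b) + 1] (mod p)" .
  qed
qed

text \<open>The powers of \<open>h\<close> complement the kernel of the additive map
  \<open>f 1 - f 0\<close>: \<open>k\<close> is the value of this map at \<open>m\<close>, and
  \<open>n\<close> is \<open>m\<close> times the power \<open>-k\<close> of
  \<open>h\<close>.\<close>

lemma shear_decomp:
  assumes h: "h \<in> M" "[f 1 h = f 0 h + 1] (mod p)" and m: "m \<in> M"
  obtains n k where "n \<in> M" "f 1 n = f 0 n" "m = n \<circ> h ^^ k" "[f 1 m = f 0 m + k] (mod p)"
proof -
  define k where "k = f 1 m + p - f 0 m"
  have k: "[f 1 m = f 0 m + k] (mod p)"
    unfolding k_def using f_less[OF m, of 0] by (simp add: cong_def)
  \<comment> \<open>\<open>q\<close> stands for \<open>-k\<close> modulo \<open>p\<close> within the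
    natural numbers.\<close>
  define q where "q = p * k - k"
  have qk: "k + q = p * k" unfolding q_def using p_gt_1 by (cases p) auto
  define n where "n = m \<circ> h ^^ q"
  have n: "n \<in> M" unfolding n_def using m h M_pow M_comp by blast
  have fn: "[f i n = f i m + q * f i h] (mod p)" for i
    unfolding n_def using f_comp[OF m M_pow[OF h(1)], of i q] f_pow[OF h(1), of i q]
    by (meson cong_add cong_refl cong_trans)
  have "[f 1 n = f 1 m + q * f 1 h] (mod p)" by (rule fn)
  also have "[f 1 m + q * f 1 h = (f 0 m + k) + q * (f 0 h + 1)] (mod p)"
    using k h(2) cong_scalar_left cong_add by blast
  also have "(f 0 m + k) + q * (f 0 h + 1) = (f 0 m + q * f 0 h) + (k + q)"
    by (simp add: algebra_simps)
  also have "[(f 0 m + q * f 0 h) + (k + q) = f 0 m + q * f 0 h] (mod p)"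
    unfolding qk by (simp add: cong_def)
  also have "[f 0 m + q * f 0 h = f 0 n] (mod p)" using fn cong_sym by blast
  finally have "f 1 n = f 0 n" using f_less[OF n] by (simp add: cong_def)
  moreover have "m = n \<circ> h ^^ k"
  proof -
    have "h ^^ q \<circ> h ^^ k = h ^^ (p * k)" using qk by (simp add: add.commute flip: funpow_add)
    also have "\<dots> = id" using M_p[OF h(1)] by (simp flip: funpow_mult)
    finally show ?thesis unfolding n_def comp_assoc by simp
  qed
  ultimately show ?thesis using that n k by blast
qed

end

section \<open>Monomial projective representations\<close>

lemma complex_root_exists:
  assumes "n > 0" obtains a :: complex where "a ^ n = b"
proof
  have "rcis (root n (cmod b)) (Arg b / n) ^ n = rcis (cmod b) (Arg b)"
    using assms by (simp add: DeMoivre2)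
  then show "rcis (root n (cmod b)) (Arg b / n) ^ n = b" by (simp add: rcis_cmod_Arg)
qed

lemma power_cong_root_unity:
  fixes e :: "'a::field"
  assumes "e ^ n = 1" "[i = j] (mod n)"
  shows "e ^ i = e ^ j"
proof -
  have "e ^ i = e ^ (i mod n)" for i
  proof -
    have "e ^ i = e ^ (n * (i div n) + i mod n)" by simp
    also have "\<dots> = e ^ (i mod n)" unfolding power_add power_mult using assms(1) by simp
    finally show ?thesis .
  qed
  then show ?thesis using assms(2) unfolding cong_def by metis
qed

lemma power_eq_1_prime:
  fixes e :: "'a::field"
  assumes "Factorial_Ring.prime p" "e ^ p = 1" "e ^ n = 1" "\<not> p dvd n"
  shows "e = 1"
proof -
  obtain a where "[n * a = Suc 0] (mod p)" using inverse_mod_prime[OF assms(1,4)] by blast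
  then have "e ^ (n * a) = e ^ Suc 0" by (rule power_cong_root_unity[OF assms(2)])
  then show ?thesis using assms(3) by (simp add: power_mult)
qed

text \<open>\<open>W g\<close> lists the nonzero entries, column by column, of a monomial matrix above the permutation
  matrix of \<open>g\<close>; these matrices form a projective representation.\<close>

definition proj_cocycle :: "nat \<Rightarrow> (nat \<Rightarrow> nat) set \<Rightarrow> ((nat \<Rightarrow> nat) \<Rightarrow> nat \<Rightarrow> complex) \<Rightarrow> bool" where
  "proj_cocycle N G W \<longleftrightarrow> (\<forall>g\<in>G. \<forall>x<N. W g x \<noteq> 0) \<and>
     (\<forall>g\<in>G. \<forall>h\<in>G. \<exists>c. c \<noteq> 0 \<and> (\<forall>x<N. W (g \<circ> h) x * c = W g (h x) * W h x))"

text \<open>\<open>F\<close> is a common eigenvector without zero entries and \<open>K g\<close> is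
  the eigenvalue of the matrix over \<open>g\<close>. Conjugation by the diagonal matrix of
  \<open>F\<close> turns the matrices into scalar multiples of permutation matrices.\<close>

definition coh_trivial :: "nat \<Rightarrow> (nat \<Rightarrow> nat) set \<Rightarrow> ((nat \<Rightarrow> nat) \<Rightarrow> nat \<Rightarrow> complex) \<Rightarrow> bool" where
  "coh_trivial N D W \<longleftrightarrow> (\<exists>F K. (\<forall>x<N. F x \<noteq> 0) \<and> (\<forall>g\<in>D. \<forall>x<N. W g x = K g * F (g x) / F x))"

text \<open>The trace that triviality on the cyclic group of \<open>g\<close> leaves on single
  entries: at a fixed point of \<open>g\<close> the entry is the eigenvalue.\<close>

definition fix_const :: "nat \<Rightarrow> (nat \<Rightarrow> nat) set \<Rightarrow> ((nat \<Rightarrow> nat) \<Rightarrow> nat \<Rightarrow> complex) \<Rightarrow> bool" where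
  "fix_const N G W \<longleftrightarrow> (\<forall>g\<in>G. \<forall>x<N. \<forall>y<N. g x = x \<longrightarrow> g y = y \<longrightarrow> W g x = W g y)"

text \<open>A change of gauge: conjugation by a diagonal matrix \<open>F\<close>, and new scalars
  \<open>K\<close> for the lifts.\<close>

definition cohomologous ::
  "nat \<Rightarrow> (nat \<Rightarrow> nat) set \<Rightarrow> ((nat \<Rightarrow> nat) \<Rightarrow> nat \<Rightarrow> complex) \<Rightarrow> ((nat \<Rightarrow> nat) \<Rightarrow> nat \<Rightarrow> complex) \<Rightarrow> bool"
where
  "cohomologous N G W W' \<longleftrightarrow> (\<exists>F K. (\<forall>x<N. F x \<noteq> 0) \<and> (\<forall>g\<in>G. K g \<noteq> 0) \<and>
     (\<forall>g\<in>G. \<forall>x<N. W' g x = K g * W g x * F (g x) / F x))"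

lemma cohomologousE:
  assumes "cohomologous N G W W'"
  obtains F K where "\<And>x. x < N \<Longrightarrow> F x \<noteq> 0" "\<And>g. g \<in> G \<Longrightarrow> K g \<noteq> 0"
    "\<And>g x. g \<in> G \<Longrightarrow> x < N \<Longrightarrow> W' g x = K g * W g x * F (g x) / F x"
proof -
  obtain F K where "(\<forall>x<N. F x \<noteq> 0) \<and> (\<forall>g\<in>G. K g \<noteq> 0) \<and>
      (\<forall>g\<in>G. \<forall>x<N. W' g x = K g * W g x * F (g x) / F x)"
    using assms unfolding cohomologous_def by (elim exE)
  then show ?thesis by (intro that[of F K]) simp_all
qed

section \<open>Calculus of the matrix entries and of changes of gauge\<close>

locale cocycle = perm_pgroup +
  fixes W :: "(nat \<Rightarrow> nat) \<Rightarrow> nat \<Rightarrow> complex"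
  assumes W: "proj_cocycle (p^2) G W"
begin

lemma W_nz: "g \<in> G \<Longrightarrow> x < p^2 \<Longrightarrow> W g x \<noteq> 0"
  using W by (auto simp: proj_cocycle_def)

lemma W_comp:
  assumes "g \<in> G" "h \<in> G"
  obtains c where "c \<noteq> 0" "\<And>x. x < p^2 \<Longrightarrow> W (g \<circ> h) x * c = W g (h x) * W h x"
  using W assms unfolding proj_cocycle_def by blast

lemma W_commute:
  assumes g: "g \<in> G" and h: "h \<in> G" and gh: "g \<circ> h = h \<circ> g"
  obtains c where "c \<noteq> 0" "\<And>x. x < p^2 \<Longrightarrow> W g (h x) * W h x = c * (W h (g x) * W g x)"
proof -
  obtain a where a: "a \<noteq> 0" "\<And>x. x < p^2 \<Longrightarrow> W (g \<circ> h) x * a = W g (h x) * W h x"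
    using W_comp g h by blast
  obtain b where b: "b \<noteq> 0" "\<And>x. x < p^2 \<Longrightarrow> W (h \<circ> g) x * b = W h (g x) * W g x"
    using W_comp g h by blast
  show ?thesis
  proof (rule that[of "a / b"])
    fix x assume x: "x < p^2"
    have "W g (h x) * W h x = W (g \<circ> h) x * a" using a(2)[OF x] by simp
    also have "\<dots> = (a / b) * (W (h \<circ> g) x * b)" using b(1) gh by simp
    finally show "W g (h x) * W h x = (a / b) * (W h (g x) * W g x)" using b(2)[OF x] by simp
  qed (use a b in simp)
qed

lemma W_id: obtains c where "c \<noteq> 0" "\<And>x. x < p^2 \<Longrightarrow> W id x = c"
proof -
  obtain c where c: "c \<noteq> 0" "\<And>x. x < p^2 \<Longrightarrow> W (id \<circ> id) x * c = W id (id x) * W id x"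
    using W_comp G_id by blast
  show ?thesis by (rule that[OF c(1)]) (use c(2) W_nz[OF G_id] in auto)
qed

text \<open>The \<open>n\<close>-th power of the matrix over \<open>g\<close> lies over
  \<open>g ^^ n\<close>; so up to one scalar the entries are products along orbits.\<close>

lemma W_pow:
  assumes g: "g \<in> G"
  shows "\<exists>c. c \<noteq> 0 \<and> (\<forall>x<p^2. W (g ^^ n) x * c = (\<Prod>l<n. W g ((g ^^ l) x)))"
proof (induction n)
  case 0
  obtain c where c: "c \<noteq> 0" "\<And>x. x < p^2 \<Longrightarrow> W id x = c" using W_id by blast
  then show ?case by (intro exI[of _ "1 / c"]) (simp add: id_def)
next
  case (Suc n)
  then obtain c where c: "c \<noteq> 0" "\<And>x. x < p^2 \<Longrightarrow> W (g ^^ n) x * c = (\<Prod>l<n. W g ((g ^^ l) x))"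
    by blast
  obtain d where d: "d \<noteq> 0" "\<And>x. x < p^2 \<Longrightarrow> W (g \<circ> g ^^ n) x * d = W g ((g ^^ n) x) * W (g ^^ n) x"
    using W_comp g G_pow by blast
  have "W (g \<circ> g ^^ n) x * (d * c) = (\<Prod>l<Suc n. W g ((g ^^ l) x))" if x: "x < p^2" for x
  proof -
    have "W (g \<circ> g ^^ n) x * (d * c) = (W (g \<circ> g ^^ n) x * d) * c" by simp
    also have "\<dots> = W g ((g ^^ n) x) * (W (g ^^ n) x * c)" unfolding d(2)[OF x] by simp
    finally show ?thesis unfolding c(2)[OF x] by simp
  qed
  then have "d * c \<noteq> 0 \<and> (\<forall>x<p^2. W (g ^^ Suc n) x * (d * c) = (\<Prod>l<Suc n. W g ((g ^^ l) x)))"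
    unfolding funpow.simps using c(1) d(1) by simp
  then show ?case by blast
qed

text \<open>The matrix over \<open>g ^^ n\<close> is a scalar multiple of a power of the matrix over
  \<open>g\<close>. Hence the two commute exactly, not only up to a scalar.\<close>

lemma W_commute_pow:
  assumes g: "g \<in> G" and x: "x < p^2"
  shows "W g ((g ^^ n) x) * W (g ^^ n) x = W (g ^^ n) (g x) * W g x"
proof -
  obtain c where c: "c \<noteq> 0" "\<And>x. x < p^2 \<Longrightarrow> W (g ^^ n) x * c = (\<Prod>l<n. W g ((g ^^ l) x))"
    using W_pow[OF g] by blast
  have gx: "g x < p^2" using g x G_less by simp
  have "W g ((g ^^ n) x) * W (g ^^ n) x * c = (\<Prod>l<Suc n. W g ((g ^^ l) x))"
    using c(2)[OF x] by (simp add: mult.assoc)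
  also have "\<dots> = W g x * (\<Prod>l<n. W g ((g ^^ Suc l) x))"
    by (subst prod.lessThan_Suc_shift) simp
  also have "\<dots> = W g x * (W (g ^^ n) (g x) * c)"
    unfolding c(2)[OF gx] by (simp add: funpow_swap1)
  finally have "(W g ((g ^^ n) x) * W (g ^^ n) x) * c = (W (g ^^ n) (g x) * W g x) * c"
    by (simp add: mult_ac)
  then show ?thesis using c(1) by simp
qed

text \<open>The elements whose matrix has the eigenvector \<open>F\<close> are closed under
  composition, so it is enough to check an eigenvector on generators.\<close>

lemma coh_trivial_comp:
  assumes F: "\<And>x. x < p^2 \<Longrightarrow> F x \<noteq> (0::complex)" and g: "g \<in> G" and h: "h \<in> G"
    and Kg: "\<And>x. x < p^2 \<Longrightarrow> W g x = Kg * F (g x) / F x"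
    and Kh: "\<And>x. x < p^2 \<Longrightarrow> W h x = Kh * F (h x) / F x"
  shows "\<exists>K. \<forall>x<p^2. W (g \<circ> h) x = K * F ((g \<circ> h) x) / F x"
proof -
  obtain c where c: "c \<noteq> 0" "\<And>x. x < p^2 \<Longrightarrow> W (g \<circ> h) x * c = W g (h x) * W h x"
    using W_comp g h by blast
  have "W (g \<circ> h) x = (Kg * Kh / c) * F ((g \<circ> h) x) / F x" if x: "x < p^2" for x
  proof -
    have hx: "h x < p^2" using x h G_less by simp
    have "W (g \<circ> h) x * c = Kg * F (g (h x)) / F (h x) * (Kh * F (h x) / F x)"
      unfolding c(2)[OF x] Kg[OF hx] Kh[OF x] ..
    also have "\<dots> = Kg * Kh * F (g (h x)) / F x" using F[OF hx] F[OF x] by (simp add: field_simps)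
    finally show ?thesis using c(1) F[OF x] by (simp add: field_simps)
  qed
  then show ?thesis by blast
qed

lemma coh_trivial_fix:
  assumes "coh_trivial (p^2) D W" "g \<in> D" "x < p^2" "y < p^2" "g x = x" "g y = y"
  shows "W g x = W g y"
  using assms unfolding coh_trivial_def by (auto split: if_splits)

lemma coh_trivial_commute:
  assumes D: "coh_trivial (p^2) D W" "g \<in> D" "h \<in> D" and G: "g \<in> G" "h \<in> G"
    and gh: "g \<circ> h = h \<circ> g" and x: "x < p^2"
  shows "W g (h x) * W h x = W h (g x) * W g x"
proof -
  obtain F K where F: "\<And>x. x < p^2 \<Longrightarrow> F x \<noteq> 0"
    and K: "\<And>g x. g \<in> D \<Longrightarrow> x < p^2 \<Longrightarrow> W g x = K g * F (g x) / F x"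
    using D(1) unfolding coh_trivial_def by blast
  have s: "g (h x) = h (g x)" using gh by (simp add: fun_eq_iff)
  have "h x < p^2" "g x < p^2" using G x G_less by auto
  then show ?thesis using K D(2,3) x F s by (simp add: mult_ac)
qed

lemma cohomologous_proj_cocycle:
  assumes "cohomologous (p^2) G W W'" shows "proj_cocycle (p^2) G W'"
proof -
  obtain F K where F: "\<And>x. x < p^2 \<Longrightarrow> F x \<noteq> 0" "\<And>g. g \<in> G \<Longrightarrow> K g \<noteq> 0"
    and W': "\<And>g x. g \<in> G \<Longrightarrow> x < p^2 \<Longrightarrow> W' g x = K g * W g x * F (g x) / F x"
    using cohomologousE[OF assms] by metis
  have "\<exists>c. c \<noteq> 0 \<and> (\<forall>x<p^2. W' (g \<circ> h) x * c = W' g (h x) * W' h x)"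
    if g: "g \<in> G" and h: "h \<in> G" for g h
  proof -
    obtain c where c: "c \<noteq> 0" "\<And>x. x < p^2 \<Longrightarrow> W (g \<circ> h) x * c = W g (h x) * W h x"
      using W_comp g h by blast
    have gh: "g \<circ> h \<in> G" using g h G_comp by blast
    have "W' (g \<circ> h) x * (K g * K h * c / K (g \<circ> h)) = W' g (h x) * W' h x" if x: "x < p^2" for x
    proof -
      have hx: "h x < p^2" "g (h x) < p^2" using g h x G_less by auto
      have "W' g (h x) * W' h x = K g * K h * (W g (h x) * W h x) * F (g (h x)) / F x"
        unfolding W'[OF g hx(1)] W'[OF h x] using F(1)[OF hx(1)] by simp
      also have "\<dots> = K g * K h * c * W (g \<circ> h) x * F (g (h x)) / F x"
        unfolding c(2)[OF x, symmetric] by simp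
      finally show ?thesis unfolding W'[OF gh x] using F(2)[OF gh] by simp
    qed
    then show ?thesis using F(2) g h gh c(1) by (intro exI[of _ "K g * K h * c / K (g \<circ> h)"]) simp
  qed
  then show ?thesis unfolding proj_cocycle_def using F W' W_nz G_less by auto
qed

lemma cohomologous_fix_const:
  assumes "cohomologous (p^2) G W W'" "fix_const (p^2) G W" shows "fix_const (p^2) G W'"
  using cohomologousE[OF assms(1)] assms(2) unfolding fix_const_def
  by (smt (verit) nonzero_mult_div_cancel_right)

lemma cohomologous_trivial:
  assumes "cohomologous (p^2) G W W'" and D: "D \<subseteq> G" and triv: "coh_trivial (p^2) D W'"
  shows "coh_trivial (p^2) D W"
proof -
  obtain F K where F: "\<And>x. x < p^2 \<Longrightarrow> F x \<noteq> 0" "\<And>g. g \<in> G \<Longrightarrow> K g \<noteq> 0"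
    and W': "\<And>g x. g \<in> G \<Longrightarrow> x < p^2 \<Longrightarrow> W' g x = K g * W g x * F (g x) / F x"
    using assms(1) by (elim cohomologousE) metis
  obtain E L where E: "\<And>x. x < p^2 \<Longrightarrow> E x \<noteq> 0"
    and L: "\<And>g x. g \<in> D \<Longrightarrow> x < p^2 \<Longrightarrow> W' g x = L g * E (g x) / E x"
    using triv unfolding coh_trivial_def by blast
  have "W g x = (L g / K g) * (E (g x) / F (g x)) / (E x / F x)" if g: "g \<in> D" and x: "x < p^2" for g x
  proof -
    have gG: "g \<in> G" using g D by auto
    have "F (g x) \<noteq> 0" using F(1) G_less gG x by blast
    then show ?thesis
      using W'[OF gG x] L[OF g x] F(1)[OF x] F(2)[OF gG] E[OF x] by (simp add: field_simps)
  qed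
  then show ?thesis unfolding coh_trivial_def using F(1) E
    by (intro exI[of _ "\<lambda>x. E x / F x"] exI[of _ "\<lambda>g. L g / K g"]) simp
qed

text \<open>Both sides are multiplied by the same factor \<open>C\<close>, so the commutator scalar
  is a gauge invariant and may be computed in any convenient gauge.\<close>

lemma cohomologous_commutator:
  assumes "cohomologous (p^2) G W W'" and g: "g \<in> G" and h: "h \<in> G" and x: "x < p^2"
    and gh: "g \<circ> h = h \<circ> g"
  shows "W' g (h x) * W' h x = c * (W' h (g x) * W' g x) \<longleftrightarrow> W g (h x) * W h x = c * (W h (g x) * W g x)"
proof -
  obtain F K where F: "\<And>x. x < p^2 \<Longrightarrow> F x \<noteq> 0" "\<And>g. g \<in> G \<Longrightarrow> K g \<noteq> 0"
    and W': "\<And>g x. g \<in> G \<Longrightarrow> x < p^2 \<Longrightarrow> W' g x = K g * W g x * F (g x) / F x"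
    using assms(1) by (elim cohomologousE) metis
  have s: "g (h x) = h (g x)" using gh by (simp add: fun_eq_iff)
  have l: "h x < p^2" "g x < p^2" "h (g x) < p^2" using g h x G_less by auto
  define C where "C = K g * K h * F (h (g x)) / F x"
  have "C \<noteq> 0" unfolding C_def using F g h x l by simp
  moreover have "W' g (h x) * W' h x = C * (W g (h x) * W h x)"
    unfolding W'[OF g l(1)] W'[OF h x] C_def s using F(1)[OF l(1)] by simp
  moreover have "W' h (g x) * W' g x = C * (W h (g x) * W g x)"
    unfolding W'[OF h l(2)] W'[OF g x] C_def using F(1)[OF l(2)] by simp
  ultimately show ?thesis by simp
qed

lemmas cohomologous_commute = cohomologous_commutator[where c = 1, simplified]

text \<open>On each nontrivial cycle of \<open>d\<close> the normalized entries have product \<open>1\<close>, so their partial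
  products along the cycle, started at its least element, diagonalize.\<close>

lemma coh_trivial_cyclic:
  assumes d: "d \<in> G" "d ^^ p = id" and fixd: "\<And>x y. x < p^2 \<Longrightarrow> y < p^2 \<Longrightarrow> d x = x \<Longrightarrow> d y = y \<Longrightarrow> W d x = W d y"
  shows "coh_trivial (p^2) (range (\<lambda>n. d ^^ n)) W"
proof -
  obtain c where c: "c \<noteq> 0" "\<And>x. x < p^2 \<Longrightarrow> W (d ^^ p) x * c = (\<Prod>l<p. W d ((d ^^ l) x))"
    using W_pow[OF d(1)] by blast
  obtain c' where c': "c' \<noteq> 0" "\<And>x. x < p^2 \<Longrightarrow> W id x = c'" using W_id by blast
  have L: "(\<Prod>l<p. W d ((d ^^ l) x)) = c' * c" if "x < p^2" for x
    using c(2)[OF that] c'(2)[OF that] d(2) by simp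
  have pow_less: "(d ^^ n) x < p^2 \<longleftrightarrow> x < p^2" for n x using G_less[OF G_pow[OF d(1)]] .
  have fix_pow: "(d ^^ n) x = x" if "d x = x" for n x
    using that by (induction n) auto
  \<comment> \<open>\<open>r\<close> will be the eigenvalue at \<open>d\<close>, and its
    \<open>p\<close>-th power has to be the scalar to which the \<open>p\<close>-th power of the
    matrix reduces. If \<open>d\<close> has fixed points, \<open>r\<close> must also be the entry
    there, which \<open>fixd\<close> makes consistent.\<close>
  obtain r where r: "r ^ p = c' * c" "\<And>x. x < p^2 \<Longrightarrow> d x = x \<Longrightarrow> W d x = r"
  proof (cases "\<exists>y<p^2. d y = y")
    case True
    then obtain y where y: "y < p^2" "d y = y" by blast
    have "W d y ^ p = c' * c" using L[OF y(1)] fix_pow[OF y(2)] by simp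
    then show ?thesis using that[of "W d y"] fixd y by blast
  next
    case False
    obtain r where "r ^ p = c' * c" using complex_root_exists p_pos by blast
    then show ?thesis using that False by blast
  qed
  have r_nz: "r \<noteq> 0" using r(1) c(1) c'(1) p_gt_1 by (auto simp: power_0_left split: if_splits)
  define A where "A n x = (\<Prod>l<n. W d ((d ^^ l) x) / r)" for n x
  have A_nz: "A n x \<noteq> 0" if "x < p^2" for n x
    unfolding A_def using W_nz[OF d(1)] pow_less that r_nz by simp
  have A_add: "A (n + n') x = A n x * A n' ((d ^^ n) x)" for n n' x
  proof -
    have "A (n + n') x = A n x * (\<Prod>l\<in>{n..<n + n'}. W d ((d ^^ l) x) / r)"
      unfolding A_def by (simp add: lessThan_atLeast0 prod.atLeastLessThan_concat)
    also have "(\<Prod>l\<in>{n..<n + n'}. W d ((d ^^ l) x) / r) = (\<Prod>l<n'. W d ((d ^^ (l + n)) x) / r)"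
      using prod.shift_bounds_nat_ivl[of _ 0 n n'] by (simp add: lessThan_atLeast0 add.commute)
    finally show ?thesis unfolding A_def by (simp add: funpow_add)
  qed
  have A_p: "A p x = 1" if "x < p^2" for x
    unfolding A_def prod_dividef using L[OF that] r(1) c(1) c'(1) by simp
  have A_pq: "A (n + p * q) x = A n x" if "x < p^2" for n q x
  proof (induction q)
    case (Suc q)
    have "A (n + p * Suc q) x = A (n + p * q) x * A p ((d ^^ (n + p * q)) x)"
      using A_add[of "n + p * q" p x] by (simp add: algebra_simps)
    then show ?case using Suc A_p pow_less that by simp
  qed simp
  \<comment> \<open>Off the fixed points, two exponents that reach the same point differ by a
    multiple of \<open>p\<close>, and a full turn contributes 1. At a fixed point every factor is
    1.\<close>
  have A_eq: "A n x = A n' x" if x: "x < p^2" and eq: "(d ^^ n) x = (d ^^ n') x" for n n' x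
  proof (cases "d x = x")
    case True
    have "W d ((d ^^ l) x) = r" for l using fix_pow[OF True] r(2)[OF x True] by simp
    then show ?thesis unfolding A_def using r_nz by simp
  next
    case False
    have "A n x = A n' x" if "n \<le> n'" "(d ^^ n) x = (d ^^ n') x" for n n'
    proof -
      have "(d ^^ n) x = (d ^^ n) ((d ^^ (n' - n)) x)"
        using that by (metis comp_apply funpow_add le_add_diff_inverse)
      then have fixn: "(d ^^ (n' - n)) x = x" using G_inj[OF G_pow[OF d(1)]] by metis
      have "p dvd n' - n"
      proof (rule ccontr)
        assume "\<not> p dvd n' - n"
        then obtain b where b: "[(n' - n) * b = Suc 0] (mod p)" using inverse_mod_prime[OF prime_p] by blast
        have "x = (d ^^ ((n' - n) * b)) x"
          by (induction b) (simp_all add: fixn funpow_add)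
        also have "\<dots> = (d ^^ ((n' - n) * b mod p)) x" using d(2) by (intro funpow_mod_eq[symmetric]) simp
        also have "\<dots> = d x" using b p_gt_1 by (simp add: cong_def)
        finally show False using False by simp
      qed
      then obtain q where "n' - n = p * q" by blast
      then have "n' = n + p * q" using that by simp
      then show ?thesis using A_pq[OF x] by simp
    qed
    then show ?thesis using eq by (metis nat_le_linear)
  qed
  define rep where "rep x = (LEAST y. \<exists>n. (d ^^ n) y = x)" for x
  \<comment> \<open>By \<open>A_eq\<close> the value does not depend on the exponent that
    \<open>SOME\<close> selects.\<close>
  define F where "F x = A (SOME n. (d ^^ n) (rep x) = x) (rep x)" for x
  have rep: "\<exists>n. (d ^^ n) (rep x) = x" for x
    unfolding rep_def by (rule LeastI[of _ x]) (rule exI[of _ 0], simp)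
  have rep_d: "rep (d x) = rep x" for x
  proof -
    have "(\<exists>n. (d ^^ n) y = d x) \<longleftrightarrow> (\<exists>n. (d ^^ n) y = x)" for y
    proof
      assume "\<exists>n. (d ^^ n) y = d x"
      then obtain n where n: "(d ^^ n) y = d x" by blast
      have "(d ^^ (p - 1 + n)) y = (d ^^ (p - 1)) (d x)" using n by (simp add: funpow_add)
      also have "\<dots> = (d ^^ Suc (p - 1)) x" by (simp only: funpow_Suc_right comp_apply)
      also have "\<dots> = x" using d(2) p_pos by simp
      finally show "\<exists>n. (d ^^ n) y = x" by blast
    next
      assume "\<exists>n. (d ^^ n) y = x"
      then obtain n where "(d ^^ n) y = x" by blast
      then have "(d ^^ Suc n) y = d x" by simp
      then show "\<exists>n. (d ^^ n) y = d x" by blast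
    qed
    then show ?thesis unfolding rep_def by simp
  qed
  have rep_less: "rep x < p^2" if "x < p^2" for x using rep[of x] pow_less that by metis
  have F: "F x = A n (rep x)" if "x < p^2" "(d ^^ n) (rep x) = x" for n x
    unfolding F_def by (rule A_eq[OF rep_less[OF that(1)]]) (use someI_ex[OF rep] that in simp)
  have F_nz: "F x \<noteq> 0" if "x < p^2" for x unfolding F_def using A_nz rep_less that by blast
  have Kd: "W d x = r * F (d x) / F x" if x: "x < p^2" for x
  proof -
    obtain n where n: "(d ^^ n) (rep x) = x" using rep by blast
    have "(d ^^ Suc n) (rep (d x)) = d x" unfolding rep_d using n by simp
    then have "F (d x) = A (Suc n) (rep x)" using F[of "d x" "Suc n"] G_less[OF d(1)] x rep_d by simp
    also have "\<dots> = A n (rep x) * (W d x / r)" unfolding A_def using n by simp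
    also have "A n (rep x) = F x" using F[OF x n] by simp
    finally show ?thesis using F_nz[OF x] r_nz by simp
  qed
  have "\<exists>K. \<forall>x<p^2. W (d ^^ n) x = K * F ((d ^^ n) x) / F x" for n
  proof (induction n)
    case 0
    show ?case using c' F_nz by (intro exI[of _ c']) (simp add: id_def)
  next
    case (Suc n)
    then obtain K where "\<And>x. x < p^2 \<Longrightarrow> W (d ^^ n) x = K * F ((d ^^ n) x) / F x" by blast
    from coh_trivial_comp[OF F_nz d(1) G_pow[OF d(1)] Kd this] show ?case by (simp only: funpow.simps)
  qed
  then have "\<forall>g\<in>range (\<lambda>n. d ^^ n). \<exists>K. \<forall>x<p^2. W g x = K * F (g x) / F x" by blast
  then obtain K where "\<forall>g\<in>range (\<lambda>n. d ^^ n). \<forall>x<p^2. W g x = K g * F (g x) / F x" by metis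
  then show ?thesis unfolding coh_trivial_def using F_nz by blast
qed

end

locale tower_cocycle = tower p G x0 z t + cocycle p G W
  for p G x0 z t W +
  assumes W_fix: "fix_const (p^2) G W"
begin

lemma W_fixD: "g \<in> G \<Longrightarrow> x < p^2 \<Longrightarrow> y < p^2 \<Longrightarrow> g x = x \<Longrightarrow> g y = y \<Longrightarrow> W g x = W g y"
  using W_fix unfolding fix_const_def by blast

lemma commute_if_t_pow:
  assumes tp: "t ^^ p \<noteq> id" and x: "x < p^2"
  shows "W t (z x) * W z x = W z (t x) * W t x"
proof -
  obtain k where k: "t ^^ p = z ^^ k" using t_p by blast
  have "\<not> p dvd k"
  proof
    assume "p dvd k"
    then have "z ^^ k = id" using z_p by (auto simp flip: funpow_mult)
    then show False using tp k by simp
  qed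
  then obtain a where a: "[k * a = Suc 0] (mod p)" using inverse_mod_prime[OF prime_p] by blast
  have "t ^^ (p * a) = z ^^ (k * a)" using k by (metis funpow_mult)
  also have "\<dots> = z ^^ ((k * a) mod p)" by (auto simp: fun_eq_iff z_pow_mod)
  also have "\<dots> = z" using a p_gt_1 by (simp add: cong_def)
  finally have "z = t ^^ (p * a)" by simp
  then show ?thesis using W_commute_pow[OF t_in x, of "p * a"] by simp
qed

end

text \<open>The gauge in which the matrix over \<open>z\<close> is \<open>a\<close> times a
  permutation matrix; \<open>gauge_z\<close> shows that it can always be reached. In it the matrices
  over \<open>M\<close> are constant on each block.\<close>

locale gauged_cocycle = tower_cocycle p G x0 z t W for p G x0 z t W +
  fixes a :: complex
  assumes W_z: "x < p^2 \<Longrightarrow> W z x = a"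
begin

lemma a_nz: "a \<noteq> 0"
  using W_z[OF x0] W_nz[OF z_in x0] by simp

lemma W_z_pow: "\<exists>c. c \<noteq> 0 \<and> (\<forall>x<p^2. W (z ^^ n) x = c)"
proof -
  obtain c where c: "c \<noteq> 0" "\<And>x. x < p^2 \<Longrightarrow> W (z ^^ n) x * c = (\<Prod>l<n. W z ((z ^^ l) x))"
    using W_pow[OF z_in] by blast
  have "W (z ^^ n) x = a ^ n / c" if "x < p^2" for x
    using c(2)[OF that] c(1) that by (simp add: W_z z_pow_less field_simps)
  then show ?thesis using a_nz c(1) by (intro exI[of _ "a ^ n / c"]) auto
qed

lemma W_t_z: obtains c where "c ^ p = 1" "\<And>x. x < p^2 \<Longrightarrow> W t (z x) = c * W t x"
proof -
  obtain c where c: "c \<noteq> 0" "\<And>x. x < p^2 \<Longrightarrow> W t (z x) * W z x = c * (W z (t x) * W t x)"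
    using W_commute t_in z_in z_central[OF t_in, symmetric] by blast
  have 1: "W t (z x) = c * W t x" if "x < p^2" for x
    using c(2)[OF that] that a_nz by (simp add: W_z G_less t_in)
  have "W t ((z ^^ n) x0) = c ^ n * W t x0" for n
    by (induction n) (simp_all add: 1 z_pow_less x0)
  from this[of p] have "c ^ p = 1" using z_p W_nz[OF t_in x0] by simp
  then show ?thesis using 1 that by blast
qed

text \<open>Multiplying \<open>m\<close> by a power of \<open>z\<close> gives an \<open>n\<close>
  with a fixed point \<open>y\<close>. As \<open>z y\<close> is fixed too, \<open>fix_const\<close>
  equates the entries of \<open>W n\<close> at \<open>y\<close> and \<open>z y\<close>, so the
  commutator scalar of \<open>n\<close> and \<open>z\<close> is 1.\<close>

lemma W_M_z:
  assumes m: "m \<in> M" and x: "x < p^2" shows "W m (z x) = W m x"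
proof -
  have fixed: "W n (z x) = W n x" if n: "n \<in> M" and y: "y < p^2" "n y = y" and x: "x < p^2" for n y x
  proof -
    obtain c where c: "c \<noteq> 0" "\<And>x. x < p^2 \<Longrightarrow> W n (z x) * W z x = c * (W z (n x) * W n x)"
      using W_commute M_G[OF n] z_in z_central[OF M_G[OF n], symmetric] by blast
    have 1: "W n (z x) = c * W n x" if "x < p^2" for x
      using c(2)[OF that] that a_nz by (simp add: W_z G_less M_G n)
    have "n (z y) = z y" using z_comm[OF M_G[OF n], of 1 y] y by simp
    then have "W n (z y) = W n y"
      by (intro W_fixD[OF M_G[OF n]]) (simp_all add: y G_less z_in)
    then have "c = 1" using 1[OF y(1)] W_nz[OF M_G[OF n] y(1)] by simp
    then show ?thesis using 1 x by simp
  qed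
  define k where "k = f 0 m"
  define n where "n = m \<circ> z ^^ (p - k)"
  have n: "n \<in> M" unfolding n_def using m z_M M_pow M_comp by blast
  have kp: "k < p" unfolding k_def using f_less m .
  have "n (P 0 0) = P 0 0"
    unfolding n_def using kp M_P[OF m, of 0] P_eq[of 0 p 0] by (simp add: z_P k_def cong_def)
  note fx = fixed[OF n P_less this]
  have "n \<circ> z ^^ k = m"
  proof -
    have "z ^^ (p - k) \<circ> z ^^ k = id" using kp z_p by (simp flip: funpow_add)
    then show ?thesis unfolding n_def comp_assoc by simp
  qed
  moreover obtain c where c: "c \<noteq> 0" "\<And>x. x < p^2 \<Longrightarrow> W (n \<circ> z ^^ k) x * c = W n ((z ^^ k) x) * W (z ^^ k) x"
    using W_comp[OF M_G[OF n] G_pow[OF z_in, of k]] by blast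
  ultimately have c2: "\<And>x. x < p^2 \<Longrightarrow> W m x * c = W n ((z ^^ k) x) * W (z ^^ k) x" by simp
  obtain d where d: "d \<noteq> 0" "\<And>x. x < p^2 \<Longrightarrow> W (z ^^ k) x = d" using W_z_pow by blast
  have "W m (z x) * c = W n ((z ^^ k) (z x)) * d"
    using c2[of "z x"] d(2)[of "z x"] x G_less z_in by simp
  also have "(z ^^ k) (z x) = z ((z ^^ k) x)" by (simp add: funpow_swap1)
  also have "W n \<dots> = W n ((z ^^ k) x)" using fx x z_pow_less by simp
  also have "\<dots> * d = W m x * c" using c2 d(2) x by simp
  finally show ?thesis using c(1) by simp
qed

definition v :: "nat \<Rightarrow> (nat \<Rightarrow> nat) \<Rightarrow> complex" where
  "v i m = W m (P i 0)"

lemma v_nz: "m \<in> M \<Longrightarrow> v i m \<noteq> 0"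
  unfolding v_def using W_nz M_G by simp

lemma W_M_P: assumes "m \<in> M" shows "W m (P i j) = v i m"
  by (induction j) (simp_all add: v_def W_M_z[OF assms] flip: z_P1)

lemma v_z: "v i z = a" unfolding v_def by (simp add: W_z)

lemma v_comp:
  assumes "m \<in> M" "n \<in> M"
  obtains c where "c \<noteq> 0" "\<And>i. v i (m \<circ> n) * c = v i m * v i n"
proof -
  obtain c where c: "c \<noteq> 0" "\<And>x. x < p^2 \<Longrightarrow> W (m \<circ> n) x * c = W m (n x) * W n x"
    using W_comp M_G assms by blast
  show ?thesis
  proof (rule that[OF c(1)])
    fix i show "v i (m \<circ> n) * c = v i m * v i n"
      using c(2)[of "P i 0"] W_M_P assms M_comp M_P[OF assms(2)] by simp
  qed
qed

text \<open>The projective scalars cancel in this quotient: \<open>ch i\<close> is an honest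
  character of \<open>M\<close>, whereas \<open>v i\<close> is multiplicative only up to
  scalars.\<close>

definition ch :: "nat \<Rightarrow> (nat \<Rightarrow> nat) \<Rightarrow> complex" where
  "ch i m = v (Suc i) m / v i m"

lemma ch_nz: "m \<in> M \<Longrightarrow> ch i m \<noteq> 0"
  unfolding ch_def using v_nz by simp

lemma ch_comp: assumes "m \<in> M" "n \<in> M" shows "ch i (m \<circ> n) = ch i m * ch i n"
proof -
  obtain c where c: "c \<noteq> 0" "\<And>i. v i (m \<circ> n) * c = v i m * v i n"
    using v_comp assms by blast
  have "ch i (m \<circ> n) = (v (Suc i) (m \<circ> n) * c) / (v i (m \<circ> n) * c)"
    unfolding ch_def using c(1) by simp
  then show ?thesis unfolding c(2) ch_def by simp
qed

lemma ch_z: "ch i z = 1" unfolding ch_def v_z using a_nz by simp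

lemma ch_id: "ch i id = 1"
  using ch_comp[OF M_id M_id, of i] ch_nz[OF M_id, of i] by simp

lemma ch_pow: assumes "m \<in> M" shows "ch i (m ^^ n) = ch i m ^ n"
  by (induction n) (simp_all add: ch_id[unfolded id_def] ch_id ch_comp[OF assms M_pow[OF assms], unfolded comp_def] comp_def)

text \<open>After division by a power of \<open>z\<close> the element fixes points in blocks
  \<open>i\<close> and \<open>i + 1\<close>, and \<open>fix_const\<close> equates the two block
  values.\<close>

lemma ch_eq_1:
  assumes m: "m \<in> M" and eq: "f (Suc i) m = f i m" shows "ch i m = 1"
proof -
  define n where "n = m \<circ> z ^^ (p - f i m)"
  have n: "n \<in> M" unfolding n_def using m z_M M_pow M_comp by blast
  have "n (P l 0) = P l 0" if "l = i \<or> l = Suc i" for l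
    unfolding n_def using f_less[OF m, of i] M_P[OF m, of l] P_eq[of l p 0] that eq
    by (auto simp: z_P cong_def)
  then have "v (Suc i) n = v i n" unfolding v_def by (intro W_fixD[OF M_G[OF n]]) simp_all
  then have "ch i n = 1" unfolding ch_def using v_nz[OF n] by simp
  then show ?thesis
    unfolding n_def using ch_comp[OF m M_pow[OF z_M]] ch_pow[OF z_M] ch_z by simp
qed

text \<open>\<open>ch 0\<close> is trivial on the kernel of \<open>f 1 - f 0\<close>, so it is a
  root of unity raised to this difference; the factor on the left avoids a negative exponent.
  \<open>e\<close> is the value at a normalized shear, and 1 if there is none.\<close>

lemma ch_0: obtains e where "e ^ p = 1" "\<And>m. m \<in> M \<Longrightarrow> ch 0 m * e ^ f 0 m = e ^ f 1 m"
proof (cases "\<forall>m\<in>M. f 1 m = f 0 m")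
  case True
  show ?thesis by (rule that[of 1]) (use True ch_eq_1[of _ 0] in auto)
next
  case False
  then obtain h where h: "h \<in> M" "[f 1 h = f 0 h + 1] (mod p)"
    using shear_exists M_pow by metis
  define e where "e = ch 0 h"
  have e: "e ^ p = 1" unfolding e_def using ch_pow[OF h(1), of 0 p] M_p[OF h(1)] ch_id by simp
  show ?thesis
  proof (rule that[OF e])
    fix m assume m: "m \<in> M"
    obtain n k where n: "n \<in> M" "f 1 n = f 0 n" "m = n \<circ> h ^^ k" and k: "[f 1 m = f 0 m + k] (mod p)"
      using shear_decomp[OF h m] by blast
    have "ch 0 m = e ^ k"
      unfolding n(3) e_def using ch_comp[OF n(1) M_pow[OF h(1)]] ch_pow[OF h(1)] ch_eq_1[OF n(1), of 0] n(2) by simp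
    then have "ch 0 m * e ^ f 0 m = e ^ (f 0 m + k)" by (simp add: power_add mult.commute)
    also have "\<dots> = e ^ f 1 m" using power_cong_root_unity[OF e] k cong_sym by blast
    finally show "ch 0 m * e ^ f 0 m = e ^ f 1 m" .
  qed
qed

text \<open>The permutation \<open>t \<circ> m\<close> is also the conjugate of \<open>m\<close>
  followed after \<open>t\<close>, and the two resulting products of matrices differ by a scalar
  \<open>b\<close> that is the same for all blocks. The power of \<open>c\<close> appears because
  \<open>m\<close> shifts block \<open>i\<close> by \<open>f i m\<close> before \<open>W t\<close>
  is applied, and \<open>W t\<close> changes by \<open>c\<close> with each step of
  \<open>z\<close>.\<close>

lemma v_conj:
  assumes c: "\<And>x. x < p^2 \<Longrightarrow> W t (z x) = c * W t x" and m: "m \<in> M"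
  obtains b where "b \<noteq> 0" "\<And>i. v (Suc i) (t \<circ> m \<circ> pinv t) * b = v i m * c ^ f i m"
proof -
  define n where "n = t \<circ> m \<circ> pinv t"
  have n: "n \<in> M" unfolding n_def using M_conj m t_in by blast
  have nt: "n \<circ> t = t \<circ> m" unfolding n_def using t_in by (simp add: fun_eq_iff)
  obtain b1 where b1: "b1 \<noteq> 0" "\<And>x. x < p^2 \<Longrightarrow> W (n \<circ> t) x * b1 = W n (t x) * W t x"
    using W_comp M_G n t_in by blast
  obtain b2 where b2: "b2 \<noteq> 0" "\<And>x. x < p^2 \<Longrightarrow> W (t \<circ> m) x * b2 = W t (m x) * W m x"
    using W_comp M_G m t_in by blast
  have ct: "W t (P i j) = c ^ j * W t (P i 0)" for i j
    by (induction j) (simp_all add: c flip: z_P1)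
  show ?thesis
  proof (rule that[of "b2 / b1"])
    fix i
    have "v (Suc i) n * W t (P i 0) * b2 = W (n \<circ> t) (P i 0) * b1 * b2"
      using b1(2)[of "P i 0"] by (simp add: v_def t_P1)
    also have "\<dots> = (W (t \<circ> m) (P i 0) * b2) * b1" unfolding nt by simp
    also have "\<dots> = W t (P i (f i m)) * v i m * b1"
      using b2(2)[of "P i 0"] M_P[OF m, of i 0] by (simp add: v_def)
    also have "\<dots> = W t (P i 0) * (c ^ f i m * v i m * b1)" unfolding ct[of i "f i m"] by simp
    finally have "W t (P i 0) * (v (Suc i) n * b2) = W t (P i 0) * (v i m * c ^ f i m * b1)"
      by (simp add: mult_ac)
    then have "v (Suc i) n * b2 = v i m * c ^ f i m * b1" using W_nz[OF t_in] by simp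
    then show "v (Suc i) (t \<circ> m \<circ> pinv t) * (b2 / b1) = v i m * c ^ f i m"
      using b1(1) by (simp add: n_def field_simps)
  qed (use b1 b2 in simp)
qed

text \<open>Each conjugation with \<open>t\<close> contributes one factor \<open>c\<close>; the root
  of unity that governs blocks \<open>i\<close> and \<open>i + 1\<close> is therefore
  \<open>c ^ i * e\<close>.\<close>

lemma ch_i:
  assumes c: "c ^ p = 1" "\<And>x. x < p^2 \<Longrightarrow> W t (z x) = c * W t x"
    and e: "\<And>m. m \<in> M \<Longrightarrow> ch 0 m * e ^ f 0 m = e ^ f 1 m"
    and m: "m \<in> M"
  shows "ch i m * (c ^ i * e) ^ f i m = (c ^ i * e) ^ f (Suc i) m"
  using m
proof (induction i arbitrary: m)
  case 0
  then show ?case using e by simp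
next
  case (Suc i)
  define n where "n = pinv t \<circ> m \<circ> t"
  have n: "n \<in> M" unfolding n_def using M_conj' Suc.prems .
  have m: "m = t \<circ> n \<circ> pinv t" unfolding n_def using t_in by (simp add: fun_eq_iff)
  have fn: "f l n = f (Suc l) m" for l unfolding n_def using f_conj' Suc.prems .
  obtain b where b: "b \<noteq> 0" "\<And>i. v (Suc i) m * b = v i n * c ^ f i n"
    using v_conj[OF c(2) n] unfolding m[symmetric] by blast
  have cnz: "c \<noteq> 0" using c(1) p_gt_1 by (auto simp: power_0_left split: if_splits)
  have "ch (Suc i) m = (v (Suc (Suc i)) m * b) / (v (Suc i) m * b)"
    unfolding ch_def using b(1) by simp
  also have "\<dots> = ch i n * c ^ f (Suc i) n / c ^ f i n"
    unfolding b(2) ch_def by simp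
  finally have "ch (Suc i) m * c ^ f i n = ch i n * c ^ f (Suc i) n" using cnz by simp
  then have "ch (Suc i) m * (c ^ Suc i * e) ^ f i n
      = (ch i n * (c ^ i * e) ^ f i n) * c ^ f (Suc i) n"
    by (simp add: power_mult_distrib mult_ac)
  also have "\<dots> = (c ^ Suc i * e) ^ f (Suc i) n"
    unfolding Suc.IH[OF n] by (simp add: power_mult_distrib mult_ac)
  finally show ?case unfolding fn .
qed

text \<open>Equal entries on blocks 0 and 2 give \<open>ch 0 m * ch 1 m = 1\<close>, whereas
  \<open>ch_0\<close> and \<open>ch_i\<close> evaluate this product to \<open>c\<close> to the power
  \<open>- f 1 m\<close>. Since \<open>p\<close> does not divide \<open>f 1 m\<close>, it follows
  that \<open>c = 1\<close>.\<close>

lemma commute_if_fixes_two_blocks: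
  assumes m: "m \<in> M" "f 0 m = 0" "f 2 m = 0" "f 1 m \<noteq> 0" and x: "x < p^2"
  shows "W t (z x) * W z x = W z (t x) * W t x"
proof -
  obtain c where c: "c ^ p = 1" "\<And>x. x < p^2 \<Longrightarrow> W t (z x) = c * W t x" using W_t_z by blast
  obtain e where e: "e ^ p = 1" "\<And>m. m \<in> M \<Longrightarrow> ch 0 m * e ^ f 0 m = e ^ f 1 m"
    using ch_0 by blast
  have 0: "ch 0 m = e ^ f 1 m" using e(2)[OF m(1)] m(2) by simp
  have 1: "ch 1 m * (c * e) ^ f 1 m = 1"
    using ch_i[OF c e(2) m(1), of 1] m(3) by (simp add: numeral_2_eq_2)
  have "m (P 0 0) = P 0 0" "m (P 2 0) = P 2 0" using M_P[OF m(1)] m(2,3) by simp_all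
  then have "v 0 m = v 2 m" unfolding v_def by (intro W_fixD[OF M_G[OF m(1)]]) simp_all
  then have "ch 0 m * ch 1 m = 1"
    unfolding ch_def using v_nz[OF m(1)] by (simp add: numeral_2_eq_2)
  then have "c ^ f 1 m = c ^ f 1 m * (ch 0 m * ch 1 m)" by simp
  also have "\<dots> = ch 1 m * (c * e) ^ f 1 m" unfolding 0 by (simp add: power_mult_distrib)
  finally have "c ^ f 1 m = 1" using 1 by simp
  moreover have "\<not> p dvd f 1 m" using m(4) f_less[OF m(1), of 1] by (auto dest: dvd_imp_le)
  ultimately have "c = 1" using power_eq_1_prime[OF prime_p c(1)] by blast
  then show ?thesis using c(2)[OF x] x G_less t_in by (simp add: W_z mult.commute)
qed

text \<open>With commutator 1 all \<open>ch i\<close> come from the same \<open>e\<close>, so the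
  block values of \<open>W m\<close> are proportional to \<open>e ^ f i m\<close>. This is what an
  eigenvector with entry \<open>e ^ j * s i\<close> at \<open>P i j\<close> requires, and the row
  factors \<open>s\<close> are free to absorb the entries of \<open>W t\<close>.\<close>

lemma coh_trivial_if_commute:
  assumes tz: "\<And>x. x < p^2 \<Longrightarrow> W t (z x) * W z x = W z (t x) * W t x"
  shows "coh_trivial (p^2) G W"
proof -
  have tz1: "W t (z x) = 1 * W t x" if "x < p^2" for x
    using tz[OF that] that a_nz G_less t_in by (simp add: W_z mult.commute)
  obtain e where e: "e ^ p = 1" "\<And>m. m \<in> M \<Longrightarrow> ch 0 m * e ^ f 0 m = e ^ f 1 m"
    using ch_0 by blast
  have enz: "e \<noteq> 0" using e(1) p_gt_1 by (auto simp: power_0_left split: if_splits)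
  have ch: "ch i m * e ^ f i m = e ^ f (Suc i) m" if "m \<in> M" for i m
    using ch_i[OF _ tz1 e(2) that, of i] by simp
  have v: "v i m = v 0 m / e ^ f 0 m * e ^ f i m" if m: "m \<in> M" for i m
  proof (induction i)
    case (Suc i)
    have "v (Suc i) m = ch i m * v i m" unfolding ch_def using v_nz[OF m] by simp
    also have "\<dots> = v 0 m / e ^ f 0 m * (ch i m * e ^ f i m)" unfolding Suc by simp
    finally show ?case unfolding ch[OF m] .
  qed (use enz in simp)
  define T where "T i = W t (P i 0)" for i
  have T_nz: "T i \<noteq> 0" for i unfolding T_def using W_nz t_in by simp
  have W_t: "W t (P i j) = T i" for i j
    by (induction j) (simp_all add: T_def tz1 flip: z_P1)
  obtain k where k: "t ^^ p = z ^^ k" using t_p by blast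
  \<comment> \<open>\<open>d\<close> will be the eigenvalue at \<open>t\<close>. Its
    \<open>p\<close>-th power is prescribed so that \<open>s p = e ^ k\<close>, matching the twist
    \<open>t ^^ p = z ^^ k\<close> when the rows close up.\<close>
  obtain d where d: "d ^ p = (\<Prod>i<p. T i) / e ^ k" using complex_root_exists p_pos by blast
  have "d ^ p \<noteq> 0" using d T_nz enz by simp
  then have d_nz: "d \<noteq> 0" using p_gt_1 by (auto simp: power_0_left split: if_splits)
  define s where "s i = (\<Prod>l<i. T l / d)" for i
  have s_nz: "s i \<noteq> 0" for i unfolding s_def using T_nz d_nz by simp
  have s_p: "s p = e ^ k"
    unfolding s_def prod_dividef using d T_nz enz \<open>d ^ p \<noteq> 0\<close> by (simp add: field_simps)
  define F where "F x = e ^ col x * s (row x)" for x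
  have F_P: "F (P i j) = e ^ j * s i" if i: "i < p" for i j
    unfolding F_def row_P[OF i] col_P[OF i]
    using power_cong_root_unity[OF e(1), of "j mod p" j] by (simp add: cong_def)
  \<comment> \<open>The case \<open>Suc i = p\<close> is the wrap-around, where
    \<open>P p j = P 0 (j + k)\<close> has to be read in row 0.\<close>
  have F_P': "F (P (Suc i) j) = e ^ j * s (Suc i)" if "i < p" for i j
  proof (cases "Suc i < p")
    case False
    then have "Suc i = p" using that by simp
    moreover have "P p j = P 0 (j + k)"
      using t_P[of p 0 j] z_P[of k 0 j] k by simp
    ultimately show ?thesis using F_P[of 0 "j + k"] s_p p_pos
      by (simp add: power_add s_def)
  qed (use F_P in blast)
  have F_nz: "F x \<noteq> 0" for x unfolding F_def using enz s_nz by simp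
  have Kt: "W t x = d * F (t x) / F x" if x: "x < p^2" for x
  proof -
    obtain i j where ij: "i < p" "x = P i j" using P_surj x by blast
    have "s (Suc i) = s i * (T i / d)" unfolding s_def by simp
    then show ?thesis unfolding ij(2) t_P1 W_t F_P[OF ij(1)] F_P'[OF ij(1)]
      using d_nz s_nz enz by simp
  qed
  have KM: "\<exists>K. \<forall>x<p^2. W m x = K * F (m x) / F x" if m: "m \<in> M" for m
  proof (intro exI allI impI)
    fix x assume x: "x < p^2"
    obtain i j where ij: "i < p" "x = P i j" using P_surj x by blast
    show "W m x = v 0 m / e ^ f 0 m * F (m x) / F x"
      unfolding ij(2) M_P[OF m] F_P[OF ij(1)] W_M_P[OF m] v[OF m, of i]
      using s_nz enz by (simp add: power_add)
  qed
  have "\<exists>K. \<forall>x<p^2. W ((t ^^ n) \<circ> m) x = K * F (((t ^^ n) \<circ> m) x) / F x" if m: "m \<in> M" for m n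
  proof (induction n)
    case 0
    then show ?case using KM[OF m] by simp
  next
    case (Suc n)
    then obtain K where K: "\<And>x. x < p^2 \<Longrightarrow> W ((t ^^ n) \<circ> m) x = K * F (((t ^^ n) \<circ> m) x) / F x"
      by blast
    have "(t ^^ n) \<circ> m \<in> G" using G_comp G_pow t_in M_G m by blast
    from coh_trivial_comp[OF F_nz t_in this Kt K] show ?case by (simp only: comp_assoc funpow.simps)
  qed
  then have "\<forall>g\<in>G. \<exists>K. \<forall>x<p^2. W g x = K * F (g x) / F x" using G_decomp by metis
  then obtain K where "\<forall>g\<in>G. \<forall>x<p^2. W g x = K g * F (g x) / F x" by metis
  then show ?thesis unfolding coh_trivial_def using F_nz by blast
qed

end

section \<open>The criteria freed from the choice of gauge\<close>

context tower_cocycle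
begin

text \<open>The \<open>p\<close>-th power of the matrix over \<open>z\<close> lies over
  \<open>id\<close> and is scalar, so the product of the entries around a block is the same for
  every block. On each block the entries can then be evened out to one \<open>p\<close>-th root
  \<open>a\<close> of this number.\<close>

lemma gauge_z:
  obtains W' a where "cohomologous (p^2) G W W'" "gauged_cocycle p G x0 z t W' a"
proof -
  obtain c where c: "c \<noteq> 0" "\<And>x. x < p^2 \<Longrightarrow> W (z ^^ p) x * c = (\<Prod>l<p. W z ((z ^^ l) x))"
    using W_pow[OF z_in] by blast
  obtain c' where c': "c' \<noteq> 0" "\<And>x. x < p^2 \<Longrightarrow> W id x = c'" using W_id by blast
  have L: "(\<Prod>l<p. W z (P i l)) = c' * c" for i
    using c(2)[of "P i 0"] c'(2)[of "P i 0"] z_p by (simp add: z_P)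
  obtain a where a: "a ^ p = c' * c" using complex_root_exists p_pos by blast
  have a_nz: "a \<noteq> 0" using a c(1) c'(1) p_gt_1 by (auto simp: power_0_left split: if_splits)
  define F where "F x = (\<Prod>l<col x. a / W z (P (row x) l))" for x
  have F_nz: "F x \<noteq> 0" for x unfolding F_def using a_nz W_nz[OF z_in] by simp
  have F_z: "F (z x) = F x * (a / W z x)" if x: "x < p^2" for x
  proof -
    have i: "row x < p" and j: "col x < p" and P: "P (row x) (col x) = x"
      using row_less col_less P_row_col x by auto
    have zx: "z x = P (row x) (Suc (col x))" using P z_P1 by metis
    have e: "F x * (a / W z x) = (\<Prod>l<Suc (col x). a / W z (P (row x) l))"
      unfolding F_def by (simp add: P)
    show ?thesis
    proof (cases "Suc (col x) < p")
      case True
      then show ?thesis unfolding e by (simp add: F_def zx row_P col_P i)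
    next
      case False
      then have 1: "Suc (col x) = p" using j by simp
      have "(\<Prod>l<p. a / W z (P (row x) l)) = 1"
        unfolding prod_dividef L using a c(1) c'(1) by simp
      moreover have "F (z x) = 1" unfolding zx 1 F_def by (simp add: row_P col_P i)
      ultimately show ?thesis unfolding e 1 by simp
    qed
  qed
  define W' where "W' g x = W g x * F (g x) / F x" for g x
  have coh: "cohomologous (p^2) G W W'"
    unfolding cohomologous_def W'_def using F_nz
    by (intro exI[of _ F] exI[of _ "\<lambda>_. 1"]) simp
  have W'_z: "W' z x = a" if "x < p^2" for x
    unfolding W'_def F_z[OF that] using F_nz W_nz[OF z_in that] by simp
  have "gauged_cocycle p G x0 z t W' a"
    by unfold_locales (use cohomologous_proj_cocycle[OF coh] cohomologous_fix_const[OF coh W_fix] W'_z in auto)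
  then show ?thesis using that coh by blast
qed

lemma commutator_root_of_unity:
  obtains c where "c ^ p = 1" "\<And>x. x < p^2 \<Longrightarrow> W t (z x) * W z x = c * (W z (t x) * W t x)"
proof -
  obtain W' a where coh: "cohomologous (p^2) G W W'" and g: "gauged_cocycle p G x0 z t W' a"
    using gauge_z by blast
  interpret g: gauged_cocycle p G x0 z t W' a by (rule g)
  obtain c where c: "c ^ p = 1" "\<And>x. x < p^2 \<Longrightarrow> W' t (z x) = c * W' t x" using g.W_t_z by blast
  show ?thesis
  proof (rule that[OF c(1)])
    fix x assume x: "x < p^2"
    have "W' t (z x) * W' z x = c * (W' z (t x) * W' t x)"
      using c(2)[OF x] x G_less t_in by (simp add: g.W_z mult.commute)
    then show "W t (z x) * W z x = c * (W z (t x) * W t x)"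
      using cohomologous_commutator[OF coh t_in z_in x z_central[OF t_in, symmetric]] by blast
  qed
qed

lemma commute_if_fixes_two_blocks:
  assumes m: "m \<in> M" "f 0 m = 0" "f 2 m = 0" "f 1 m \<noteq> 0" and x: "x < p^2"
  shows "W t (z x) * W z x = W z (t x) * W t x"
proof -
  obtain W' a where coh: "cohomologous (p^2) G W W'" and g: "gauged_cocycle p G x0 z t W' a"
    using gauge_z by blast
  have "W' t (z x) * W' z x = W' z (t x) * W' t x"
    using gauged_cocycle.commute_if_fixes_two_blocks[OF g m x] .
  then show ?thesis using cohomologous_commute[OF coh t_in z_in x z_central[OF t_in, symmetric]] by blast
qed

lemma coh_trivial_if_commute:
  assumes tz: "\<And>x. x < p^2 \<Longrightarrow> W t (z x) * W z x = W z (t x) * W t x"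
  shows "coh_trivial (p^2) G W"
proof -
  obtain W' a where coh: "cohomologous (p^2) G W W'" and g: "gauged_cocycle p G x0 z t W' a"
    using gauge_z by blast
  have "W' t (z x) * W' z x = W' z (t x) * W' t x" if "x < p^2" for x
    using tz[OF that] cohomologous_commute[OF coh t_in z_in that z_central[OF t_in, symmetric]] by blast
  then have "coh_trivial (p^2) G W'" using gauged_cocycle.coh_trivial_if_commute[OF g] by blast
  then show ?thesis using cohomologous_trivial[OF coh subset_refl] by blast
qed

text \<open>In the gauge of the common eigenvector of \<open>D\<close>, the entries over
  \<open>h\<close> and over its conjugate are constant. Then \<open>v_conj\<close> at blocks 0 and 1
  leaves \<open>c ^ f 0 h = c ^ f 1 h\<close>, where the exponents are distinct modulo
  \<open>p\<close>.\<close>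

lemma commute_if_trivial_on_M:
  assumes D: "coh_trivial (p^2) D W" "D \<subseteq> G" "z \<in> D" "h \<in> D" "t \<circ> h \<circ> pinv t \<in> D"
    and h: "h \<in> M" "f 0 h \<noteq> f 1 h" and x: "x < p^2"
  shows "W t (z x) * W z x = W z (t x) * W t x"
proof -
  obtain F K where F: "\<And>x. x < p^2 \<Longrightarrow> F x \<noteq> 0"
    and K: "\<And>g x. g \<in> D \<Longrightarrow> x < p^2 \<Longrightarrow> W g x = K g * F (g x) / F x"
    using D(1) unfolding coh_trivial_def by blast
  \<comment> \<open>Dividing out the eigenvector makes every matrix over \<open>D\<close> a scalar
    multiple of a permutation matrix.\<close>
  define W' where "W' g x = W g x * (1 / F (g x)) / (1 / F x)" for g x
  have coh: "cohomologous (p^2) G W W'"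
    unfolding cohomologous_def W'_def using F
    by (intro exI[of _ "\<lambda>x. 1 / F x"] exI[of _ "\<lambda>_. 1"]) simp
  have W'D: "W' g x = K g" if "g \<in> D" "x < p^2" for g x
    unfolding W'_def K[OF that] using F that(2) F[of "g x"] G_less D(2) that(1) by auto
  interpret g: gauged_cocycle p G x0 z t W' "K z"
    by unfold_locales (use cohomologous_proj_cocycle[OF coh] cohomologous_fix_const[OF coh W_fix] W'D D(3) in auto)
  obtain c where c: "c ^ p = 1" "\<And>x. x < p^2 \<Longrightarrow> W' t (z x) = c * W' t x" using g.W_t_z by blast
  obtain b where b: "b \<noteq> 0" "\<And>i. g.v (Suc i) (t \<circ> h \<circ> pinv t) * b = g.v i h * c ^ f i h"
    using g.v_conj[OF c(2) h(1)] by blast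
  have "K h * c ^ f 0 h = K h * c ^ f 1 h"
    using b(2)[of 0] b(2)[of 1] D(4,5) by (simp add: g.v_def W'D)
  moreover have "K h \<noteq> 0" using g.W_nz[OF M_G[OF h(1)] x0] W'D D(4) x0 by simp
  ultimately have c01: "c ^ f 0 h = c ^ f 1 h" by simp
  have cnz: "c \<noteq> 0" using c(1) p_gt_1 by (auto simp: power_0_left split: if_splits)
  have "c = 1"
  proof -
    have "c = 1" if "i < j" "j < p" "c ^ i = c ^ j" for i j
    proof -
      have "c ^ j = c ^ i * c ^ (j - i)" using that(1) by (simp flip: power_add)
      then have "c ^ (j - i) = 1" using that(3) cnz by simp
      moreover have "\<not> p dvd j - i" using that by (auto dest!: dvd_imp_le)
      ultimately show ?thesis using power_eq_1_prime[OF prime_p c(1)] by blast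
    qed
    then show ?thesis using h(2) c01 f_less[OF h(1)] by (metis linorder_neqE_nat)
  qed
  then have "W' t (z x) * W' z x = W' z (t x) * W' t x"
    using c(2)[OF x] x G_less t_in D(3) by (simp add: W'D mult.commute)
  then show ?thesis using cohomologous_commute[OF coh t_in z_in x z_central[OF t_in, symmetric]] by blast
qed

end

section \<open>Cocycles with values in \<open>J\<close>\<close>

locale perm_pgroup_point = perm_pgroup +
  fixes i :: nat
  assumes i: "i < p^2"
begin

abbreviation \<Gamma> :: "(nat \<Rightarrow> nat) monoid" where
  "\<Gamma> \<equiv> (perm_grp (p^2))\<lparr>carrier := G\<rparr>"

abbreviation H :: "(nat \<Rightarrow> nat) set" where
  "H \<equiv> {\<sigma> \<in> G. \<sigma> i = i}"

text \<open>The left coset of \<open>H\<close> that corresponds to the point \<open>x\<close>. It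
  serves to replace functions on cosets by functions on points; \<open>pt\<close> is the
  inverse.\<close>

definition cs :: "nat \<Rightarrow> (nat \<Rightarrow> nat) set" where
  "cs x = {\<sigma> \<in> G. \<sigma> i = x}"

lemma inv_\<Gamma>: "g \<in> G \<Longrightarrow> inv\<^bsub>\<Gamma>\<^esub> g = pinv g"
  using group.m_inv_consistent[OF group_perm_grp sub] inv_perm_grp[OF G_perm] by metis

lemma l_coset_cs: "g \<in> G \<Longrightarrow> l_coset \<Gamma> g (cs x) = cs (g x)"
proof
  assume g: "g \<in> G"
  show "l_coset \<Gamma> g (cs x) \<subseteq> cs (g x)"
    using g G_comp by (auto simp: l_coset_def cs_def)
  show "cs (g x) \<subseteq> l_coset \<Gamma> g (cs x)"
  proof
    fix s assume s: "s \<in> cs (g x)"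
    then have "pinv g \<circ> s \<in> cs x" using g G_comp G_inv by (auto simp: cs_def)
    moreover have "s = g \<circ> (pinv g \<circ> s)" using g by (simp add: fun_eq_iff)
    ultimately show "s \<in> l_coset \<Gamma> g (cs x)" by (auto simp: l_coset_def)
  qed
qed

lemma lcosets_\<Gamma>: "lcosets\<^bsub>\<Gamma>\<^esub> H = cs ` {..<p^2}"
proof -
  have "lcosets\<^bsub>\<Gamma>\<^esub> H = (\<lambda>g. cs (g i)) ` G"
    using l_coset_cs[of _ i] by (auto simp: LCOSETS_def cs_def)
  also have "\<dots> = cs ` (\<lambda>g. g i) ` G" by (simp add: image_image)
  also have "(\<lambda>g. g i) ` G = {..<p^2}"
    using G_trans[OF i] G_less i by auto
  finally show ?thesis .
qed

lemma cs_inj: "x < p^2 \<Longrightarrow> cs x = cs y \<Longrightarrow> x = y"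
  using G_trans[OF i, of x] unfolding cs_def by blast

definition pt :: "(nat \<Rightarrow> nat) set \<Rightarrow> nat" where
  "pt C = (THE x. x < p^2 \<and> C = cs x)"

lemma pt_cs: "x < p^2 \<Longrightarrow> pt (cs x) = x"
  unfolding pt_def using cs_inj by (intro the_equality) auto

lemma ind_act_cs:
  "g \<in> G \<Longrightarrow> x < p^2 \<Longrightarrow> ind_act \<Gamma> H g u (cs x) = u (cs (pinv g x))"
  unfolding ind_act_def lcosets_\<Gamma> using l_coset_cs[OF G_inv] by (simp add: inv_\<Gamma>)

lemma const_on_cs: "const_on (lcosets\<^bsub>\<Gamma>\<^esub> H) u \<longleftrightarrow> (\<exists>n. \<forall>x<p^2. u (cs x) = n)"
  unfolding const_on_def lcosets_\<Gamma> by auto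

lemma inv_less: "g \<in> G \<Longrightarrow> x < p^2 \<Longrightarrow> pinv g x < p^2"
  using G_less G_inv by blast

text \<open>The coboundary of a 1-cochain, transported from cosets to points. It is polymorphic
  because both integral and real cochains occur.\<close>

definition d1 :: "((nat \<Rightarrow> nat) \<Rightarrow> nat \<Rightarrow> 'b::ab_group_add) \<Rightarrow> (nat \<Rightarrow> nat) \<Rightarrow> (nat \<Rightarrow> nat) \<Rightarrow> nat \<Rightarrow> 'b" where
  "d1 b g h x = b h (pinv g x) - b (g \<circ> h) x + b g x"

lemma B2_iff:
  assumes "D \<subseteq> G"
  shows "c \<in> B2 \<Gamma> H D \<longleftrightarrow> c \<in> cochains2 \<Gamma> H D \<and>
    (\<exists>b. \<forall>g\<in>D. \<forall>h\<in>D. \<exists>n. \<forall>x<p^2. c g h (cs x) = d1 b g h x + n)"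
    (is "_ \<longleftrightarrow> _ \<and> ?R")
proof (intro iffI conjI)
  assume c: "c \<in> B2 \<Gamma> H D"
  then show "c \<in> cochains2 \<Gamma> H D" by (simp add: B2_def)
  obtain b where b: "\<forall>g\<in>D. \<forall>h\<in>D. const_on (lcosets\<^bsub>\<Gamma>\<^esub> H)
      (\<lambda>C. c g h C - (ind_act \<Gamma> H g (b h) C - b (g \<otimes>\<^bsub>\<Gamma>\<^esub> h) C + b g C))"
    using c unfolding B2_def by blast
  have "\<exists>n. \<forall>x<p^2. c g h (cs x) = d1 (\<lambda>g x. b g (cs x)) g h x + n" if gh: "g \<in> D" "h \<in> D" for g h
  proof -
    have g: "g \<in> G" using gh assms by blast
    obtain n where n: "\<forall>x<p^2. c g h (cs x) - (ind_act \<Gamma> H g (b h) (cs x) - b (g \<otimes>\<^bsub>\<Gamma>\<^esub> h) (cs x) + b g (cs x)) = n"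
      using b[rule_format, OF gh] unfolding const_on_cs by (elim exE)
    have "c g h (cs x) = d1 (\<lambda>g x. b g (cs x)) g h x + n" if x: "x < p^2" for x
      using n[rule_format, OF x] unfolding ind_act_cs[OF g x] d1_def by simp
    then show ?thesis by blast
  qed
  then show ?R by blast
next
  assume "c \<in> cochains2 \<Gamma> H D \<and> ?R"
  then obtain b where c: "c \<in> cochains2 \<Gamma> H D"
    and b: "\<forall>g\<in>D. \<forall>h\<in>D. \<exists>n. \<forall>x<p^2. c g h (cs x) = d1 b g h x + n" by blast
  have "const_on (lcosets\<^bsub>\<Gamma>\<^esub> H)
      (\<lambda>C. c g h C - (ind_act \<Gamma> H g (\<lambda>C. b h (pt C)) C - b (g \<otimes>\<^bsub>\<Gamma>\<^esub> h) (pt C) + b g (pt C)))"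
    if "g \<in> D" "h \<in> D" for g h
  proof -
    have g: "g \<in> G" using that assms by blast
    obtain n where "\<forall>x<p^2. c g h (cs x) = d1 b g h x + n" using b \<open>g \<in> D\<close> \<open>h \<in> D\<close> by blast
    then show ?thesis unfolding const_on_cs
      by (intro exI[of _ n]) (simp add: ind_act_cs g pt_cs inv_less d1_def)
  qed
  then have "\<exists>b. \<forall>g\<in>D. \<forall>h\<in>D. const_on (lcosets\<^bsub>\<Gamma>\<^esub> H)
      (\<lambda>C. c g h C - (ind_act \<Gamma> H g (b h) C - b (g \<otimes>\<^bsub>\<Gamma>\<^esub> h) C + b g C))"
    by (intro exI[of _ "\<lambda>h C. b h (pt C)"]) blast
  then show "c \<in> B2 \<Gamma> H D" using c unfolding B2_def by blast
qed

lemma Z2_iff: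
  "c \<in> Z2 \<Gamma> H G \<longleftrightarrow> c \<in> cochains2 \<Gamma> H G \<and>
    (\<forall>g\<in>G. \<forall>h\<in>G. \<forall>k\<in>G. \<exists>n. \<forall>x<p^2.
      c h k (cs (pinv g x)) - c (g \<circ> h) k (cs x) + c g (h \<circ> k) (cs x) - c g h (cs x) = n)"
  unfolding Z2_def const_on_cs by (auto simp: ind_act_cs)

text \<open>Modulo constants, the integral cochain \<open>c\<close> is the coboundary of the real cochain \<open>\<beta>\<close>.\<close>

definition represents :: "((nat \<Rightarrow> nat) \<Rightarrow> (nat \<Rightarrow> nat) \<Rightarrow> (nat \<Rightarrow> nat) set \<Rightarrow> int) \<Rightarrow> ((nat \<Rightarrow> nat) \<Rightarrow> nat \<Rightarrow> real) \<Rightarrow> bool" where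
  "represents c \<beta> \<longleftrightarrow> (\<forall>g\<in>G. \<forall>h\<in>G. \<exists>r. \<forall>x<p^2. real_of_int (c g h (cs x)) = d1 \<beta> g h x + r)"

lemma representsE:
  assumes "represents c \<beta>" "g \<in> G" "h \<in> G"
  obtains r where "\<And>x. x < p^2 \<Longrightarrow> real_of_int (c g h (cs x)) = d1 \<beta> g h x + r"
  using assms unfolding represents_def by blast

lemma comp_image: "g \<in> D \<Longrightarrow> D \<subseteq> G \<Longrightarrow> (\<And>g h. g \<in> D \<Longrightarrow> h \<in> D \<Longrightarrow> g \<circ> h \<in> D) \<Longrightarrow> bij_betw (\<lambda>h. g \<circ> h) D D"
proof -
  assume g: "g \<in> D" and D: "D \<subseteq> G" and cl: "\<And>g h. g \<in> D \<Longrightarrow> h \<in> D \<Longrightarrow> g \<circ> h \<in> D"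
  have "finite D" using D finite_G finite_subset by blast
  moreover have inj: "inj_on (\<lambda>h. g \<circ> h) D"
    using G_inj[of g] g D by (auto simp: inj_on_def fun_eq_iff)
  moreover have "(\<lambda>h. g \<circ> h) ` D \<subseteq> D" using g cl by blast
  ultimately have "(\<lambda>h. g \<circ> h) ` D = D" using endo_inj_surj by blast
  then show ?thesis using inj by (simp add: bij_betw_def)
qed

text \<open>Averaging over the last argument is the usual contraction: summing the cocycle identity
  over \<open>k\<close> writes \<open>card G\<close> times \<open>c\<close> as a coboundary up to
  constants.\<close>

lemma Z2_represents:
  assumes c: "c \<in> Z2 \<Gamma> H G"
  shows "\<exists>\<beta>. represents c \<beta>"
proof -
  define N where "N = real (card G)"
  have N: "N > 0" unfolding N_def using finite_G G_id card_gt_0_iff by fastforce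
  define \<beta> where "\<beta> g x = (\<Sum>k\<in>G. real_of_int (c g k (cs x))) / N" for g x
  have "\<exists>r. \<forall>x<p^2. real_of_int (c g h (cs x)) = d1 \<beta> g h x + r" if g: "g \<in> G" and h: "h \<in> G" for g h
  proof -
    have "\<forall>k\<in>G. \<exists>n. \<forall>x<p^2.
      c h k (cs (pinv g x)) - c (g \<circ> h) k (cs x) + c g (h \<circ> k) (cs x) - c g h (cs x) = n"
      using c g h unfolding Z2_iff by blast
    then obtain n where n: "\<And>k x. k \<in> G \<Longrightarrow> x < p^2 \<Longrightarrow>
      c h k (cs (pinv g x)) - c (g \<circ> h) k (cs x) + c g (h \<circ> k) (cs x) - c g h (cs x) = n k" by metis
    have "real_of_int (c g h (cs x)) = d1 \<beta> g h x + (- (\<Sum>k\<in>G. real_of_int (n k)) / N)" if x: "x < p^2" for x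
    proof -
      have "(\<Sum>k\<in>G. real_of_int (n k)) = (\<Sum>k\<in>G. real_of_int (c h k (cs (pinv g x))) - real_of_int (c (g \<circ> h) k (cs x))
          + real_of_int (c g (h \<circ> k) (cs x)) - real_of_int (c g h (cs x)))"
        by (intro sum.cong refl) (simp flip: n[OF _ x])
      also have "\<dots> = N * \<beta> h (pinv g x) - N * \<beta> (g \<circ> h) x + (\<Sum>k\<in>G. real_of_int (c g (h \<circ> k) (cs x)))
          - N * real_of_int (c g h (cs x))"
        using N by (simp add: sum.distrib sum_subtractf \<beta>_def N_def)
      also have "(\<Sum>k\<in>G. real_of_int (c g (h \<circ> k) (cs x))) = N * \<beta> g x"
        using sum.reindex_bij_betw[OF comp_image[OF h subset_refl G_comp], of "\<lambda>k. real_of_int (c g k (cs x))"] N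
        by (simp add: \<beta>_def)
      finally have "N * real_of_int (c g h (cs x)) = N * d1 \<beta> g h x - (\<Sum>k\<in>G. real_of_int (n k))"
        unfolding d1_def distrib_left right_diff_distrib by linarith
      then show ?thesis using N by (simp add: field_simps)
    qed
    then show ?thesis by blast
  qed
  then show ?thesis unfolding represents_def by blast
qed

lemma represents_Z2:
  assumes c: "c \<in> cochains2 \<Gamma> H G" and r: "represents c \<beta>"
  shows "c \<in> Z2 \<Gamma> H G"
  unfolding Z2_iff
proof (intro conjI ballI c)
  fix g h k assume g: "g \<in> G" and h: "h \<in> G" and k: "k \<in> G"
  have gh: "g \<circ> h \<in> G" and hk: "h \<circ> k \<in> G" using g h k G_comp by auto
  obtain r1 where r1: "\<And>x. x < p^2 \<Longrightarrow> real_of_int (c h k (cs x)) = d1 \<beta> h k x + r1"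
    using representsE[OF r h k] by metis
  obtain r2 where r2: "\<And>x. x < p^2 \<Longrightarrow> real_of_int (c (g \<circ> h) k (cs x)) = d1 \<beta> (g \<circ> h) k x + r2"
    using representsE[OF r gh k] by metis
  obtain r3 where r3: "\<And>x. x < p^2 \<Longrightarrow> real_of_int (c g (h \<circ> k) (cs x)) = d1 \<beta> g (h \<circ> k) x + r3"
    using representsE[OF r g hk] by metis
  obtain r4 where r4: "\<And>x. x < p^2 \<Longrightarrow> real_of_int (c g h (cs x)) = d1 \<beta> g h x + r4"
    using representsE[OF r g h] by metis
  define u where "u x = c h k (cs (pinv g x)) - c (g \<circ> h) k (cs x) + c g (h \<circ> k) (cs x) - c g h (cs x)" for x
  have "real_of_int (u x) = r1 - r2 + r3 - r4" if x: "x < p^2" for x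
  proof -
    have "pinv (g \<circ> h) = pinv h \<circ> pinv g" using o_inv_distrib G_bij g h by blast
    then show ?thesis
      unfolding u_def using r1[OF inv_less[OF g x]] r2[OF x] r3[OF x] r4[OF x]
      by (simp add: d1_def comp_assoc)
  qed
  then have "u x = u i" if "x < p^2" for x using that i by (metis of_int_eq_iff)
  then show "\<exists>n. \<forall>x<p^2. c h k (cs (pinv g x)) - c (g \<circ> h) k (cs x) + c g (h \<circ> k) (cs x) - c g h (cs x) = n"
    unfolding u_def by blast
qed

lemma represents_add_scale:
  assumes "represents c \<beta>" "represents c' \<beta>'"
  shows "represents (\<lambda>g h C. c g h C + l * c' g h C) (\<lambda>g x. \<beta> g x + real_of_int l * \<beta>' g x)"
  unfolding represents_def
proof (intro ballI)
  fix g h assume g: "g \<in> G" "h \<in> G"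
  obtain r where r: "\<And>x. x < p^2 \<Longrightarrow> real_of_int (c g h (cs x)) = d1 \<beta> g h x + r"
    using representsE[OF assms(1) g] by metis
  obtain r' where r': "\<And>x. x < p^2 \<Longrightarrow> real_of_int (c' g h (cs x)) = d1 \<beta>' g h x + r'"
    using representsE[OF assms(2) g] by metis
  show "\<exists>q. \<forall>x<p^2. real_of_int (c g h (cs x) + l * c' g h (cs x)) =
      d1 (\<lambda>g x. \<beta> g x + real_of_int l * \<beta>' g x) g h x + q"
    by (intro exI[of _ "r + l * r'"]) (simp add: r r' d1_def algebra_simps)
qed

text \<open>The same averaging one degree lower: H^1 with values in real functions modulo constants
  vanishes. It is meant for the difference of a real and an integral cochain whose coboundaries
  agree up to constants.\<close>

lemma represents_diff_const:
  assumes "\<And>g h. g \<in> D \<Longrightarrow> h \<in> D \<Longrightarrow> \<exists>r. \<forall>x<p^2. d1 \<beta> g h x = (r::real)"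
    and D: "id \<in> D" "D \<subseteq> G" "\<And>g h. g \<in> D \<Longrightarrow> h \<in> D \<Longrightarrow> g \<circ> h \<in> D"
  obtains S \<kappa> where "\<And>g x. g \<in> D \<Longrightarrow> x < p^2 \<Longrightarrow> \<beta> g x = S x - S (pinv g x) + \<kappa> g"
proof -
  have fin: "finite D" using D(2) finite_G finite_subset by blast
  define N where "N = real (card D)"
  have N: "N > 0" unfolding N_def using fin D(1) card_gt_0_iff by fastforce
  obtain r where r: "\<And>g h x. g \<in> D \<Longrightarrow> h \<in> D \<Longrightarrow> x < p^2 \<Longrightarrow> d1 \<beta> g h x = r g h"
    using assms(1) by metis
  define S where "S x = (\<Sum>h\<in>D. \<beta> h x) / N" for x
  show ?thesis
  proof (rule that[of S "\<lambda>g. (\<Sum>h\<in>D. r g h) / N"])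
    fix g x assume g: "g \<in> D" and x: "x < p^2"
    have "(\<Sum>h\<in>D. r g h) = (\<Sum>h\<in>D. \<beta> h (pinv g x)) - (\<Sum>h\<in>D. \<beta> (g \<circ> h) x) + N * \<beta> g x"
      using r[OF g _ x, symmetric] by (simp add: d1_def sum.distrib sum_subtractf N_def)
    also have "(\<Sum>h\<in>D. \<beta> (g \<circ> h) x) = (\<Sum>h\<in>D. \<beta> h x)"
      using sum.reindex_bij_betw[OF comp_image[OF g D(2,3)], of "\<lambda>h. \<beta> h x"] by simp
    finally show "\<beta> g x = S x - S (pinv g x) + (\<Sum>h\<in>D. r g h) / N"
      using N by (simp add: S_def field_simps)
  qed
qed

text \<open>\<open>J\<close> tensored with R/Z is the torus of unitary diagonal matrices modulo
  scalars, and this is the exponential of \<open>\<beta>\<close> in it. The argument is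
  \<open>g x\<close> because matrix entries are indexed by their column \<open>x\<close>, cochains
  by the image \<open>g x\<close>.\<close>

definition Wr :: "((nat \<Rightarrow> nat) \<Rightarrow> nat \<Rightarrow> real) \<Rightarrow> (nat \<Rightarrow> nat) \<Rightarrow> nat \<Rightarrow> complex" where
  "Wr \<beta> g x = cis (2 * pi * \<beta> g (g x))"

lemma cis_2pi_int: "cis (2 * pi * real_of_int n) = 1"
  by (rule cis_multiple_2pi) simp

lemma cis_2pi_eqD:
  assumes "cis (2 * pi * a) = 1" shows "a \<in> \<int>"
proof -
  have "cos (2 * pi * a) = 1" using assms by (simp add: complex_eq_iff)
  then obtain n :: int where "2 * pi * a = real_of_int n * 2 * pi" unfolding cos_one_2pi_int by blast
  then have "a = n" by simp
  then show ?thesis by simp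
qed

lemma Wr_proj_cocycle:
  assumes "represents c \<beta>" shows "proj_cocycle (p^2) G (Wr \<beta>)"
  unfolding proj_cocycle_def
proof (intro conjI ballI)
  fix g h assume g: "g \<in> G" and h: "h \<in> G"
  obtain r where r: "\<And>x. x < p^2 \<Longrightarrow> real_of_int (c g h (cs x)) = d1 \<beta> g h x + r"
    using representsE[OF assms g h] by metis
  have "Wr \<beta> (g \<circ> h) x * cis (- (2 * pi * r)) = Wr \<beta> g (h x) * Wr \<beta> h x" if x: "x < p^2" for x
  proof -
    have l: "g (h x) < p^2" using g h x G_less by simp
    have e: "\<beta> g (g (h x)) + \<beta> h (h x) = \<beta> (g \<circ> h) (g (h x)) - r + real_of_int (c g h (cs (g (h x))))"
      using r[OF l] g by (simp add: d1_def)
    have "Wr \<beta> g (h x) * Wr \<beta> h x = cis (2 * pi * (\<beta> g (g (h x)) + \<beta> h (h x)))"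
      by (simp add: Wr_def cis_mult algebra_simps)
    also have "\<dots> = cis (2 * pi * (\<beta> (g \<circ> h) (g (h x)) - r)) * cis (2 * pi * real_of_int (c g h (cs (g (h x)))))"
      unfolding e cis_mult by (simp add: algebra_simps)
    also have "\<dots> = Wr \<beta> (g \<circ> h) x * cis (- (2 * pi * r))"
      unfolding cis_2pi_int by (simp add: Wr_def cis_mult algebra_simps)
    finally show ?thesis by simp
  qed
  then show "\<exists>c. c \<noteq> 0 \<and> (\<forall>x<p^2. Wr \<beta> (g \<circ> h) x * c = Wr \<beta> g (h x) * Wr \<beta> h x)"
    by (intro exI[of _ "cis (- (2 * pi * r))"]) simp
qed (simp add: Wr_def)

lemma restr2_cochains2:
  "c \<in> cochains2 \<Gamma> H G \<Longrightarrow> restr2 D c \<in> cochains2 \<Gamma> H D"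
  unfolding cochains2_def restr2_def by auto

text \<open>The connecting map made explicit: the class of \<open>c\<close> dies on \<open>D\<close>
  iff subtracting an integral \<open>b\<close> from \<open>\<beta>\<close> leaves a coboundary
  modulo constants, and integers disappear under the exponential. An eigenvector is the exponential
  of \<open>S\<close>; conversely \<open>S\<close> and \<open>\<kappa>\<close> are the arguments of
  \<open>F\<close> and \<open>K\<close>.\<close>

lemma restr2_B2_iff:
  assumes c: "c \<in> cochains2 \<Gamma> H G" and rep: "represents c \<beta>"
    and D: "id \<in> D" "D \<subseteq> G" "\<And>g h. g \<in> D \<Longrightarrow> h \<in> D \<Longrightarrow> g \<circ> h \<in> D"
  shows "restr2 D c \<in> B2 \<Gamma> H D \<longleftrightarrow> coh_trivial (p^2) D (Wr \<beta>)"
proof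
  assume "restr2 D c \<in> B2 \<Gamma> H D"
  then obtain b where b: "\<forall>g\<in>D. \<forall>h\<in>D. \<exists>n. \<forall>x<p^2. restr2 D c g h (cs x) = d1 b g h x + n"
    unfolding B2_iff[OF D(2)] by blast
  define \<beta>' where "\<beta>' g x = \<beta> g x - real_of_int (b g x)" for g x
  have "\<exists>r. \<forall>x<p^2. d1 \<beta>' g h x = r" if gh: "g \<in> D" "h \<in> D" for g h
  proof -
    obtain n where n: "\<And>x. x < p^2 \<Longrightarrow> restr2 D c g h (cs x) = d1 b g h x + n" using b gh by blast
    obtain r where r: "\<And>x. x < p^2 \<Longrightarrow> real_of_int (c g h (cs x)) = d1 \<beta> g h x + r"
      using representsE[OF rep] gh D(2) by (metis subsetD)
    have "d1 \<beta>' g h x = real_of_int n - r" if x: "x < p^2" for x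
    proof -
      have "d1 \<beta>' g h x = d1 \<beta> g h x - real_of_int (d1 b g h x)"
        unfolding d1_def \<beta>'_def by simp
      also have "d1 b g h x = c g h (cs x) - n" using n[OF x] gh by (simp add: restr2_def)
      finally show ?thesis using r[OF x] by simp
    qed
    then show ?thesis by blast
  qed
  then obtain S \<kappa> where S: "\<And>g x. g \<in> D \<Longrightarrow> x < p^2 \<Longrightarrow> \<beta>' g x = S x - S (pinv g x) + \<kappa> g"
    using represents_diff_const[OF _ D] by blast
  have "Wr \<beta> g x = cis (2 * pi * \<kappa> g) * cis (2 * pi * S (g x)) / cis (2 * pi * S x)"
    if g: "g \<in> D" and x: "x < p^2" for g x
  proof -
    have gG: "g \<in> G" using g D by auto
    have "\<beta>' g (g x) = S (g x) - S x + \<kappa> g" using S[OF g, of "g x"] gG x G_less by simp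
    then have e: "\<beta> g (g x) = S (g x) - S x + \<kappa> g + real_of_int (b g (g x))" by (simp add: \<beta>'_def)
    have "Wr \<beta> g x = cis (2 * pi * (S (g x) - S x + \<kappa> g)) * cis (2 * pi * real_of_int (b g (g x)))"
      unfolding Wr_def e cis_mult by (simp add: algebra_simps)
    also have "\<dots> = cis (2 * pi * \<kappa> g) * cis (2 * pi * S (g x)) / cis (2 * pi * S x)"
      unfolding cis_2pi_int cis_mult cis_divide by (simp add: algebra_simps)
    finally show ?thesis .
  qed
  then show "coh_trivial (p^2) D (Wr \<beta>)"
    unfolding coh_trivial_def
    by (intro exI[of _ "\<lambda>x. cis (2 * pi * S x)"] exI[of _ "\<lambda>g. cis (2 * pi * \<kappa> g)"]) simp
next
  assume "coh_trivial (p^2) D (Wr \<beta>)"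
  then obtain F K where F: "\<And>x. x < p^2 \<Longrightarrow> F x \<noteq> 0"
    and K: "\<And>g x. g \<in> D \<Longrightarrow> x < p^2 \<Longrightarrow> Wr \<beta> g x = K g * F (g x) / F x"
    unfolding coh_trivial_def by blast
  define S where "S x = Arg (F x) / (2 * pi)" for x
  define \<kappa> where "\<kappa> g = Arg (K g) / (2 * pi)" for g
  have S: "cis (2 * pi * S x) = F x / cmod (F x)" if "x < p^2" for x
    using F[OF that] by (simp add: S_def cis_Arg sgn_eq)
  have int: "\<beta> g (g x) - S (g x) + S x - \<kappa> g \<in> \<int>" if g: "g \<in> D" and x: "x < p^2" for g x
  proof -
    have gG: "g \<in> G" using g D by auto
    have gx: "g x < p^2" using G_less gG x by simp
    have Knz: "K g \<noteq> 0" using K[OF g x] by (auto simp: Wr_def)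
    have \<kappa>: "cis (2 * pi * \<kappa> g) = K g / cmod (K g)"
      using Knz by (simp add: \<kappa>_def cis_Arg sgn_eq)
    \<comment> \<open>The matrices are unitary, so the absolute values of \<open>F\<close> and
      \<open>K\<close> cancel and only their arguments matter.\<close>
    have "cmod (Wr \<beta> g x) = 1" by (simp add: Wr_def)
    then have nrm: "cmod (K g) * cmod (F (g x)) = cmod (F x)"
      unfolding K[OF g x] using F[OF x] by (simp add: norm_mult norm_divide field_simps)
    have "cis (2 * pi * \<kappa> g) * cis (2 * pi * S (g x)) / cis (2 * pi * S x)
        = K g * F (g x) / F x * (cmod (F x) / complex_of_real (cmod (K g) * cmod (F (g x))))"
      unfolding S[OF x] S[OF gx] \<kappa> using F[OF x] by (simp add: field_simps)
    also have "\<dots> = Wr \<beta> g x" unfolding nrm K[OF g x] using F[OF x] by simp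
    finally have e: "Wr \<beta> g x = cis (2 * pi * \<kappa> g) * cis (2 * pi * S (g x)) / cis (2 * pi * S x)" by simp
    have "cis (2 * pi * (\<beta> g (g x) - S (g x) + S x - \<kappa> g))
        = Wr \<beta> g x / (cis (2 * pi * \<kappa> g) * cis (2 * pi * S (g x)) / cis (2 * pi * S x))"
      unfolding Wr_def cis_mult cis_divide by (simp add: algebra_simps)
    then have "cis (2 * pi * (\<beta> g (g x) - S (g x) + S x - \<kappa> g)) = 1"
      unfolding e by simp
    then show ?thesis by (rule cis_2pi_eqD)
  qed
  \<comment> \<open>For \<open>g\<close> in \<open>D\<close> and points \<open>y\<close> the floor
    is taken of a number already known to be an integer; it only changes the type.\<close>
  define b where "b g y = \<lfloor>\<beta> g y - S y + S (pinv g y) - \<kappa> g\<rfloor>" for g y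
  have b: "real_of_int (b g y) = \<beta> g y - S y + S (pinv g y) - \<kappa> g" if g: "g \<in> D" and y: "y < p^2" for g y
  proof -
    have gG: "g \<in> G" using g D by auto
    have "g (pinv g y) = y" using gG by simp
    then have "\<beta> g y - S y + S (pinv g y) - \<kappa> g \<in> \<int>"
      using int[OF g inv_less[OF gG y]] by simp
    then show ?thesis unfolding b_def by simp
  qed
  have "\<exists>n. \<forall>x<p^2. restr2 D c g h (cs x) = d1 b g h x + n" if gh: "g \<in> D" "h \<in> D" for g h
  proof -
    have G: "g \<in> G" "h \<in> G" using gh D by auto
    have ghD: "g \<circ> h \<in> D" using gh D by auto
    obtain r where r: "\<And>x. x < p^2 \<Longrightarrow> real_of_int (c g h (cs x)) = d1 \<beta> g h x + r"
      using representsE[OF rep G] by metis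
    have inv: "pinv (g \<circ> h) = pinv h \<circ> pinv g" using o_inv_distrib G_bij G by blast
    define u where "u x = c g h (cs x) - d1 b g h x" for x
    have "real_of_int (u x) = r + \<kappa> h - \<kappa> (g \<circ> h) + \<kappa> g" if x: "x < p^2" for x
      unfolding u_def using r[OF x] b[OF gh(2) inv_less[OF G(1) x]] b[OF gh(1) x] b[OF ghD x]
      by (simp add: d1_def inv)
    then have "u x = u i" if "x < p^2" for x using that i by (metis of_int_eq_iff)
    moreover have "restr2 D c g h (cs x) = d1 b g h x + u x" for x
      using gh unfolding u_def restr2_def by simp
    ultimately have "\<forall>x<p^2. restr2 D c g h (cs x) = d1 b g h x + u i" by simp
    then show ?thesis by blast
  qed
  then show "restr2 D c \<in> B2 \<Gamma> H D"
    unfolding B2_iff[OF D(2)] using restr2_cochains2[OF c] by blast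
qed

lemma restr2_G: "c \<in> cochains2 \<Gamma> H G \<Longrightarrow> restr2 G c = c"
  unfolding cochains2_def restr2_def by (auto simp: fun_eq_iff)

lemma B2_G_iff:
  assumes "c \<in> cochains2 \<Gamma> H G" "represents c \<beta>"
  shows "c \<in> B2 \<Gamma> H G \<longleftrightarrow> coh_trivial (p^2) G (Wr \<beta>)"
  using restr2_B2_iff[OF assms G_id subset_refl G_comp] restr2_G[OF assms(1)] by simp

section \<open>The group of classes and its subgroup \<open>Sha2\<close>\<close>

abbreviation Zg :: "((nat \<Rightarrow> nat) \<Rightarrow> (nat \<Rightarrow> nat) \<Rightarrow> (nat \<Rightarrow> nat) set \<Rightarrow> int) monoid" where
  "Zg \<equiv> (cochain_grp \<Gamma> H G)\<lparr>carrier := Z2 \<Gamma> H G\<rparr>"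

abbreviation Bg :: "((nat \<Rightarrow> nat) \<Rightarrow> (nat \<Rightarrow> nat) \<Rightarrow> (nat \<Rightarrow> nat) set \<Rightarrow> int) set" where
  "Bg \<equiv> B2 \<Gamma> H G"

lemma cochains2_add_scale:
  "c \<in> cochains2 \<Gamma> H D \<Longrightarrow> c' \<in> cochains2 \<Gamma> H D \<Longrightarrow> (\<lambda>g h C. c g h C + l * c' g h C) \<in> cochains2 \<Gamma> H D"
  unfolding cochains2_def by (auto simp: fun_eq_iff)

lemma Z2_cochains2: "c \<in> Z2 \<Gamma> H G \<Longrightarrow> c \<in> cochains2 \<Gamma> H G"
  by (simp add: Z2_def)

lemma Z2_add_scale:
  assumes "c \<in> Z2 \<Gamma> H G" "c' \<in> Z2 \<Gamma> H G"
  shows "(\<lambda>g h C. c g h C + l * c' g h C) \<in> Z2 \<Gamma> H G"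
proof -
  obtain \<beta> \<beta>' where "represents c \<beta>" "represents c' \<beta>'" using assms Z2_represents by blast
  then show ?thesis
    using represents_Z2 represents_add_scale cochains2_add_scale assms Z2_cochains2 by blast
qed

lemma B2_add_scale:
  assumes D: "D \<subseteq> G" and c: "c \<in> B2 \<Gamma> H D" and c': "c' \<in> B2 \<Gamma> H D"
  shows "(\<lambda>g h C. c g h C + l * c' g h C) \<in> B2 \<Gamma> H D"
proof -
  obtain b where b: "\<forall>g\<in>D. \<forall>h\<in>D. \<exists>n. \<forall>x<p^2. c g h (cs x) = d1 b g h x + n"
    using c unfolding B2_iff[OF D] by blast
  obtain b' where b': "\<forall>g\<in>D. \<forall>h\<in>D. \<exists>n. \<forall>x<p^2. c' g h (cs x) = d1 b' g h x + n"
    using c' unfolding B2_iff[OF D] by blast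
  have "\<exists>n. \<forall>x<p^2. c g h (cs x) + l * c' g h (cs x) = d1 (\<lambda>g x. b g x + l * b' g x) g h x + n"
    if gh: "g \<in> D" "h \<in> D" for g h
  proof -
    obtain n where n: "\<forall>x<p^2. c g h (cs x) = d1 b g h x + n" using b gh by blast
    obtain n' where n': "\<forall>x<p^2. c' g h (cs x) = d1 b' g h x + n'" using b' gh by blast
    have "d1 (\<lambda>g x. b g x + l * b' g x) g h x = d1 b g h x + l * d1 b' g h x" for x
      unfolding d1_def by (simp only: algebra_simps)
    then show ?thesis using n n' by (intro exI[of _ "n + l * n'"]) (simp add: algebra_simps)
  qed
  moreover have "(\<lambda>g h C. c g h C + l * c' g h C) \<in> cochains2 \<Gamma> H D"
    using c c' cochains2_add_scale unfolding B2_iff[OF D] by blast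
  ultimately show ?thesis unfolding B2_iff[OF D] by blast
qed

lemma zero_B2: "D \<subseteq> G \<Longrightarrow> (\<lambda>_ _ _. 0) \<in> B2 \<Gamma> H D"
  unfolding B2_iff cochains2_def by (auto intro!: exI[of _ "\<lambda>_ _. 0"] simp: d1_def)

lemma B2_Z2: assumes "c \<in> Bg" shows "c \<in> Z2 \<Gamma> H G"
proof -
  obtain b where b: "\<forall>g\<in>G. \<forall>h\<in>G. \<exists>n. \<forall>x<p^2. c g h (cs x) = d1 b g h x + n"
    using assms unfolding B2_iff[OF subset_refl] by blast
  have "represents c (\<lambda>g x. real_of_int (b g x))"
    unfolding represents_def
  proof (intro ballI)
    fix g h assume "g \<in> G" "h \<in> G"
    then obtain n where n: "\<forall>x<p^2. c g h (cs x) = d1 b g h x + n" using b by blast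
    then show "\<exists>r. \<forall>x<p^2. real_of_int (c g h (cs x)) = d1 (\<lambda>g x. real_of_int (b g x)) g h x + r"
      by (intro exI[of _ "real_of_int n"]) (simp add: d1_def)
  qed
  moreover have "c \<in> cochains2 \<Gamma> H G" using assms by (simp add: B2_def)
  ultimately show ?thesis using represents_Z2 by blast
qed

lemma zero_Z2: "(\<lambda>_ _ _. 0) \<in> Z2 \<Gamma> H G"
  using B2_Z2 zero_B2 by blast

lemma group_Zg: "comm_group Zg"
proof (rule comm_groupI)
  fix x y assume "x \<in> carrier Zg" "y \<in> carrier Zg"
  then show "x \<otimes>\<^bsub>Zg\<^esub> y \<in> carrier Zg"
    using Z2_add_scale[of x y 1] by (simp add: cochain_grp_def)
next
  show "\<one>\<^bsub>Zg\<^esub> \<in> carrier Zg" using zero_Z2 by (simp add: cochain_grp_def)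
next
  fix x assume "x \<in> carrier Zg"
  then show "\<exists>y\<in>carrier Zg. y \<otimes>\<^bsub>Zg\<^esub> x = \<one>\<^bsub>Zg\<^esub>"
    using Z2_add_scale[OF zero_Z2, of x "- 1"]
    by (intro bexI[of _ "\<lambda>g h C. - x g h C"]) (simp_all add: cochain_grp_def)
qed (simp_all add: cochain_grp_def algebra_simps)

lemma Zg_inv: assumes "c \<in> Z2 \<Gamma> H G" shows "inv\<^bsub>Zg\<^esub> c = (\<lambda>g h C. - c g h C)"
proof -
  have "(\<lambda>g h C. - c g h C) \<in> Z2 \<Gamma> H G"
    using Z2_add_scale[OF zero_Z2 assms, of "- 1"] by simp
  then show ?thesis
    using assms by (intro group.inv_equality comm_group.axioms(2)[OF group_Zg]) (simp_all add: cochain_grp_def)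
qed

lemma normal_Bg: "Bg \<lhd> Zg"
proof -
  interpret Z: comm_group Zg by (rule group_Zg)
  have "subgroup Bg Zg"
  proof (rule Z.subgroupI)
    show "Bg \<subseteq> carrier Zg" using B2_Z2 by auto
    show "Bg \<noteq> {}" using zero_B2 by blast
    fix a b assume a: "a \<in> Bg" and b: "b \<in> Bg"
    show "inv\<^bsub>Zg\<^esub> a \<in> Bg"
      using B2_add_scale[OF subset_refl zero_B2[OF subset_refl] a, of "- 1"] Zg_inv B2_Z2[OF a] by simp
    show "a \<otimes>\<^bsub>Zg\<^esub> b \<in> Bg"
      using B2_add_scale[OF subset_refl a b, of 1] by (simp add: cochain_grp_def)
  qed
  then show ?thesis by (rule Z.subgroup_imp_normal)
qed

definition cls :: "((nat \<Rightarrow> nat) \<Rightarrow> (nat \<Rightarrow> nat) \<Rightarrow> (nat \<Rightarrow> nat) set \<Rightarrow> int) \<Rightarrow> ((nat \<Rightarrow> nat) \<Rightarrow> (nat \<Rightarrow> nat) \<Rightarrow> (nat \<Rightarrow> nat) set \<Rightarrow> int) set" where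
  "cls c = Bg #>\<^bsub>Zg\<^esub> c"

lemma cls_eq: "cls c = (\<lambda>b g h C. b g h C + c g h C) ` Bg"
  unfolding cls_def r_coset_def by (auto simp: cochain_grp_def)

lemma H2J_carrier: "carrier (H2J \<Gamma> H) = cls ` Z2 \<Gamma> H G"
  by (auto simp: H2J_def FactGroup_def RCOSETS_def cls_def)

lemma H2J_one: "\<one>\<^bsub>Sha2 \<Gamma> H DD\<^esub> = Bg"
  by (simp add: Sha2_def H2J_def FactGroup_def)

lemma cls_mult:
  assumes "c \<in> Z2 \<Gamma> H G" "c' \<in> Z2 \<Gamma> H G"
  shows "cls c \<otimes>\<^bsub>Sha2 \<Gamma> H DD\<^esub> cls c' = cls (\<lambda>g h C. c g h C + c' g h C)"
proof -
  have "cls c <#>\<^bsub>Zg\<^esub> cls c' = Bg #>\<^bsub>Zg\<^esub> (c \<otimes>\<^bsub>Zg\<^esub> c')"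
    unfolding cls_def by (rule normal.rcos_sum[OF normal_Bg]) (use assms in auto)
  then show ?thesis by (simp add: Sha2_def H2J_def FactGroup_def cls_def cochain_grp_def)
qed

lemma cls_eq_iff:
  assumes "c \<in> Z2 \<Gamma> H G" "c' \<in> Z2 \<Gamma> H G"
  shows "cls c = cls c' \<longleftrightarrow> (\<lambda>g h C. c g h C - c' g h C) \<in> Bg"
proof
  assume e: "cls c = cls c'"
  have "c \<in> cls c" unfolding cls_eq
    by (rule image_eqI[of _ _ "\<lambda>_ _ _. 0"]) (simp_all add: zero_B2)
  then obtain b where "b \<in> Bg" "c = (\<lambda>g h C. b g h C + c' g h C)" using e by (auto simp: cls_eq)
  then show "(\<lambda>g h C. c g h C - c' g h C) \<in> Bg" by simp
next
  assume d: "(\<lambda>g h C. c g h C - c' g h C) \<in> Bg"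
  have 1: "cls u \<subseteq> cls u'" if "(\<lambda>g h C. u g h C - u' g h C) \<in> Bg" for u u'
  proof
    fix y assume "y \<in> cls u"
    then obtain b where b: "b \<in> Bg" "y = (\<lambda>g h C. b g h C + u g h C)" by (auto simp: cls_eq)
    have "(\<lambda>g h C. b g h C + 1 * (u g h C - u' g h C)) \<in> Bg"
      using B2_add_scale[OF subset_refl b(1) that] .
    then show "y \<in> cls u'" unfolding cls_eq b(2) by (rule rev_image_eqI) (simp add: fun_eq_iff)
  qed
  have "(\<lambda>g h C. c' g h C - c g h C) \<in> Bg"
    using B2_add_scale[OF subset_refl zero_B2[OF subset_refl] d, of "- 1"] by simp
  then show "cls c = cls c'" using 1 d by blast
qed

lemma cls_B2: "c \<in> Bg \<Longrightarrow> cls c = Bg"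
proof -
  assume c: "c \<in> Bg"
  have "cls c = cls (\<lambda>_ _ _. 0)" using cls_eq_iff[OF B2_Z2[OF c] zero_Z2] c by simp
  then show ?thesis by (simp add: cls_eq)
qed

lemma restr2_Bg: "b \<in> Bg \<Longrightarrow> D \<subseteq> G \<Longrightarrow> restr2 D b \<in> B2 \<Gamma> H D"
  unfolding B2_iff[OF subset_refl] B2_iff using restr2_cochains2 by (auto simp: restr2_def subset_iff) metis

text \<open>\<open>Sha2\<close> imposes its condition on every representative of a class.
  Coboundaries on \<open>G\<close> restrict to coboundaries on \<open>D\<close>, so one
  representative decides.\<close>

lemma Sha2_carrier:
  assumes DD: "\<And>D. D \<in> DD \<Longrightarrow> D \<subseteq> G"
  shows "carrier (Sha2 \<Gamma> H DD) = cls ` {c \<in> Z2 \<Gamma> H G. \<forall>D\<in>DD. restr2 D c \<in> B2 \<Gamma> H D}"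
proof -
  have "(\<forall>y\<in>cls c. \<forall>D\<in>DD. restr2 D y \<in> B2 \<Gamma> H D) \<longleftrightarrow> (\<forall>D\<in>DD. restr2 D c \<in> B2 \<Gamma> H D)" for c
  proof
    assume a: "\<forall>y\<in>cls c. \<forall>D\<in>DD. restr2 D y \<in> B2 \<Gamma> H D"
    have "c \<in> cls c" unfolding cls_eq
      by (rule image_eqI[of _ _ "\<lambda>_ _ _. 0"]) (simp_all add: zero_B2)
    then show "\<forall>D\<in>DD. restr2 D c \<in> B2 \<Gamma> H D" using a by blast
  next
    assume a: "\<forall>D\<in>DD. restr2 D c \<in> B2 \<Gamma> H D"
    show "\<forall>y\<in>cls c. \<forall>D\<in>DD. restr2 D y \<in> B2 \<Gamma> H D"
    proof (intro ballI)
      fix y D assume y: "y \<in> cls c" and D: "D \<in> DD"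
      obtain b where b: "b \<in> Bg" "y = (\<lambda>g h C. b g h C + c g h C)" using y by (auto simp: cls_eq)
      have "restr2 D y = (\<lambda>g h C. restr2 D b g h C + 1 * restr2 D c g h C)"
        unfolding b(2) restr2_def by (auto simp: fun_eq_iff)
      then show "restr2 D y \<in> B2 \<Gamma> H D"
        using B2_add_scale[OF DD[OF D] restr2_Bg[OF b(1) DD[OF D]], of "restr2 D c" 1] a D by simp
    qed
  qed
  then show ?thesis unfolding Sha2_def H2J_carrier by auto
qed

lemma Sha2_trivial:
  assumes DD: "\<And>D. D \<in> DD \<Longrightarrow> D \<subseteq> G"
    and triv: "\<And>c. c \<in> Z2 \<Gamma> H G \<Longrightarrow> \<forall>D\<in>DD. restr2 D c \<in> B2 \<Gamma> H D \<Longrightarrow> c \<in> Bg"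
  shows "carrier (Sha2 \<Gamma> H DD) = {\<one>\<^bsub>Sha2 \<Gamma> H DD\<^esub>}"
proof -
  have car: "carrier (Sha2 \<Gamma> H DD) = cls ` {c \<in> Z2 \<Gamma> H G. \<forall>D\<in>DD. restr2 D c \<in> B2 \<Gamma> H D}"
    by (rule Sha2_carrier) (rule DD)
  have "(\<lambda>_ _ _. 0) \<in> {c \<in> Z2 \<Gamma> H G. \<forall>D\<in>DD. restr2 D c \<in> B2 \<Gamma> H D}"
    using zero_Z2 zero_B2[OF DD] by (auto simp: restr2_def)
  then have "cls (\<lambda>_ _ _. 0) \<in> carrier (Sha2 \<Gamma> H DD)" unfolding car by blast
  moreover have "cls (\<lambda>_ _ _. 0) = Bg" by (rule cls_B2[OF zero_B2[OF subset_refl]])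
  moreover have "carrier (Sha2 \<Gamma> H DD) \<subseteq> {Bg}"
    unfolding car using triv cls_B2 by auto
  ultimately show ?thesis unfolding H2J_one by auto
qed

end

section \<open>The groups \<open>P'\<close>\<close>

lemma permutes_if_bij:
  assumes "bij s" "\<And>x. x \<notin> S \<Longrightarrow> s x = x" shows "s permutes S"
  using assms unfolding permutes_def bij_iff by blast

text \<open>An element of the Heisenberg group over the field with \<open>p\<close> elements, acting
  on the affine plane: \<open>a\<close> and \<open>c\<close> translate, \<open>e\<close>
  shears.\<close>

definition aff :: "nat \<Rightarrow> nat \<Rightarrow> nat \<Rightarrow> nat \<Rightarrow> nat \<Rightarrow> nat" where
  "aff p a e c x = (if x < p^2 then (x mod p + a) mod p + p * ((x div p + e * (x mod p) + c) mod p) else x)"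

text \<open>The shifts are integers because the exponents in \<open>gamma\<close> are signed
  binomial coefficients.\<close>

definition fshift :: "nat \<Rightarrow> (nat \<Rightarrow> int) \<Rightarrow> nat \<Rightarrow> nat" where
  "fshift p E x = (if x < p^2 then x mod p + p * nat ((int (x div p) + E (x mod p)) mod int p) else x)"

lemma div_less_of_less_square: "x < p^2 \<Longrightarrow> x div p < (p::nat)"
  by (simp add: less_mult_imp_div_less power2_eq_square)

lemma coordinates_less_square: "i < p \<Longrightarrow> j < p \<Longrightarrow> i + p * j < (p::nat)^2"
proof -
  assume "i < p" "j < p"
  then have "i + p * j < p * Suc j" by simp
  also have "\<dots> \<le> p * p" using \<open>j < p\<close> by (intro mult_le_mono2) simp
  finally show ?thesis by (simp add: power2_eq_square)
qed

lemma aff_coords: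
  assumes "p > 0" "x < p^2"
  shows "aff p a e c x < p^2" "aff p a e c x mod p = (x mod p + a) mod p"
    "aff p a e c x div p = (x div p + e * (x mod p) + c) mod p"
  using assms coordinates_less_square[of "(x mod p + a) mod p" p] by (simp_all add: aff_def)

lemma aff_comp:
  assumes "p > 0"
  shows "aff p a e c \<circ> aff p a' e' c' = aff p (a + a') (e + e') (c + c' + e * a')"
proof
  fix x show "(aff p a e c \<circ> aff p a' e' c') x = aff p (a + a') (e + e') (c + c' + e * a') x"
  proof (cases "x < p^2")
    case True
    define i j where "i = x mod p" and "j = x div p"
    have "[(j + e' * i + c') mod p + e * ((i + a') mod p) + c = (j + e' * i + c') + e * (i + a') + c] (mod p)"
      by (intro cong_add cong_scalar_left cong_refl) (simp_all add: cong_def)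
    also have "(j + e' * i + c') + e * (i + a') + c = j + (e + e') * i + (c + c' + e * a')"
      by (simp add: algebra_simps)
    finally have 1: "((j + e' * i + c') mod p + e * ((i + a') mod p) + c) mod p = (j + (e + e') * i + (c + c' + e * a')) mod p"
      by (simp add: cong_def)
    have 2: "((i + a') mod p + a) mod p = (i + (a + a')) mod p"
      by (simp add: mod_simps algebra_simps)
    have y: "aff p a' e' c' x < p^2" "aff p a' e' c' x mod p = (i + a') mod p"
      "aff p a' e' c' x div p = (j + e' * i + c') mod p"
      using aff_coords[OF assms True] by (simp_all add: i_def j_def)
    have "aff p a e c (aff p a' e' c' x) = ((i + a') mod p + a) mod p
        + p * (((j + e' * i + c') mod p + e * ((i + a') mod p) + c) mod p)"
      using y unfolding aff_def[of p a e c] by simp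
    also have "\<dots> = aff p (a + a') (e + e') (c + c' + e * a') x"
      unfolding 1 2 using True by (simp add: aff_def i_def j_def)
    finally show ?thesis by simp
  qed (simp add: aff_def)
qed

lemma aff_cong:
  assumes "[a = a'] (mod p)" "[e = e'] (mod p)" "[c = c'] (mod p)"
  shows "aff p a e c = aff p a' e' c'"
proof
  fix x
  have "[x mod p + a = x mod p + a'] (mod p)" using assms by (intro cong_add cong_refl)
  moreover have "[x div p + e * (x mod p) + c = x div p + e' * (x mod p) + c'] (mod p)"
    using assms by (intro cong_add cong_mult cong_refl)
  ultimately show "aff p a e c x = aff p a' e' c' x" by (simp add: aff_def cong_def)
qed

text \<open>The images of the points 0 and 1, with coordinates (0,0) and (1,0), already determine
  the three parameters modulo \<open>p\<close>.\<close>

lemma aff_inj: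
  assumes p: "p > 1" and eq: "aff p a e c = aff p a' e' c'"
  shows "[a = a'] (mod p)" "[e = e'] (mod p)" "[c = c'] (mod p)"
proof -
  have p2: "0 < p^2" "1 < p^2" using p one_less_power[OF p, of 2] by auto
  have p0: "p > 0" using p by simp
  show "[a = a'] (mod p)"
    using aff_coords(2)[OF p0 p2(1), of a e c] aff_coords(2)[OF p0 p2(1), of a' e' c'] eq by (simp add: cong_def)
  show c: "[c = c'] (mod p)"
    using aff_coords(3)[OF p0 p2(1), of a e c] aff_coords(3)[OF p0 p2(1), of a' e' c'] eq by (simp add: cong_def)
  have "[e + c = e' + c'] (mod p)"
    using aff_coords(3)[OF p0 p2(2), of a e c] aff_coords(3)[OF p0 p2(2), of a' e' c'] eq p by (simp add: cong_def)
  then have "[e + c = e' + c] (mod p)" using c by (meson cong_add cong_refl cong_sym cong_trans)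
  then show "[e = e'] (mod p)" by (simp add: cong_add_rcancel_nat)
qed

lemma aff_id: "p > 0 \<Longrightarrow> aff p 0 0 0 = id"
  by (auto simp: aff_def fun_eq_iff div_less_of_less_square)

lemma aff_pow:
  assumes "p > 0"
  shows "aff p a e c ^^ n = aff p (n * a) (n * e) (n * c + e * a * (n * (n - 1) div 2))"
proof (induction n)
  case 0
  then show ?case using aff_id[OF assms] by (simp add: id_def)
next
  case (Suc n)
  have "Suc n * (Suc n - 1) div 2 = n * (n - 1) div 2 + n"
    by (cases n) (simp_all add: algebra_simps)
  then have "c + (n * c + e * a * (n * (n - 1) div 2)) + e * (n * a) = Suc n * c + e * a * (Suc n * (Suc n - 1) div 2)"
    by (simp only:) (simp add: algebra_simps)
  then show ?case unfolding funpow.simps Suc.IH aff_comp[OF assms] by (simp only: mult_Suc)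
qed

text \<open>Moving shears past translations accumulates \<open>e * a\<close> times
  \<open>p (p - 1) / 2\<close>, which is a multiple of \<open>p\<close> because \<open>p\<close> is
  odd.\<close>

lemma aff_pow_p:
  assumes p: "odd p"
  shows "aff p a e c ^^ p = id"
proof -
  have p0: "p > 0" using p by (cases p) auto
  obtain k where k: "p = 2 * k + 1" using p oddE by blast
  have "p * (p - 1) div 2 = p * k" using k by simp
  then have "[p * c + e * a * (p * (p - 1) div 2) = 0] (mod p)"
    by (simp add: cong_0_iff)
  then have "aff p a e c ^^ p = aff p 0 0 0"
    unfolding aff_pow[OF p0] by (intro aff_cong) (simp_all add: cong_0_iff)
  then show ?thesis using aff_id[OF p0] by simp
qed

lemma aff_permutes:
  assumes "odd p" shows "aff p a e c permutes {..<p^2}"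
proof (rule permutes_if_bij)
  have "p > 0" using assms by (cases p) auto
  then have *: "aff p a e c ^^ Suc (p - 1) = id" using aff_pow_p[OF assms] by simp
  have "aff p a e c \<circ> aff p a e c ^^ (p - 1) = id" using * by (simp only: funpow.simps)
  moreover have "aff p a e c ^^ (p - 1) \<circ> aff p a e c = id" using * by (simp only: funpow_Suc_right)
  ultimately show "bij (aff p a e c)" using o_bij by blast
  show "aff p a e c x = x" if "x \<notin> {..<p^2}" for x using that by (simp add: aff_def)
qed

lemma rho1_aff: "p > 0 \<Longrightarrow> rho1 p = aff p 0 0 1"
  by (auto simp: rho1_def aff_def fun_eq_iff)

lemma rho2_aff: "p > 0 \<Longrightarrow> rho2 p = aff p 1 0 0"
  by (auto simp: rho2_def aff_def fun_eq_iff div_less_of_less_square)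

lemma fshift_coords:
  assumes "p > 0" "x < p^2"
  shows "fshift p E x < p^2" "fshift p E x mod p = x mod p"
    "fshift p E x div p = nat ((int (x div p) + E (x mod p)) mod int p)"
proof -
  have l: "nat ((int (x div p) + E (x mod p)) mod int p) < p"
    using assms(1) by (simp add: nat_less_iff)
  show "fshift p E x < p^2" "fshift p E x mod p = x mod p"
    "fshift p E x div p = nat ((int (x div p) + E (x mod p)) mod int p)"
    using assms coordinates_less_square[OF _ l] by (simp_all add: fshift_def)
qed

lemma fshift_comp:
  assumes "p > 0" shows "fshift p E \<circ> fshift p E' = fshift p (\<lambda>i. E i + E' i)"
proof
  fix x show "(fshift p E \<circ> fshift p E') x = fshift p (\<lambda>i. E i + E' i) x"
  proof (cases "x < p^2")
    case True
    have "fshift p E (fshift p E' x) = x mod p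
        + p * nat ((int (nat ((int (x div p) + E' (x mod p)) mod int p)) + E (x mod p)) mod int p)"
      unfolding fshift_def[of p E] using fshift_coords[OF assms True, of E'] by (simp only: if_True)
    also have "int (nat ((int (x div p) + E' (x mod p)) mod int p)) = (int (x div p) + E' (x mod p)) mod int p"
      using assms by simp
    also have "((int (x div p) + E' (x mod p)) mod int p + E (x mod p)) mod int p
        = ((int (x div p) + E' (x mod p)) + E (x mod p)) mod int p"
      by (rule mod_add_left_eq)
    also have "(int (x div p) + E' (x mod p)) + E (x mod p) = int (x div p) + (E (x mod p) + E' (x mod p))"
      by simp
    finally show ?thesis using True by (simp add: fshift_def)
  qed (simp add: fshift_def)
qed

lemma fshift_cong:
  assumes "p > 0" "\<And>i. i < p \<Longrightarrow> [E i = E' i] (mod int p)"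
  shows "fshift p E = fshift p E'"
proof
  fix x
  have "[int (x div p) + E (x mod p) = int (x div p) + E' (x mod p)] (mod int p)"
    using assms by (intro cong_add cong_refl) simp
  then show "fshift p E x = fshift p E' x" by (simp add: fshift_def cong_def)
qed

lemma fshift_0: "p > 0 \<Longrightarrow> fshift p (\<lambda>_. 0) = id"
  by (auto simp: fshift_def fun_eq_iff div_less_of_less_square simp flip: of_nat_mod)

lemma fshift_permutes:
  assumes "p > 0" shows "fshift p E permutes {..<p^2}"
proof (rule permutes_if_bij)
  have "fshift p E \<circ> fshift p (\<lambda>i. - E i) = id" "fshift p (\<lambda>i. - E i) \<circ> fshift p E = id"
    using assms by (simp_all add: fshift_comp fshift_0)
  then show "bij (fshift p E)" using o_bij by blast
  show "fshift p E x = x" if "x \<notin> {..<p^2}" for x using that by (simp add: fshift_def)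
qed

lemma fshift_aff:
  assumes "p > 0" "\<And>i. i < p \<Longrightarrow> [E i = int (e * i + c)] (mod int p)"
  shows "fshift p E = aff p 0 e c"
proof -
  have "fshift p E = fshift p (\<lambda>i. int (e * i + c))" using assms by (rule fshift_cong)
  also have "\<dots> = aff p 0 e c"
  proof
    fix x
    have "nat ((int (x div p) + int (e * (x mod p) + c)) mod int p) = (x div p + e * (x mod p) + c) mod p"
      by (metis add.assoc nat_int of_nat_add of_nat_mod)
    then show "fshift p (\<lambda>i. int (e * i + c)) x = aff p 0 e c x" by (simp add: fshift_def aff_def)
  qed
  finally show ?thesis .
qed

lemma zz_fshift:
  assumes "p > 0" shows "zz p j = fshift p (\<lambda>i. if i = j then 1 else 0)"
proof
  fix x
  have 1: "nat ((int (x div p) + 1) mod int p) = (x div p + 1) mod p"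
    by (metis nat_int of_nat_1 of_nat_add of_nat_mod)
  have 2: "nat ((int (x div p) + 0) mod int p) = x div p" if "x < p^2"
    using div_less_of_less_square[OF that] by (metis add.right_neutral mod_less nat_int of_nat_mod)
  have 3: "x = x mod p + p * (x div p)" by simp
  show "zz p j x = fshift p (\<lambda>i. if i = j then 1 else 0) x"
    unfolding zz_def fshift_def using 1 2 3 by (cases "x mod p = j") (simp_all only: if_True if_False split: if_splits, auto)
qed

lemma fshift_int_pow:
  assumes p: "p > 0"
  shows "fshift p E [^]\<^bsub>perm_grp (p^2)\<^esub> (k::int) = fshift p (\<lambda>i. k * E i)"
proof -
  have nat: "fshift p E [^]\<^bsub>perm_grp (p^2)\<^esub> (n::nat) = fshift p (\<lambda>i. int n * E i)" for n
    unfolding nat_pow_perm_grp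
  proof (induction n)
    case 0
    then show ?case using fshift_0[OF p] by (simp add: id_def)
  next
    case (Suc n)
    show ?case unfolding funpow.simps Suc.IH fshift_comp[OF p]
      by (simp add: algebra_simps)
  qed
  show ?thesis
  proof (cases "k < 0")
    case True
    have "inv\<^bsub>perm_grp (p^2)\<^esub> (fshift p (\<lambda>i. int (nat (- k)) * E i)) = fshift p (\<lambda>i. k * E i)"
    proof (rule group.inv_equality[OF group_perm_grp])
      show "fshift p (\<lambda>i. k * E i) \<otimes>\<^bsub>perm_grp (p^2)\<^esub> fshift p (\<lambda>i. int (nat (- k)) * E i) = \<one>\<^bsub>perm_grp (p^2)\<^esub>"
        using True p by (simp add: fshift_comp fshift_0)
    qed (simp_all add: fshift_permutes p)
    then show ?thesis using True by (simp add: int_pow_def2 nat)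
  next
    case False
    then show ?thesis by (simp add: int_pow_def2 nat)
  qed
qed

lemma gamma_fshift:
  assumes p: "p > 0" shows "gamma p n = fshift p (acoef (p - n))"
proof -
  define F where "F j g = zz p j [^]\<^bsub>perm_grp (p^2)\<^esub> acoef (p - n) j \<otimes>\<^bsub>perm_grp (p^2)\<^esub> g" for j g
  have "foldr F js \<one>\<^bsub>perm_grp (p^2)\<^esub>
      = fshift p (\<lambda>i. if i \<in> set js then acoef (p - n) i else 0)" if "distinct js" for js
    using that
  proof (induction js)
    case Nil
    then show ?case using fshift_0[OF p] by simp
  next
    case (Cons j js)
    have "(\<lambda>i. acoef (p - n) j * (if i = j then 1 else 0) + (if i \<in> set js then acoef (p - n) i else 0))
        = (\<lambda>i. if i \<in> set (j # js) then acoef (p - n) i else 0)"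
      using Cons.prems by (auto simp: fun_eq_iff)
    moreover have "foldr F js \<one>\<^bsub>perm_grp (p^2)\<^esub>
      = fshift p (\<lambda>i. if i \<in> set js then acoef (p - n) i else 0)"
      by (rule Cons.IH) (use Cons.prems in simp)
    moreover have "foldr F (j # js) \<one>\<^bsub>perm_grp (p^2)\<^esub> = F j (foldr F js \<one>\<^bsub>perm_grp (p^2)\<^esub>)" by simp
    moreover have "F j u = fshift p (\<lambda>i. acoef (p - n) j * (if i = j then 1 else 0)) \<circ> u" for u
      by (simp only: F_def zz_fshift[OF p] fshift_int_pow[OF p] mult_perm_grp)
    ultimately show ?case by (simp only: fshift_comp[OF p])
  qed
  moreover have "gamma p n = foldr F [0..<p] \<one>\<^bsub>perm_grp (p^2)\<^esub>"
    unfolding gamma_def F_def[abs_def] ..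
  ultimately have "gamma p n = fshift p (\<lambda>i. if i \<in> set [0..<p] then acoef (p - n) i else 0)"
    by (metis distinct_upt)
  also have "\<dots> = fshift p (acoef (p - n))" by (rule fshift_cong[OF p]) simp
  finally show ?thesis .
qed

text \<open>Pascal's rule for the coefficients of the powers of X - 1.\<close>

lemma acoef_Suc: "acoef (Suc n) (Suc j) = acoef n j - acoef n (Suc j)"
proof (cases "Suc j \<le> n")
  case True
  then have "n - j = Suc (n - Suc j)" by simp
  then show ?thesis using True by (simp add: acoef_def algebra_simps)
qed (auto simp: acoef_def le_Suc_eq not_less_eq_eq)

text \<open>Modulo \<open>p\<close>, (X - 1)^p is X^p - 1, and division by X - 1 leaves 1 + X + ...
  + X^(p-1). In the induction, the vanishing inner coefficients make neighbouring ones
  congruent.\<close>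

lemma acoef_p_minus_1:
  assumes p: "Factorial_Ring.prime p" "odd p" and j: "j < p"
  shows "[acoef (p - 1) j = 1] (mod int p)"
  using j
proof (induction j)
  case 0
  have "even (p - 1)" using p(2) by simp
  then show ?case by (simp add: acoef_def)
next
  case (Suc j)
  have "p dvd (p choose Suc j)" using Suc.prems by (intro dvd_choose_prime p(1)) auto
  then have "int p dvd acoef p (Suc j)" by (auto simp: acoef_def)
  moreover have "acoef p (Suc j) = acoef (p - 1) j - acoef (p - 1) (Suc j)"
    using acoef_Suc[of "p - 1" j] Suc.prems by simp
  ultimately have "[acoef (p - 1) j = acoef (p - 1) (Suc j)] (mod int p)"
    by (simp add: cong_iff_dvd_diff)
  then show ?case using Suc by (metis Suc_lessD cong_sym cong_trans)
qed

text \<open>One more division by X - 1 turns the constant coefficients into an arithmetic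
  progression. This is why \<open>gamma p 2\<close> is affine.\<close>

lemma acoef_p_minus_2:
  assumes p: "Factorial_Ring.prime p" "odd p" and j: "j < p"
  shows "[acoef (p - 2) j = - (int j + 1)] (mod int p)"
  using j
proof (induction j)
  case 0
  have "p \<ge> 3" using p prime_ge_2_nat[OF p(1)] by (cases "p = 2") auto
  then have "odd (p - 2)" using p(2) by simp
  then show ?case by (simp add: acoef_def)
next
  case (Suc j)
  have p2: "p \<ge> 2" using prime_ge_2_nat[OF p(1)] .
  have "Suc (p - 2) = p - 1" using p2 by simp
  then have "acoef (p - 1) (Suc j) = acoef (p - 2) j - acoef (p - 2) (Suc j)"
    using acoef_Suc[of "p - 2" j] by simp
  then have "acoef (p - 2) (Suc j) = acoef (p - 2) j - acoef (p - 1) (Suc j)" by simp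
  also have "[\<dots> = - (int j + 1) - 1] (mod int p)"
    using Suc acoef_p_minus_1[OF p Suc.prems] by (intro cong_diff) auto
  finally show ?case by (simp add: algebra_simps)
qed

lemma gamma_1: "Factorial_Ring.prime p \<Longrightarrow> odd p \<Longrightarrow> gamma p 1 = aff p 0 0 1"
  unfolding gamma_fshift[OF prime_gt_0_nat] using acoef_p_minus_1
  by (intro fshift_aff) (auto simp: prime_gt_0_nat)

lemma gamma_2:
  assumes "Factorial_Ring.prime p" "odd p" shows "gamma p 2 = aff p 0 (p - 1) (p - 1)"
  unfolding gamma_fshift[OF prime_gt_0_nat[OF assms(1)]]
proof (rule fshift_aff)
  fix i assume i: "i < p"
  obtain q where "p = Suc q" using i by (cases p) auto
  then have "int ((p - 1) * i + (p - 1)) = int p * (int i + 1) - (int i + 1)"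
    by (simp add: algebra_simps)
  then have "[- (int i + 1) = int ((p - 1) * i + (p - 1))] (mod int p)"
    by (simp add: cong_iff_dvd_diff)
  then show "[acoef (p - 2) i = int ((p - 1) * i + (p - 1))] (mod int p)"
    using acoef_p_minus_2[OF assms i] cong_trans by blast
qed (simp add: prime_gt_0_nat assms)

text \<open>One family for both groups: \<open>b = 0\<close> leaves the translations,
  \<open>b = 1\<close> admits every shear. So \<open>P' p n\<close> is the case
  \<open>b = n - 1\<close>.\<close>

definition affs :: "nat \<Rightarrow> nat \<Rightarrow> (nat \<Rightarrow> nat) set" where
  "affs p b = {aff p a (b * e) c |a e c. True}"

lemma affsI: "aff p a (b * e) c \<in> affs p b"
  unfolding affs_def by blast

lemma affsE:
  assumes "s \<in> affs p b" obtains a e c where "s = aff p a (b * e) c"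
  using assms unfolding affs_def by blast

lemma affs_comp:
  assumes "p > 0" "s \<in> affs p b" "u \<in> affs p b" shows "s \<circ> u \<in> affs p b"
proof -
  obtain a e c where s: "s = aff p a (b * e) c" using assms(2) by (rule affsE)
  obtain a' e' c' where u: "u = aff p a' (b * e') c'" using assms(3) by (rule affsE)
  show ?thesis unfolding s u aff_comp[OF assms(1)] distrib_left[symmetric] by (rule affsI)
qed

lemma affs_pow:
  assumes "p > 0" "s \<in> affs p b" shows "s ^^ n \<in> affs p b"
proof -
  obtain a e c where s: "s = aff p a (b * e) c" using assms(2) by (rule affsE)
  show ?thesis unfolding s aff_pow[OF assms(1)] mult.left_commute[of n b] by (rule affsI)
qed

lemma subgroup_affs:
  assumes p: "odd p" shows "subgroup (affs p b) (perm_grp (p^2))"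
proof (rule group.subgroupI[OF group_perm_grp])
  have p0: "p > 0" using p by (cases p) auto
  show "affs p b \<subseteq> carrier (perm_grp (p^2))" "affs p b \<noteq> {}" using aff_permutes[OF p] by (auto simp: affs_def)
  show "s \<otimes>\<^bsub>perm_grp (p^2)\<^esub> u \<in> affs p b" if "s \<in> affs p b" "u \<in> affs p b" for s u
    using that affs_comp[OF p0] by simp
  fix s assume s: "s \<in> affs p b"
  have "s ^^ (p - 1) \<circ> s = s ^^ Suc (p - 1)" by (simp only: funpow_Suc_right)
  also have "\<dots> = id" using s aff_pow_p[OF p] p0 by (auto simp: affs_def)
  finally have "inv\<^bsub>perm_grp (p^2)\<^esub> s = s ^^ (p - 1)"
    using s affs_pow[OF p0 s, of "p - 1"] aff_permutes[OF p]
    by (intro group.inv_equality[OF group_perm_grp]) (auto simp: affs_def)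
  then show "inv\<^bsub>perm_grp (p^2)\<^esub> s \<in> affs p b" using affs_pow[OF p0 s] by simp
qed

lemma P'_carrier:
  assumes p: "Factorial_Ring.prime p" "odd p" and n: "n \<in> {1, 2}"
  shows "carrier (P' p n) = affs p (n - 1)"
proof
  have p0: "p > 0" using prime_gt_0_nat[OF p(1)] .
  have gamma: "gamma p n = aff p 0 ((n - 1) * (p - 1)) (if n = 1 then 1 else p - 1)"
    using n gamma_1[OF p] gamma_2[OF p] by auto
  define K where "K = carrier (P' p n)"
  have K: "K = generate (perm_grp (p^2)) {rho1 p, rho2 p, gamma p n}"
    by (simp add: K_def P'_def)
  have r1: "rho1 p = aff p 0 ((n - 1) * 0) 1" and r2: "rho2 p = aff p 1 ((n - 1) * 0) 0"
    using rho1_aff[OF p0] rho2_aff[OF p0] by simp_all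
  have "{rho1 p, rho2 p, gamma p n} \<subseteq> affs p (n - 1)"
    using affsI[of p 0 "n - 1" 0 1] affsI[of p 1 "n - 1" 0 0] affsI[of p 0 "n - 1" "p - 1"]
    unfolding r1[symmetric] r2[symmetric] gamma by blast
  then show "carrier (P' p n) \<subseteq> affs p (n - 1)"
    unfolding K[unfolded K_def]
    by (rule group.generate_subgroup_incl[OF group_perm_grp _ subgroup_affs[OF p(2)]])
  have incl: "rho1 p \<in> K" "rho2 p \<in> K" "gamma p n \<in> K" unfolding K by (auto intro: generate.incl)
  have one: "id \<in> K" unfolding K using generate.one[of "perm_grp (p^2)"] by simp
  have cl: "s \<circ> u \<in> K" if "s \<in> K" "u \<in> K" for s u
    using generate.eng[of s "perm_grp (p^2)" _ u] that unfolding K by simp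
  have pw: "s ^^ k \<in> K" if "s \<in> K" for s k
    by (induction k) (use that one cl in \<open>simp_all only: funpow.simps\<close>)
  have tr: "aff p a 0 c \<in> K" for a c
  proof -
    have "rho2 p ^^ a \<circ> rho1 p ^^ c = aff p a 0 c"
      unfolding rho1_aff[OF p0] rho2_aff[OF p0] aff_pow[OF p0] aff_comp[OF p0] by simp
    then show ?thesis using cl pw incl by metis
  qed
  show "affs p (n - 1) \<subseteq> carrier (P' p n)"
  proof
    fix s assume "s \<in> affs p (n - 1)"
    then obtain a e c where s: "s = aff p a ((n - 1) * e) c" by (rule affsE)
    show "s \<in> carrier (P' p n)"
    proof (cases "n = 1")
      case True
      then show ?thesis using tr unfolding s K_def by simp
    next
      case False
      then have n2: "n = 2" using n by simp
      obtain q where q: "p = Suc q" using p0 by (cases p) auto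
      \<comment> \<open>\<open>gamma p 2\<close> has shear and translation -1, so the exponent
        \<open>- e\<close> produces the shear \<open>e\<close>. The translation that comes with it
        is undone by the factor \<open>p - 1\<close>, which stands for -1.\<close>
      define k where "k = (p - 1) * e"
      have "[k * (p - 1) = e] (mod p)"
      proof -
        have "k * (p - 1) + p * (2 * e) = e + p * (p * e)" unfolding k_def q by (simp add: algebra_simps)
        then have "[k * (p - 1) + p * (2 * e) = e + p * (p * e)] (mod p)" by simp
        then show ?thesis unfolding cong_def mod_mult_self2 .
      qed
      moreover have "[c + (p - 1) * (k * (p - 1)) + k * (p - 1) = c] (mod p)"
      proof -
        have "c + (p - 1) * (k * (p - 1)) + k * (p - 1) = c + p * (k * (p - 1))"
          unfolding q by (simp add: algebra_simps)
        then show ?thesis by (simp only: cong_def mod_mult_self2)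
      qed
      ultimately have "aff p a (k * (p - 1)) (c + (p - 1) * (k * (p - 1)) + k * (p - 1)) = s"
        unfolding s n2 by (intro aff_cong) simp_all
      moreover have "aff p a 0 (c + (p - 1) * (k * (p - 1))) \<circ> gamma p n ^^ k
          = aff p a (k * (p - 1)) (c + (p - 1) * (k * (p - 1)) + k * (p - 1))"
        unfolding n2 gamma_2[OF p] aff_pow[OF p0] aff_comp[OF p0] by simp
      ultimately show ?thesis using cl[OF tr pw[OF incl(3)]] unfolding K_def by metis
    qed
  qed
qed

lemma P'_aff:
  assumes p: "Factorial_Ring.prime p" "odd p" and n: "n \<in> {1, 2}" and "s \<in> carrier (P' p n)"
  obtains a e c where "s = aff p a e c"
  using assms affsE unfolding P'_carrier[OF p n] by metis

text \<open>Class at most two, stated without inverses: \<open>c\<close> is a commutator of \<open>g\<close> and \<open>h\<close>.\<close>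

lemma P'_class_2:
  assumes p: "Factorial_Ring.prime p" "odd p" and n: "n \<in> {1, 2}"
    and "g \<in> carrier (P' p n)" "h \<in> carrier (P' p n)" "c \<in> carrier (P' p n)" "k \<in> carrier (P' p n)"
    and eq: "g \<circ> h = c \<circ> (h \<circ> g)"
  shows "c \<circ> k = k \<circ> c"
proof -
  have p1: "p > 1" and p0: "p > 0" using prime_gt_1_nat[OF p(1)] by auto
  obtain a1 e1 c1 a2 e2 c2 a3 e3 c3 a4 e4 c4 where
    g: "g = aff p a1 e1 c1" and h: "h = aff p a2 e2 c2" and c: "c = aff p a3 e3 c3" and k: "k = aff p a4 e4 c4"
    using assms(4-7) P'_aff[OF p n] by metis
  note ceq = eq[unfolded g h c aff_comp[OF p0]]
  have "[a1 + a2 = a3 + (a2 + a1)] (mod p)" using aff_inj(1)[OF p1 ceq] .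
  then have "[0 + (a2 + a1) = a3 + (a2 + a1)] (mod p)" by (simp add: add.commute)
  then have a3: "[a3 = 0] (mod p)" unfolding cong_add_rcancel_nat by (rule cong_sym)
  have "[e1 + e2 = e3 + (e2 + e1)] (mod p)" using aff_inj(2)[OF p1 ceq] .
  then have "[0 + (e2 + e1) = e3 + (e2 + e1)] (mod p)" by (simp add: add.commute)
  then have e3: "[e3 = 0] (mod p)" unfolding cong_add_rcancel_nat by (rule cong_sym)
  have "c = aff p 0 0 c3" unfolding c using a3 e3 by (intro aff_cong) auto
  then show ?thesis unfolding k by (simp add: aff_comp[OF p0] add.commute)
qed

lemma P'_pow_p:
  assumes p: "Factorial_Ring.prime p" "odd p" and n: "n \<in> {1, 2}" and g: "g \<in> carrier (P' p n)"
  shows "g ^^ p = id"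
  using P'_aff[OF p n g] aff_pow_p[OF p(2)] by metis

text \<open>An abstract isomorphism does not tell how \<open>G\<close> acts on the points. These two
  properties are what is carried over from \<open>P'\<close>, and the computation of
  \<open>Sha2\<close> rests on them.\<close>

lemma iso_P'_properties:
  assumes p: "Factorial_Ring.prime p" "odd p" and n: "n \<in> {1, 2}"
    and iso: "(perm_grp (p^2))\<lparr>carrier := G\<rparr> \<cong> P' p n" and G: "subgroup G (perm_grp (p^2))"
  shows "g \<in> G \<Longrightarrow> g ^^ p = id"
    and "\<lbrakk>g \<in> G; h \<in> G; c \<in> G; k \<in> G; g \<circ> h = c \<circ> (h \<circ> g)\<rbrakk> \<Longrightarrow> c \<circ> k = k \<circ> c"
proof -
  obtain \<phi> where \<phi>: "\<phi> \<in> iso ((perm_grp (p^2))\<lparr>carrier := G\<rparr>) (P' p n)" using iso by (auto simp: is_iso_def)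
  then have car: "\<And>g. g \<in> G \<Longrightarrow> \<phi> g \<in> carrier (P' p n)"
    and mult: "\<And>g h. g \<in> G \<Longrightarrow> h \<in> G \<Longrightarrow> \<phi> (g \<circ> h) = \<phi> g \<circ> \<phi> h"
    and inj: "inj_on \<phi> G"
    by (auto simp: iso_def hom_def bij_betw_def P'_def)
  have cl: "\<And>g h. g \<in> G \<Longrightarrow> h \<in> G \<Longrightarrow> g \<circ> h \<in> G" and id: "id \<in> G"
    using subgroup.m_closed[OF G] subgroup.one_closed[OF G] by auto
  \<comment> \<open>\<open>\<phi> id\<close> is an idempotent bijection, hence the identity.\<close>
  have "bij (\<phi> id)"
    using P'_aff[OF p n car[OF id]] permutes_bij[OF aff_permutes[OF p(2)]] by metis
  moreover have "\<phi> id \<circ> \<phi> id = \<phi> id" using mult[OF id id] by simp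
  ultimately have phi_id: "\<phi> id = id" by (metis bij_is_inj comp_apply ext id_apply inj_eq)
  show "g ^^ p = id" if g: "g \<in> G"
  proof -
    have pw: "g ^^ m \<in> G \<and> \<phi> (g ^^ m) = \<phi> g ^^ m" for m
    proof (induction m)
      case (Suc m)
      then show ?case using mult[OF g] cl[OF g] by (simp only: funpow.simps)
    qed (use id phi_id in \<open>simp add: id_def\<close>)
    then have "\<phi> (g ^^ p) = \<phi> id" using P'_pow_p[OF p n car[OF g]] phi_id by simp
    then show ?thesis using inj pw id by (meson inj_onD)
  qed
  show "c \<circ> k = k \<circ> c" if "g \<in> G" "h \<in> G" "c \<in> G" "k \<in> G" "g \<circ> h = c \<circ> (h \<circ> g)"
  proof -
    have "\<phi> g \<circ> \<phi> h = \<phi> c \<circ> (\<phi> h \<circ> \<phi> g)" using that mult cl by metis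
    then have "\<phi> c \<circ> \<phi> k = \<phi> k \<circ> \<phi> c" using P'_class_2[OF p n] car that by blast
    then have "\<phi> (c \<circ> k) = \<phi> (k \<circ> c)" using mult that by simp
    then show ?thesis using inj cl that by (meson inj_onD)
  qed
qed

section \<open>Affine actions\<close>

lemma int_cong_diff:
  assumes "[a = b + c] (mod (n::nat))" shows "[int a - int b = int c] (mod int n)"
proof -
  have "[int a = int b + int c] (mod int n)" using assms by (metis cong_int_iff of_nat_add)
  from cong_diff[OF this cong_refl[of "int b"]] show ?thesis by simp
qed

context tower
begin

text \<open>Stated in the integers because of the subtraction. In coordinates it says that every
  element of \<open>M\<close> acts as a shear combined with a translation.\<close>

definition affine :: bool where
  "affine \<longleftrightarrow> (\<forall>m\<in>M. \<forall>l. [int (f l m) = int (f 0 m) + int l * (int (f 1 m) - int (f 0 m))] (mod int p))"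

lemma int_f_comp: "m \<in> M \<Longrightarrow> n \<in> M \<Longrightarrow> [int (f l (m \<circ> n)) = int (f l m) + int (f l n)] (mod int p)"
  using f_comp[of m n l] by (metis cong_int_iff of_nat_add)

lemma int_f_pow: "m \<in> M \<Longrightarrow> [int (f l (m ^^ k)) = int k * int (f l m)] (mod int p)"
  using f_pow[of m l k] by (metis cong_int_iff of_nat_mult)

lemma f_eq_iff: "m \<in> M \<Longrightarrow> n \<in> M \<Longrightarrow> f l m = f l' n \<longleftrightarrow> [int (f l m) = int (f l' n)] (mod int p)"
  using f_less by (metis cong_int_iff cong_less_modulus_unique_nat cong_refl)

lemma f_0_shift:
  assumes "m \<in> M" obtains n where "n \<in> M" "f 0 n = 0" "\<And>l. [int (f l n) = int (f l m) - int (f 0 m)] (mod int p)"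
proof -
  define n where "n = m \<circ> z ^^ (p - f 0 m)"
  have n: "n \<in> M" unfolding n_def using assms z_M M_pow M_comp by blast
  have fl: "[int (f l n) = int (f l m) - int (f 0 m)] (mod int p)" for l
  proof -
    have "[int (f l n) = int (f l m) + int (p - f 0 m) * int (f l z)] (mod int p)"
      unfolding n_def using int_f_comp[OF assms M_pow[OF z_M]] int_f_pow[OF z_M]
      by (meson cong_add cong_refl cong_trans)
    also have "int (f l m) + int (p - f 0 m) * int (f l z) = int (f l m) - int (f 0 m) + int p"
      using f_less[OF assms, of 0] by (simp add: f_z of_nat_diff)
    also have "[\<dots> = int (f l m) - int (f 0 m)] (mod int p)" by (simp add: cong_def)
    finally show ?thesis .
  qed
  have "[int (f 0 n) = int (f 0 id)] (mod int p)" using fl[of 0] by (simp add: f_id)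
  then have "f 0 n = 0" using f_eq_iff[OF n M_id] f_id by metis
  then show ?thesis using that n fl by blast
qed

text \<open>On \<open>M\<close> the successive differences of \<open>f\<close> form a geometric sequence, because \<open>f 1 - f 0\<close>
  determines the element up to powers of \<open>z\<close>; its ratio is \<open>1\<close> since it has period \<open>p\<close>.\<close>

lemma affine_if_no_two_fixed_blocks:
  assumes tp: "t ^^ p = id"
    and small: "\<And>m. m \<in> M \<Longrightarrow> f 0 m = 0 \<Longrightarrow> f 2 m = 0 \<Longrightarrow> f 1 m = 0"
  shows affine
proof -
  \<comment> \<open>If some \<open>h\<close> has \<open>f 0 h = 0\<close> and
    \<open>f 1 h \<noteq> 0\<close>, a nonzero \<open>f 2 m\<close> could be used to cancel
    \<open>f 2 h\<close> without changing \<open>f 0\<close> and \<open>f 1\<close>, against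
    \<open>small\<close>. If there is no such \<open>h\<close>, conjugation with \<open>t\<close>
    moves the shifts of \<open>m\<close> down by one block, where \<open>f 0 = 0\<close> forces
    \<open>f 1 = 0\<close>.\<close>
  have two: "f 2 m = 0" if m: "m \<in> M" "f 0 m = 0" "f 1 m = 0" for m
  proof (cases "\<exists>h\<in>M. f 0 h = 0 \<and> f 1 h \<noteq> 0")
    case True
    then obtain h where h: "h \<in> M" "f 0 h = 0" "f 1 h \<noteq> 0" by blast
    show ?thesis
    proof (rule ccontr)
      assume "f 2 m \<noteq> 0"
      then have "\<not> p dvd f 2 m" using f_less[OF m(1), of 2] by (auto dest: dvd_imp_le)
      then obtain b where b: "[f 2 m * b = Suc 0] (mod p)" using inverse_mod_prime[OF prime_p] by blast
      \<comment> \<open>\<open>k\<close> solves \<open>f 2 h + k * f 2 m = 0\<close> modulo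
        \<open>p\<close>.\<close>
      define k where "k = b * (p - f 2 h)"
      define n where "n = h \<circ> m ^^ k"
      have n: "n \<in> M" unfolding n_def using h m M_pow M_comp by blast
      have fn: "[f l n = f l h + k * f l m] (mod p)" for l
        unfolding n_def using f_comp[OF h(1) M_pow[OF m(1)]] f_pow[OF m(1)]
        by (meson cong_add cong_refl cong_trans)
      have zero: "f l n = 0" if "[f l n = 0] (mod p)" for l
        using that f_less[OF n, of l] by (simp add: cong_def)
      have "f 0 n = 0" using fn[of 0] h(2) m(2) zero by simp
      moreover have "f 2 n = 0"
      proof (rule zero)
        have "k * f 2 m = (f 2 m * b) * (p - f 2 h)" unfolding k_def by simp
        then have "[f 2 h + k * f 2 m = f 2 h + Suc 0 * (p - f 2 h)] (mod p)"
          using b by (metis cong_add cong_refl cong_scalar_right)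
        also have "f 2 h + Suc 0 * (p - f 2 h) = p" using f_less[OF h(1), of 2] by simp
        finally show "[f 2 n = 0] (mod p)" using fn[of 2] by (simp add: cong_def)
      qed
      ultimately have "f 1 n = 0" using small n by blast
      then have "[f 1 h = 0] (mod p)" using fn[of 1] m(3) by (simp add: cong_def)
      then show False using h(3) f_less[OF h(1), of 1] by (simp add: cong_def)
    qed
  next
    case False
    have "f 0 (pinv t \<circ> m \<circ> t) = 0" using f_conj'[OF m(1), of 0] m(3) by simp
    then have "f 1 (pinv t \<circ> m \<circ> t) = 0" using False M_conj'[OF m(1)] by blast
    then show ?thesis using f_conj'[OF m(1), of 1] by (simp add: numeral_2_eq_2)
  qed
  have two_diff: "f 2 m = f 1 m" if m: "m \<in> M" "f 1 m = f 0 m" for m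
  proof -
    obtain n where n: "n \<in> M" "f 0 n = 0" "\<And>l. [int (f l n) = int (f l m) - int (f 0 m)] (mod int p)"
      using f_0_shift[OF m(1)] by blast
    have "[int (f 1 n) = int (f 0 n)] (mod int p)" using n(3)[of 1] n(2) m(2) by simp
    then have "f 1 n = 0" using f_eq_iff[OF n(1) n(1)] n(2) by metis
    then have "f 2 n = 0" using two n by blast
    then have "[int (f 2 m) = int (f 1 m)] (mod int p)"
      using cong_add[OF n(3)[of 2] cong_refl[of "int (f 0 m)"]] m(2) by (simp add: cong_sym)
    then show ?thesis using f_eq_iff[OF m(1) m(1)] by blast
  qed
  \<comment> \<open>\<open>\<mu>\<close> is the ratio of successive differences. It is read off at a
    shear \<open>h\<close> whose first difference is 1; without shears these differences vanish and
    1 may be taken.\<close>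
  obtain \<mu> :: int where \<mu>: "\<And>m. m \<in> M \<Longrightarrow>
      [int (f 2 m) - int (f 1 m) = \<mu> * (int (f 1 m) - int (f 0 m))] (mod int p)"
    and \<mu>p: "(\<forall>m\<in>M. f 1 m = f 0 m) \<or> (\<exists>h\<in>M. [f 1 h = f 0 h + 1] (mod p))"
  proof (cases "\<forall>m\<in>M. f 1 m = f 0 m")
    case True
    show ?thesis by (rule that[of 1]) (use True two_diff in auto)
  next
    case False
    then obtain h where h: "h \<in> M" "[f 1 h = f 0 h + 1] (mod p)"
      using shear_exists M_pow by metis
    show ?thesis
    proof (rule that[of "int (f 2 h) - int (f 1 h)"])
      fix m assume m: "m \<in> M"
      obtain n k where n: "n \<in> M" "f 1 n = f 0 n" "m = n \<circ> h ^^ k" and k: "[f 1 m = f 0 m + k] (mod p)"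
        using shear_decomp[OF h m] by blast
      have k': "[int (f 1 m) - int (f 0 m) = int k] (mod int p)"
        by (rule int_cong_diff[OF k])
      have fm: "[int (f l m) = int (f l n) + int k * int (f l h)] (mod int p)" for l
        unfolding n(3) using int_f_comp[OF n(1) M_pow[OF h(1)]] int_f_pow[OF h(1)]
        by (meson cong_add cong_refl cong_trans)
      have "[int (f 2 m) - int (f 1 m) = (int (f 2 n) + int k * int (f 2 h)) - (int (f 1 n) + int k * int (f 1 h))] (mod int p)"
        by (intro cong_diff fm)
      also have "(int (f 2 n) + int k * int (f 2 h)) - (int (f 1 n) + int k * int (f 1 h)) = (int (f 2 h) - int (f 1 h)) * int k"
        using two_diff[OF n(1,2)] by (simp add: algebra_simps)
      also have "[\<dots> = (int (f 2 h) - int (f 1 h)) * (int (f 1 m) - int (f 0 m))] (mod int p)"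
        by (rule cong_scalar_left[OF cong_sym[OF k']])
      finally show "[int (f 2 m) - int (f 1 m) = (int (f 2 h) - int (f 1 h)) * (int (f 1 m) - int (f 0 m))] (mod int p)" .
    qed (use h in blast)
  qed
  have step: "[int (f (Suc l) m) - int (f l m) = \<mu> ^ l * (int (f 1 m) - int (f 0 m))] (mod int p)" if "m \<in> M" for l m
    using that
  proof (induction l arbitrary: m)
    case (Suc l)
    define n where "n = pinv t \<circ> m \<circ> t"
    have n: "n \<in> M" unfolding n_def using M_conj' Suc.prems .
    have fn: "f l n = f (Suc l) m" for l unfolding n_def using f_conj' Suc.prems .
    have "[int (f (Suc l) n) - int (f l n) = \<mu> ^ l * (int (f 1 n) - int (f 0 n))] (mod int p)"
      by (rule Suc.IH[OF n])
    also have "int (f 1 n) - int (f 0 n) = int (f 2 m) - int (f 1 m)"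
      by (simp add: fn numeral_2_eq_2)
    also have "[\<mu> ^ l * (int (f 2 m) - int (f 1 m)) = \<mu> ^ l * (\<mu> * (int (f 1 m) - int (f 0 m)))] (mod int p)"
      by (intro cong_scalar_left \<mu> Suc.prems)
    finally show ?case unfolding fn by (simp add: algebra_simps)
  qed simp
  have mu1: "[\<mu> * (int (f 1 m) - int (f 0 m)) = int (f 1 m) - int (f 0 m)] (mod int p)" if m: "m \<in> M" for m
    using \<mu>p
  proof
    assume "\<exists>h\<in>M. [f 1 h = f 0 h + 1] (mod p)"
    then obtain h where h: "h \<in> M" "[f 1 h = f 0 h + 1] (mod p)" by blast
    \<comment> \<open>As \<open>t ^^ p = id\<close>, the rows close up without a twist and the
      differences have period \<open>p\<close>. At \<open>h\<close> this gives
      \<open>\<mu> ^ p = 1\<close>, and by Fermat \<open>\<mu> ^ p\<close> is \<open>\<mu>\<close>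
      itself.\<close>
    have "P p j = P 0 j" for j using t_P[of p 0 j] tp by simp
    moreover have "P (Suc p) j = P 1 j" for j using t_P[of p 1 j] tp by simp
    ultimately have per: "f p h = f 0 h" "f (Suc p) h = f 1 h" unfolding f_def by simp_all
    have h': "[int (f 1 h) - int (f 0 h) = 1] (mod int p)"
      using int_cong_diff[OF h(2)] by simp
    have "[int (f 1 h) - int (f 0 h) = \<mu> ^ p * (int (f 1 h) - int (f 0 h))] (mod int p)"
      using step[OF h(1), of p] unfolding per .
    then have mup: "[1 = \<mu> ^ p * 1] (mod int p)"
      using h' by (meson cong_scalar_left cong_sym cong_trans)
    define \<nu> where "\<nu> = nat (\<mu> mod int p)"
    have nu: "[int \<nu> = \<mu>] (mod int p)" unfolding \<nu>_def using p_gt_1 by (simp add: cong_def)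
    have nup: "[1 = \<nu> ^ p] (mod p)"
      using mup cong_pow[OF nu, of p] by (metis cong_int_iff cong_sym cong_trans mult.right_neutral of_nat_1 of_nat_power)
    have "\<not> p dvd \<nu>"
    proof
      assume "p dvd \<nu>"
      then have "p dvd \<nu> ^ p" using p_gt_1 by (simp add: dvd_power_le[of p \<nu> 1 p, simplified])
      then have "[1 = 0] (mod p)" using nup by (simp add: cong_def dvd_eq_mod_eq_0)
      then show False using p_gt_1 by (simp add: cong_def)
    qed
    then have "[\<nu> ^ (p - 1) = 1] (mod p)" by (rule fermat_theorem[OF prime_p])
    then have "[\<nu> ^ (p - 1) * \<nu> = 1 * \<nu>] (mod p)" by (rule cong_scalar_right)
    also have "\<nu> ^ (p - 1) * \<nu> = \<nu> ^ p" using p_gt_1 by (cases p) auto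
    finally have "[1 = 1 * \<nu>] (mod p)" by (rule cong_trans[OF nup])
    then have "[\<nu> = 1] (mod p)" by (simp add: cong_sym)
    then have "[\<mu> = 1] (mod int p)" using nu by (metis cong_int_iff cong_sym cong_trans of_nat_1)
    then show ?thesis using cong_scalar_right[of \<mu> 1 "int p" "int (f 1 m) - int (f 0 m)"] by simp
  qed (use m in simp)
  have step1: "[int (f (Suc l) m) - int (f l m) = int (f 1 m) - int (f 0 m)] (mod int p)" if m: "m \<in> M" for l m
  proof -
    have "[\<mu> ^ l * (int (f 1 m) - int (f 0 m)) = int (f 1 m) - int (f 0 m)] (mod int p)" for l
    proof (induction l)
      case (Suc l)
      have "[\<mu> * (\<mu> ^ l * (int (f 1 m) - int (f 0 m))) = \<mu> * (int (f 1 m) - int (f 0 m))] (mod int p)"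
        using Suc by (rule cong_scalar_left)
      then show ?case using mu1[OF m] cong_trans by (simp add: mult.assoc) 
    qed simp
    then show ?thesis using step[OF m, of l] cong_trans by blast
  qed
  have "[int (f l m) = int (f 0 m) + int l * (int (f 1 m) - int (f 0 m))] (mod int p)" if m: "m \<in> M" for l m
  proof (induction l)
    case (Suc l)
    have "[(int (f (Suc l) m) - int (f l m)) + int (f l m) = (int (f 1 m) - int (f 0 m))
        + (int (f 0 m) + int l * (int (f 1 m) - int (f 0 m)))] (mod int p)"
      using step1[OF m, of l] Suc by (rule cong_add)
    then show ?case by (simp add: algebra_simps)
  qed simp
  then show ?thesis unfolding affine_def by blast
qed

text \<open>The commutator \<open>c\<close> of \<open>t\<close> and \<open>m\<close> is central, so
  it shifts all blocks by the same amount. That amount is, up to sign, the difference of the shifts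
  of \<open>m\<close> on consecutive blocks.\<close>

lemma affine_if_class_2:
  assumes class_2: "\<And>g h c k. \<lbrakk>g \<in> G; h \<in> G; c \<in> G; k \<in> G; g \<circ> h = c \<circ> (h \<circ> g)\<rbrakk> \<Longrightarrow> c \<circ> k = k \<circ> c"
  shows affine
  unfolding affine_def
proof (intro ballI allI)
  fix m l assume m: "m \<in> M"
  define c where "c = t \<circ> m \<circ> pinv t \<circ> pinv m"
  have tm: "t \<circ> m \<circ> pinv t \<in> M" using M_conj m t_in by blast
  have c: "c \<in> M" unfolding c_def using tm M_inv[OF m] M_comp by blast
  have "t \<circ> m = c \<circ> (m \<circ> t)"
    unfolding c_def using M_G[OF m] t_in by (simp add: fun_eq_iff)
  then have "c \<circ> t = t \<circ> c" using class_2[OF t_in M_G[OF m] M_G[OF c] t_in] by blast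
  then have fc: "f l c = f 0 c" for l using centralizer_t(1)[OF c] by metis
  have "c \<circ> m = t \<circ> m \<circ> pinv t" unfolding c_def using M_G[OF m] by (simp add: fun_eq_iff)
  then have step: "[int (f l m) = int (f 0 c) + int (f (Suc l) m)] (mod int p)" for l
    using int_f_comp[OF c m, of "Suc l"] f_conj[OF m, of l] unfolding fc[of "Suc l"] by metis
  have step': "[int (f (Suc l) m) = int (f l m) - int (f 0 c)] (mod int p)" for l
    using cong_diff[OF cong_sym[OF step[of l]] cong_refl[of "int (f 0 c)"]] by simp
  have e: "[int (f 1 m) - int (f 0 m) = - int (f 0 c)] (mod int p)"
    using cong_diff[OF step'[of 0] cong_refl[of "int (f 0 m)"]] by simp
  show "[int (f l m) = int (f 0 m) + int l * (int (f 1 m) - int (f 0 m))] (mod int p)"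
  proof (induction l)
    case (Suc l)
    have "[int (f (Suc l) m) = int (f l m) - int (f 0 c)] (mod int p)" by (rule step')
    also have "[int (f l m) - int (f 0 c) = (int (f 0 m) + int l * (int (f 1 m) - int (f 0 m))) + (int (f 1 m) - int (f 0 m))] (mod int p)"
      using cong_add[OF Suc cong_sym[OF e]] by simp
    finally show ?case by (simp add: algebra_simps)
  qed simp
qed

lemma P_period:
  assumes "t ^^ p = id" shows "P (l mod p) j = P l j"
proof -
  have "P (n + p * q) j = P n j" for n q
  proof (induction q)
    case (Suc q)
    then show ?case using t_P[of p "n + p * q" j] assms by (simp add: add_ac)
  qed simp
  from this[of "l mod p" "l div p"] show ?thesis by simp
qed

text \<open>Renumbering \<open>P l j\<close> as the point \<open>l + p * j\<close> turns
  \<open>t\<close> into \<open>rho2\<close>, \<open>z\<close> into \<open>rho1\<close> and, by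
  affinity, the elements of \<open>M\<close> into shears with translations. Conjugation by this
  renumbering is the isomorphism.\<close>

lemma iso_P'_if_affine:
  assumes p: "odd p" and tp: "t ^^ p = id" and aff: affine
  shows "\<exists>n\<in>{1, 2}. (perm_grp (p^2))\<lparr>carrier := G\<rparr> \<cong> P' p n"
proof -
  define \<theta> where "\<theta> x = (if x < p^2 then row x + p * col x else x)" for x
  have th_P: "\<theta> (P l j) = l mod p + p * (j mod p)" for l j
    unfolding \<theta>_def using row_P[of "l mod p" j] col_P[of "l mod p" j] P_period[OF tp, of l j]
    by simp
  have th_less: "\<theta> x < p^2" if "x < p^2" for x
    unfolding \<theta>_def using that coordinates_less_square row_less col_less by simp
  have inj: "inj_on \<theta> {..<p^2}"
  proof (rule inj_onI)
    fix x y assume x: "x \<in> {..<p^2}" and y: "y \<in> {..<p^2}" and e: "\<theta> x = \<theta> y"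
    have xl: "x < p^2" "y < p^2" using x y by auto
    have e': "row x + p * col x = row y + p * col y" using e xl by (simp add: \<theta>_def)
    have "row x = (row x + p * col x) mod p" "row y = (row y + p * col y) mod p"
      using row_less xl by simp_all
    then have r: "row x = row y" using e' by simp
    then have "col x = col y" using e' p_gt_1 by simp
    then show "x = y" using r P_row_col xl by metis
  qed
  have "\<theta> ` {..<p^2} \<subseteq> {..<p^2}" using th_less by auto
  then have "bij_betw \<theta> {..<p^2} {..<p^2}"
    using inj endo_inj_surj[OF finite_lessThan] by (simp add: bij_betw_def)
  then have th: "\<theta> permutes {..<p^2}" by (rule bij_imp_permutes) (simp add: \<theta>_def)
  have th_inv: "pinv \<theta> \<circ> \<theta> = id" "\<theta> \<circ> pinv \<theta> = id"
    using permutes_inv_o[OF th] by auto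
  define \<psi> where "\<psi> g = \<theta> \<circ> g \<circ> pinv \<theta>" for g
  have psi_comp: "\<psi> (g \<circ> h) = \<psi> g \<circ> \<psi> h" for g h
  proof -
    have "\<psi> g \<circ> \<psi> h = \<theta> \<circ> g \<circ> (pinv \<theta> \<circ> \<theta>) \<circ> h \<circ> pinv \<theta>" by (simp only: \<psi>_def comp_assoc)
    then show ?thesis by (simp add: \<psi>_def th_inv comp_assoc)
  qed
  have psi_inj: "inj \<psi>"
  proof (rule injI)
    fix g h assume "\<psi> g = \<psi> h"
    then have "pinv \<theta> \<circ> (\<theta> \<circ> g \<circ> pinv \<theta>) \<circ> \<theta> = pinv \<theta> \<circ> (\<theta> \<circ> h \<circ> pinv \<theta>) \<circ> \<theta>" by (simp add: \<psi>_def)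
    then have "(pinv \<theta> \<circ> \<theta>) \<circ> g \<circ> (pinv \<theta> \<circ> \<theta>) = (pinv \<theta> \<circ> \<theta>) \<circ> h \<circ> (pinv \<theta> \<circ> \<theta>)" by (simp only: comp_assoc)
    then show "g = h" by (simp add: th_inv)
  qed
  have psi_aff: "\<psi> (t ^^ a \<circ> m) = aff p a e (f 0 m)"
    if m: "m \<in> M" and e: "[int e = int (f 1 m) - int (f 0 m)] (mod int p)" for a m e
  proof -
    have "aff p a e (f 0 m) \<circ> \<theta> = \<theta> \<circ> (t ^^ a \<circ> m)"
    proof
      fix x show "(aff p a e (f 0 m) \<circ> \<theta>) x = (\<theta> \<circ> (t ^^ a \<circ> m)) x"
      proof (cases "x < p^2")
        case True
        then obtain l j where lj: "l < p" "j < p" "x = P l j" using P_surj by blast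
        have thx: "\<theta> x = l + p * j" unfolding lj(3) th_P using lj by simp
        have cd: "\<theta> x < p^2" "\<theta> x mod p = l" "\<theta> x div p = j"
          using th_less[OF True] lj unfolding thx by simp_all
        have "[int (f l m) = int (f 0 m) + int l * int e] (mod int p)"
          using aff[unfolded affine_def, rule_format, OF m, of l] cong_scalar_left[OF cong_sym[OF e], of "int l"]
          by (meson cong_add cong_refl cong_trans)
        then have "[f l m = f 0 m + l * e] (mod p)" by (metis cong_int_iff of_nat_add of_nat_mult)
        then have "[j + f l m = j + (f 0 m + l * e)] (mod p)" by (intro cong_add cong_refl)
        also have "j + (f 0 m + l * e) = j + e * l + f 0 m" by simp
        finally have fl: "(j + f l m) mod p = (j + e * l + f 0 m) mod p" by (simp add: cong_def)
        have "(\<theta> \<circ> (t ^^ a \<circ> m)) x = \<theta> (P (l + a) (j + f l m))"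
          using lj(3) by (simp add: M_P[OF m] t_P)
        then show ?thesis unfolding th_P fl using cd by (simp add: aff_def)
      next
        case False
        have "t ^^ a \<circ> m \<in> G" using G_comp G_pow t_in M_G m by blast
        then have "(t ^^ a \<circ> m) x = x" using permutes_not_in[OF G_perm] False by blast
        then show ?thesis using False by (simp add: \<theta>_def aff_def)
      qed
    qed
    then have "\<psi> (t ^^ a \<circ> m) = aff p a e (f 0 m) \<circ> \<theta> \<circ> pinv \<theta>"
      by (simp only: \<psi>_def)
    then show ?thesis by (simp add: th_inv comp_assoc)
  qed
  \<comment> \<open>Without a shear in \<open>M\<close> the image is \<open>P' p 1\<close>; with
    one, its powers supply all shears and the image is \<open>P' p 2\<close>.\<close>
  define b :: nat where "b = (if \<forall>m\<in>M. f 1 m = f 0 m then 0 else 1)"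
  have "\<psi> ` G = affs p b"
  proof
    show "\<psi> ` G \<subseteq> affs p b"
    proof clarify
      fix g assume "g \<in> G"
      then obtain a m where m: "m \<in> M" "g = t ^^ a \<circ> m" using G_decomp by blast
      define e where "e = f 1 m + p - f 0 m"
      have e: "[int e = int (f 1 m) - int (f 0 m)] (mod int p)"
      proof -
        have "int e = int (f 1 m) - int (f 0 m) + int p"
          unfolding e_def using f_less[OF m(1), of 0] by (simp add: of_nat_diff)
        then show ?thesis by (simp only: cong_def mod_add_self2)
      qed
      have be: "[int (b * e) = int (f 1 m) - int (f 0 m)] (mod int p)"
        using e m(1) by (auto simp: b_def)
      show "\<psi> g \<in> affs p b" unfolding m(2) psi_aff[OF m(1) be] by (rule affsI)
    qed
    show "affs p b \<subseteq> \<psi> ` G"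
    proof
      fix s assume "s \<in> affs p b"
      then obtain a e c where s: "s = aff p a (b * e) c" by (rule affsE)
      have "\<exists>h\<in>M. [int (f 1 h) - int (f 0 h) = int b] (mod int p)"
      proof (cases "b = 0")
        case True
        then show ?thesis using z_M f_z by (intro bexI[of _ z]) simp_all
      next
        case False
        then obtain h where "h \<in> M" "f 1 h \<noteq> f 0 h" unfolding b_def by meson
        then obtain h' where h': "h' \<in> M" "[f 1 h' = f 0 h' + 1] (mod p)"
          using shear_exists M_pow by metis
        have "b = 1" using False unfolding b_def by meson
        then have "[int (f 1 h') - int (f 0 h') = int b] (mod int p)"
          using int_cong_diff[OF h'(2)] by simp
        then show ?thesis using h'(1) by blast
      qed
      then obtain h where h: "h \<in> M" "[int (f 1 h) - int (f 0 h) = int b] (mod int p)" by blast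
      \<comment> \<open>\<open>k\<close> is \<open>c - e * f 0 h\<close> modulo \<open>p\<close>,
        chosen to give \<open>m\<close> the shift \<open>c\<close> on block 0.\<close>
      define k where "k = c + (p - 1) * (e * f 0 h)"
      define m where "m = z ^^ k \<circ> h ^^ e"
      have m: "m \<in> M" unfolding m_def using M_comp M_pow z_M h(1) by blast
      have fm: "[f l m = k + e * f l h] (mod p)" for l
      proof -
        have "[f l m = k * f l z + e * f l h] (mod p)"
          unfolding m_def using f_comp[OF M_pow[OF z_M] M_pow[OF h(1)]] f_pow[OF z_M] f_pow[OF h(1)]
          by (meson cong_add cong_trans)
        then show ?thesis by (simp add: f_z)
      qed
      have fm': "[int (f l m) = int k + int e * int (f l h)] (mod int p)" for l
        using fm[of l] by (metis cong_int_iff of_nat_add of_nat_mult)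
      have "k + e * f 0 h = c + p * (e * f 0 h)" unfolding k_def using p_gt_1 by (cases p) simp_all
      then have "[f 0 m = c] (mod p)" using fm[of 0] by (simp add: cong_def)
      moreover have "[int (b * e) = int (f 1 m) - int (f 0 m)] (mod int p)"
      proof (rule cong_sym)
        have "[int (f 1 m) - int (f 0 m) = (int k + int e * int (f 1 h)) - (int k + int e * int (f 0 h))] (mod int p)"
          by (intro cong_diff fm')
        also have "(int k + int e * int (f 1 h)) - (int k + int e * int (f 0 h)) = int e * (int (f 1 h) - int (f 0 h))"
          by (simp add: algebra_simps)
        also have "[\<dots> = int e * int b] (mod int p)" using h(2) by (rule cong_scalar_left)
        finally show "[int (f 1 m) - int (f 0 m) = int (b * e)] (mod int p)" by (simp add: mult.commute)
      qed
      ultimately have "\<psi> (t ^^ a \<circ> m) = s"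
        unfolding s psi_aff[OF m \<open>[int (b * e) = int (f 1 m) - int (f 0 m)] (mod int p)\<close>]
        by (intro aff_cong cong_refl)
      moreover have "t ^^ a \<circ> m \<in> G" using G_comp G_pow t_in M_G m by blast
      ultimately show "s \<in> \<psi> ` G" by blast
    qed
  qed
  moreover have b: "b + 1 \<in> {1, 2}" unfolding b_def by simp
  ultimately have "\<psi> \<in> iso ((perm_grp (p^2))\<lparr>carrier := G\<rparr>) (P' p (b + 1))"
    unfolding iso_def hom_def bij_betw_def P'_carrier[OF prime_p p b]
    using psi_comp inj_on_subset[OF psi_inj subset_UNIV] by (auto simp: P'_def)
  then show ?thesis using b unfolding is_iso_def by blast
qed

end

section \<open>Classes that are trivial on cyclic subgroups\<close>

text \<open>The cycle of \<open>x0\<close> under \<open>z\<close> has at most \<open>p\<close>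
  points, so transitivity supplies a \<open>t\<close> that leaves it.\<close>

lemma (in perm_pgroup) exists_tower:
  assumes "x0 < p^2"
  obtains z t where "tower p G x0 z t"
proof -
  obtain z where z: "z \<in> G" "z \<noteq> id" "z ^^ p = id" "\<And>g. g \<in> G \<Longrightarrow> z \<circ> g = g \<circ> z"
    using exists_central_prime_order by blast
  have "(\<lambda>j. (z ^^ j) x0) ` UNIV \<subseteq> (\<lambda>j. (z ^^ j) x0) ` {..<p}"
  proof
    fix y assume "y \<in> (\<lambda>j. (z ^^ j) x0) ` UNIV"
    then obtain j where "y = (z ^^ j) x0" by blast
    then have "y = (z ^^ (j mod p)) x0" using z(3) by (subst funpow_mod_eq) simp_all
    then show "y \<in> (\<lambda>j. (z ^^ j) x0) ` {..<p}" using p_gt_1 by simp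
  qed
  then have "card ((\<lambda>j. (z ^^ j) x0) ` UNIV) \<le> p"
    using surj_card_le[OF finite_lessThan] by fastforce
  moreover have fin: "finite ((\<lambda>j. (z ^^ j) x0) ` UNIV)"
    using \<open>_ \<subseteq> _\<close> finite_subset by blast
  moreover have "p < p^2" using p_gt_1 by (simp add: power2_eq_square)
  ultimately have "\<not> {..<p^2} \<subseteq> (\<lambda>j. (z ^^ j) x0) ` UNIV"
    using card_mono[OF fin, of "{..<p^2}"] by auto
  then obtain y where y: "y < p^2" "\<And>j. y \<noteq> (z ^^ j) x0" by auto
  obtain t where t: "t \<in> G" "t x0 = y" using G_trans assms y(1) by blast
  have "tower p G x0 z t"
    by unfold_locales (use assms z t y in auto)
  then show ?thesis using that by blast
qed

text \<open>For elements of order \<open>p\<close>, the cyclic groups generated by them meet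
  trivially. The exponents 1 and 0 show that the condition also excludes \<open>id\<close>.\<close>

definition indep :: "nat \<Rightarrow> (nat \<Rightarrow> nat) \<Rightarrow> (nat \<Rightarrow> nat) \<Rightarrow> bool" where
  "indep p a b \<longleftrightarrow> (\<forall>n m. a ^^ n = b ^^ m \<longrightarrow> p dvd n \<and> p dvd m)"

lemma indep_sym: "indep p a b \<Longrightarrow> indep p b a"
  unfolding indep_def by metis

lemma indepI:
  assumes p: "Factorial_Ring.prime p" and a: "a ^^ p = id" "a \<noteq> id" and b: "b ^^ p = id" "b \<notin> range (\<lambda>n. a ^^ n)"
  shows "indep p a b"
  unfolding indep_def
proof (intro allI impI)
  fix n m assume e: "a ^^ n = b ^^ m"
  have m: "p dvd m"
  proof (rule ccontr)
    assume "\<not> p dvd m"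
    then obtain k where "[m * k = Suc 0] (mod p)" using inverse_mod_prime[OF p] by blast
    then have "b ^^ (m * k) = b ^^ Suc 0" by (rule funpow_cong_mod[OF b(1)])
    moreover have "b ^^ (m * k) = a ^^ (n * k)" using e by (simp flip: funpow_mult)
    ultimately have "b = a ^^ (n * k)" by simp
    then show False using b(2) by blast
  qed
  then obtain k where "m = p * k" by blast
  then have "b ^^ m = id" using b(1) by (simp flip: funpow_mult)
  then show "p dvd n \<and> p dvd m" using e m funpow_eq_id_prime[OF p a(1)] a(2) by metis
qed

context perm_pgroup_point
begin

lemma subgroup_\<Gamma>D:
  assumes "subgroup D \<Gamma>"
  shows "D \<subseteq> G" "id \<in> D" "\<And>g h. g \<in> D \<Longrightarrow> h \<in> D \<Longrightarrow> g \<circ> h \<in> D" "\<And>g. g \<in> D \<Longrightarrow> pinv g \<in> D"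
proof -
  show DG: "D \<subseteq> G" using subgroup.subset[OF assms] by simp
  show "id \<in> D" using subgroup.one_closed[OF assms] by simp
  show "g \<circ> h \<in> D" if "g \<in> D" "h \<in> D" for g h using subgroup.m_closed[OF assms that] by simp
  show "pinv g \<in> D" if "g \<in> D" for g
    using subgroup.m_inv_closed[OF assms that] inv_\<Gamma> that DG by (metis subsetD)
qed

lemma subgroup_pow:
  assumes "subgroup D \<Gamma>" "g \<in> D" shows "g ^^ n \<in> D"
  by (induction n) (use subgroup_\<Gamma>D[OF assms(1)] assms(2) in \<open>simp_all only: funpow.simps\<close>)

definition sha :: "(nat \<Rightarrow> nat) set set \<Rightarrow> ((nat \<Rightarrow> nat) \<Rightarrow> (nat \<Rightarrow> nat) \<Rightarrow> (nat \<Rightarrow> nat) set \<Rightarrow> int) set" where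
  "sha DD = {c \<in> Z2 \<Gamma> H G. \<forall>D\<in>DD. restr2 D c \<in> B2 \<Gamma> H D}"

text \<open>Each \<open>g\<close> lies in the cyclic group it generates, on which the class is
  trivial. This is how the presence of the cyclic subgroups in \<open>DD\<close> is used.\<close>

lemma sha_fix_const:
  assumes DD: "cyclic_subgroups \<Gamma> \<subseteq> DD" and c: "c \<in> sha DD" and rep: "represents c \<beta>"
  shows "fix_const (p^2) G (Wr \<beta>)"
  unfolding fix_const_def
proof (intro ballI allI impI)
  fix g x y assume g: "g \<in> G" and x: "x < p^2" "g x = x" and y: "y < p^2" "g y = y"
  interpret cocycle p G "Wr \<beta>" by unfold_locales (rule Wr_proj_cocycle[OF rep])
  define D where "D = generate \<Gamma> {g}"
  have "D \<in> DD" using DD g unfolding D_def cyclic_subgroups_def by auto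
  then have "restr2 D c \<in> B2 \<Gamma> H D" "c \<in> cochains2 \<Gamma> H G"
    using c Z2_cochains2 unfolding sha_def by auto
  moreover have "subgroup D \<Gamma>"
    unfolding D_def by (rule group.generate_is_subgroup[OF group_G]) (use g in simp)
  ultimately have "coh_trivial (p^2) D (Wr \<beta>)"
    using restr2_B2_iff[OF _ rep subgroup_\<Gamma>D(2,1,3)] by blast
  moreover have "g \<in> D" unfolding D_def by (rule generate.incl) simp
  ultimately show "Wr \<beta> g x = Wr \<beta> g y" using coh_trivial_fix x y by blast
qed

lemma sha_trivial_on:
  assumes "c \<in> sha DD" "represents c \<beta>" "D \<in> DD" "subgroup D \<Gamma>"
  shows "coh_trivial (p^2) D (Wr \<beta>)"
  using restr2_B2_iff[OF _ assms(2) subgroup_\<Gamma>D(2,1,3)[OF assms(4)]] assms(1,3) Z2_cochains2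
  unfolding sha_def by blast

lemma sha_add_scale:
  assumes DD: "\<And>D. D \<in> DD \<Longrightarrow> D \<subseteq> G" and c: "c \<in> sha DD" and c': "c' \<in> sha DD"
  shows "(\<lambda>g h C. c g h C + l * c' g h C) \<in> sha DD"
  unfolding sha_def
proof (intro CollectI conjI ballI)
  show "(\<lambda>g h C. c g h C + l * c' g h C) \<in> Z2 \<Gamma> H G"
    using Z2_add_scale c c' by (simp add: sha_def)
  fix D assume D: "D \<in> DD"
  have "restr2 D (\<lambda>g h C. c g h C + l * c' g h C) = (\<lambda>g h C. restr2 D c g h C + l * restr2 D c' g h C)"
    by (auto simp: restr2_def fun_eq_iff)
  then show "restr2 D (\<lambda>g h C. c g h C + l * c' g h C) \<in> B2 \<Gamma> H D"
    using B2_add_scale[OF DD[OF D]] c c' D by (simp add: sha_def)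
qed

lemma zero_sha: "(\<And>D. D \<in> DD \<Longrightarrow> D \<subseteq> G) \<Longrightarrow> (\<lambda>_ _ _. 0) \<in> sha DD"
  unfolding sha_def using zero_Z2 zero_B2 by (auto simp: restr2_def)

lemma sha_B2:
  assumes "c \<in> sha DD" "represents c \<beta>" shows "c \<in> Bg \<longleftrightarrow> coh_trivial (p^2) G (Wr \<beta>)"
  using B2_G_iff[OF _ assms(2)] assms(1) Z2_cochains2 unfolding sha_def by blast

lemma sha_E:
  assumes "c \<in> sha DD" obtains \<beta> where "represents c \<beta>"
  using assms Z2_represents unfolding sha_def by blast

lemma admissibleD:
  assumes "admissible \<Gamma> DD"
  shows "\<And>D. D \<in> DD \<Longrightarrow> subgroup D \<Gamma>" "cyclic_subgroups \<Gamma> \<subseteq> DD" "\<And>D. D \<in> DD \<Longrightarrow> D \<subseteq> G"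
  using assms subgroup_\<Gamma>D(1) unfolding admissible_def by blast+

lemma cyclic_subgroups_subset: "D \<in> cyclic_subgroups \<Gamma> \<Longrightarrow> D \<subseteq> G"
proof -
  assume "D \<in> cyclic_subgroups \<Gamma>"
  then obtain g where g: "g \<in> G" "D = generate \<Gamma> {g}" unfolding cyclic_subgroups_def by auto
  have "subgroup D \<Gamma>"
    unfolding g(2) by (rule group.generate_is_subgroup[OF group_G]) (use g in simp)
  then show "D \<subseteq> G" by (rule subgroup_\<Gamma>D(1))
qed

theorem iso_P'_if_Sha2_nontrivial:
  assumes odd: "odd p"
    and ne: "carrier (Sha2 \<Gamma> H (cyclic_subgroups \<Gamma>)) \<noteq> {\<one>\<^bsub>Sha2 \<Gamma> H (cyclic_subgroups \<Gamma>)\<^esub>}"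
  shows "\<exists>n\<in>{1, 2}. \<Gamma> \<cong> P' p n"
proof (rule ccontr)
  assume niso: "\<not> ?thesis"
  obtain z t where "tower p G i z t" using exists_tower i by blast
  then interpret tower p G i z t .
  have "c \<in> Bg" if c: "c \<in> sha (cyclic_subgroups \<Gamma>)" for c
  proof -
    obtain \<beta> where rep: "represents c \<beta>" using sha_E[OF c] by blast
    interpret tower_cocycle p G i z t "Wr \<beta>"
      by unfold_locales (use Wr_proj_cocycle[OF rep] sha_fix_const[OF subset_refl c rep] in auto)
    have "Wr \<beta> t (z x) * Wr \<beta> z x = Wr \<beta> z (t x) * Wr \<beta> t x" if x: "x < p^2" for x
    proof (cases "t ^^ p = id")
      case True
      have "\<not> affine" using iso_P'_if_affine[OF odd True] niso by blast
      then obtain m where "m \<in> M" "f 0 m = 0" "f 2 m = 0" "f 1 m \<noteq> 0"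
        using affine_if_no_two_fixed_blocks[OF True] by blast
      then show ?thesis using commute_if_fixes_two_blocks x by blast
    next
      case False
      then show ?thesis using commute_if_t_pow x by blast
    qed
    then show ?thesis using sha_B2[OF c rep] coh_trivial_if_commute by blast
  qed
  then have "carrier (Sha2 \<Gamma> H (cyclic_subgroups \<Gamma>)) = {\<one>\<^bsub>Sha2 \<Gamma> H (cyclic_subgroups \<Gamma>)\<^esub>}"
    by (intro Sha2_trivial cyclic_subgroups_subset) (auto simp: sha_def)
  then show False using ne by contradiction
qed

section \<open>Subgroups isomorphic to \<open>(C_p)^2\<close> as pairs of commuting independent
  elements\<close>

lemma contains_Cp2_indep:
  assumes "contains_Cp2 \<Gamma> p D"
  obtains a b where "a \<in> D" "b \<in> D" "a \<circ> b = b \<circ> a" "indep p a b"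
proof -
  define C where "C = integer_mod_group p \<times>\<times> integer_mod_group p"
  obtain K where K: "K \<subseteq> D" "subgroup K \<Gamma>" "\<Gamma>\<lparr>carrier := K\<rparr> \<cong> C"
    using assms unfolding contains_Cp2_def C_def by blast
  have "group (\<Gamma>\<lparr>carrier := K\<rparr>)" by (rule subgroup.subgroup_is_group[OF K(2) group_G])
  then obtain \<chi> where chi: "\<chi> \<in> iso C (\<Gamma>\<lparr>carrier := K\<rparr>)"
    using group.iso_sym[OF _ K(3)] unfolding is_iso_def by blast
  have carC: "carrier C = {0..<int p} \<times> {0..<int p}"
    using p_gt_1 by (simp add: C_def carrier_integer_mod_group)
  have hom: "\<chi> ((u + u') mod int p, (v + v') mod int p) = \<chi> (u, v) \<circ> \<chi> (u', v')"
    if "u \<in> {0..<int p}" "u' \<in> {0..<int p}" "v \<in> {0..<int p}" "v' \<in> {0..<int p}" for u u' v v'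
  proof -
    have "(u, v) \<in> carrier C" "(u', v') \<in> carrier C" using that by (auto simp: carC)
    then have "\<chi> ((u, v) \<otimes>\<^bsub>C\<^esub> (u', v')) = \<chi> (u, v) \<circ> \<chi> (u', v')"
      using chi by (simp add: iso_def hom_def)
    then show ?thesis by (simp add: C_def DirProd_def)
  qed
  have car: "\<chi> w \<in> K" if "w \<in> carrier C" for w
    using chi that by (auto simp: iso_def hom_def)
  have inj: "inj_on \<chi> (carrier C)" using chi by (auto simp: iso_def bij_betw_def)
  have p1: "1 \<in> {0..<int p}" "0 \<in> {0..<int p}" using p_gt_1 by auto
  define a b where "a = \<chi> (1, 0)" and "b = \<chi> (0, 1)"
  have z00: "\<chi> (0, 0) = id"
  proof -
    have "\<chi> (0, 0) \<circ> \<chi> (0, 0) = \<chi> (0, 0)" using hom[of 0 0 0 0] p1 by simp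
    moreover have "\<chi> (0, 0) \<in> G" using car[of "(0,0)"] p1 K(2) subgroup_\<Gamma>D(1) by (auto simp: carC)
    ultimately show ?thesis using G_inj by (metis comp_apply ext id_apply)
  qed
  have apow: "a ^^ n = \<chi> (int n mod int p, 0)" for n
  proof (induction n)
    case 0
    then show ?case using z00 by (simp add: id_def)
  next
    case (Suc n)
    have "\<chi> ((1 + int n mod int p) mod int p, (0 + 0) mod int p) = \<chi> (1, 0) \<circ> \<chi> (int n mod int p, 0)"
      by (rule hom) (use p1 p_gt_1 in auto)
    then show ?case unfolding funpow.simps Suc a_def[symmetric] by (simp add: mod_simps)
  qed
  have bpow: "b ^^ n = \<chi> (0, int n mod int p)" for n
  proof (induction n)
    case 0
    then show ?case using z00 by (simp add: id_def)
  next
    case (Suc n)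
    have "\<chi> ((0 + 0) mod int p, (1 + int n mod int p) mod int p) = \<chi> (0, 1) \<circ> \<chi> (0, int n mod int p)"
      by (rule hom) (use p1 p_gt_1 in auto)
    then show ?case unfolding funpow.simps Suc b_def[symmetric] by (simp add: mod_simps)
  qed
  show ?thesis
  proof (rule that)
    show "a \<in> D" "b \<in> D" unfolding a_def b_def using car K(1) p1 by (auto simp: carC)
    show "a \<circ> b = b \<circ> a" unfolding a_def b_def using hom[of 1 0 0 1] hom[of 0 1 1 0] p1 by simp
    show "indep p a b" unfolding indep_def
    proof (intro allI impI)
      fix n m assume "a ^^ n = b ^^ m"
      then have "\<chi> (int n mod int p, 0) = \<chi> (0, int m mod int p)" unfolding apow bpow .
      then have "(int n mod int p, 0) = (0, int m mod int p)"
        using inj p_gt_1 by (auto dest!: inj_onD simp: carC)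
      then show "p dvd n \<and> p dvd m" by (auto simp: dvd_eq_mod_eq_0 zmod_int[symmetric])
    qed
  qed
qed

lemma indep_contains_Cp2:
  assumes D: "subgroup D \<Gamma>" and ab: "a \<in> D" "b \<in> D" "a \<circ> b = b \<circ> a"
    and ord: "a ^^ p = id" "b ^^ p = id" and ind: "indep p a b"
  shows "contains_Cp2 \<Gamma> p D"
proof -
  define C where "C = integer_mod_group p \<times>\<times> integer_mod_group p"
  have grpC: "group C" unfolding C_def by (intro DirProd_group group_integer_mod_group)
  have carC: "carrier C = {0..<int p} \<times> {0..<int p}"
    using p_gt_1 by (simp add: C_def carrier_integer_mod_group)
  define \<chi> where "\<chi> w = a ^^ nat (fst w) \<circ> b ^^ nat (snd w)" for w :: "int \<times> int"
  have swap: "a ^^ n \<circ> b ^^ m = b ^^ m \<circ> a ^^ n" for n m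
    using funpow_swap2[OF ab(3)] by (simp add: fun_eq_iff)
  have natp: "c ^^ nat ((u + u') mod int p) = c ^^ nat u \<circ> c ^^ nat u'"
    if "u \<in> {0..<int p}" "u' \<in> {0..<int p}" "c ^^ p = id" for u u' and c :: "nat \<Rightarrow> nat"
  proof -
    have "nat ((u + u') mod int p) = (nat u + nat u') mod p"
      using that by (simp add: nat_mod_distrib nat_add_distrib)
    then have "[nat ((u + u') mod int p) = nat u + nat u'] (mod p)" by (simp add: cong_def)
    then have "c ^^ nat ((u + u') mod int p) = c ^^ (nat u + nat u')" by (rule funpow_cong_mod[OF that(3)])
    then show ?thesis by (simp add: funpow_add)
  qed
  have chi_D: "\<chi> w \<in> D" for w
    unfolding \<chi>_def using subgroup_\<Gamma>D(3)[OF D] subgroup_pow[OF D] ab by blast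
  have DG: "D \<subseteq> G" using subgroup_\<Gamma>D(1)[OF D] .
  have hom: "\<chi> \<in> hom C \<Gamma>"
  proof (rule homI)
    show "\<chi> w \<in> carrier \<Gamma>" for w using subsetD[OF DG chi_D[of w]] by simp
    fix w w' assume w: "w \<in> carrier C" and w': "w' \<in> carrier C"
    obtain u v u' v' where uv: "w = (u, v)" "w' = (u', v')" by fastforce
    have "\<chi> (w \<otimes>\<^bsub>C\<^esub> w') = a ^^ nat ((u + u') mod int p) \<circ> b ^^ nat ((v + v') mod int p)"
      unfolding uv \<chi>_def C_def by (simp add: DirProd_def)
    also have "\<dots> = (a ^^ nat u \<circ> a ^^ nat u') \<circ> (b ^^ nat v \<circ> b ^^ nat v')"
      using w w' by (simp add: uv carC natp ord)
    also have "\<dots> = a ^^ nat u \<circ> (a ^^ nat u' \<circ> b ^^ nat v) \<circ> b ^^ nat v'" by (simp only: comp_assoc)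
    also have "\<dots> = a ^^ nat u \<circ> (b ^^ nat v \<circ> a ^^ nat u') \<circ> b ^^ nat v'"
      unfolding swap[of "nat u'" "nat v"] ..
    also have "\<dots> = \<chi> w \<circ> \<chi> w'" unfolding uv \<chi>_def by (simp add: comp_assoc)
    finally show "\<chi> (w \<otimes>\<^bsub>C\<^esub> w') = \<chi> w \<otimes>\<^bsub>\<Gamma>\<^esub> \<chi> w'" by simp
  qed
  have inj: "inj_on \<chi> (carrier C)"
  proof (rule inj_onI)
    fix w w' assume w: "w \<in> carrier C" and w': "w' \<in> carrier C" and e: "\<chi> w = \<chi> w'"
    obtain u v u' v' where uv: "w = (u, v)" "w' = (u', v')" by fastforce
    have r: "u \<in> {0..<int p}" "v \<in> {0..<int p}" "u' \<in> {0..<int p}" "v' \<in> {0..<int p}"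
      using w w' uv by (auto simp: carC)
    \<comment> \<open>\<open>\<chi> w = \<chi> w'\<close> amounts to \<open>a ^^ n = b ^^ m\<close>
      with \<open>n = u - u'\<close> and \<open>m = v' - v\<close> modulo \<open>p\<close>; the
      summand \<open>p\<close> keeps the exponents natural.\<close>
    define n m where "n = nat u + (p - nat u')" and "m = nat v' + (p - nat v)"
    have "p - nat u' + nat u' = p" "nat v + (p - nat v) = p" using r by auto
    then have inva: "a ^^ (p - nat u') \<circ> a ^^ nat u' = id" and invb: "b ^^ nat v \<circ> b ^^ (p - nat v) = id"
      using ord by (simp_all only: funpow_add[symmetric])
    have "a ^^ n = a ^^ (p - nat u') \<circ> a ^^ nat u \<circ> (b ^^ nat v \<circ> b ^^ (p - nat v))"
      unfolding n_def invb by (simp add: add.commute flip: funpow_add)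
    also have "\<dots> = a ^^ (p - nat u') \<circ> \<chi> w \<circ> b ^^ (p - nat v)"
      by (simp add: \<chi>_def uv comp_assoc)
    also have "\<dots> = a ^^ (p - nat u') \<circ> \<chi> w' \<circ> b ^^ (p - nat v)" unfolding e ..
    also have "\<dots> = (a ^^ (p - nat u') \<circ> a ^^ nat u') \<circ> (b ^^ nat v' \<circ> b ^^ (p - nat v))"
      by (simp add: \<chi>_def uv comp_assoc)
    also have "\<dots> = b ^^ m" unfolding inva m_def by (simp add: funpow_add)
    finally have "p dvd n" "p dvd m" using ind unfolding indep_def by blast+
    moreover have "int n = u - u' + int p" "int m = v' - v + int p"
      using r by (auto simp: n_def m_def of_nat_diff)
    ultimately have "int p dvd u - u' + int p" "int p dvd v' - v + int p" by (metis int_dvd_int_iff)+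
    then have "int p dvd u - u'" "int p dvd v' - v" by (simp_all add: dvd_add_left_iff)
    then have "u = u'" "v = v'" using r by (auto simp: mod_eq_dvd_iff[symmetric])
    then show "w = w'" using uv by simp
  qed
  interpret h: group_hom C \<Gamma> \<chi>
    using grpC group_G hom by (simp add: group_hom_def group_hom_axioms_def)
  define K where "K = \<chi> ` carrier C"
  have K: "subgroup K \<Gamma>" unfolding K_def by (rule h.img_is_subgroup)
  have "\<chi> \<in> iso C (\<Gamma>\<lparr>carrier := K\<rparr>)"
    using hom inj unfolding iso_def hom_def bij_betw_def K_def by auto
  then have "C \<cong> \<Gamma>\<lparr>carrier := K\<rparr>" unfolding is_iso_def by blast
  then have "\<Gamma>\<lparr>carrier := K\<rparr> \<cong> C" by (rule group.iso_sym[OF grpC])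
  moreover have "K \<subseteq> D" unfolding K_def using chi_D by blast
  ultimately show ?thesis unfolding contains_Cp2_def C_def using K by blast
qed

end

section \<open>Class two and exponent \<open>p\<close>\<close>

locale perm_pgroup_class_2 = perm_pgroup_point +
  assumes exponent_p: "\<And>g. g \<in> G \<Longrightarrow> g ^^ p = id"
    and class_2: "\<And>g h c k. \<lbrakk>g \<in> G; h \<in> G; c \<in> G; k \<in> G; g \<circ> h = c \<circ> (h \<circ> g)\<rbrakk> \<Longrightarrow> c \<circ> k = k \<circ> c"

locale tower_class_2 = perm_pgroup_class_2 p G i + tower p G i z t for p G i z t
begin

lemma affine: affine
  using affine_if_class_2 class_2 by blast

lemma t_p_id: "t ^^ p = id" using exponent_p t_in .

lemma f_eq_if_f_0_f_1: "m \<in> M \<Longrightarrow> f 1 m = f 0 m \<Longrightarrow> f l m = f 0 m"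
proof -
  assume m: "m \<in> M" and e: "f 1 m = f 0 m"
  have "[int (f l m) = int (f 0 m)] (mod int p)"
    using affine[unfolded affine_def, rule_format, OF m, of l] unfolding e by simp
  then show "f l m = f 0 m" using f_eq_iff[OF m m] by blast
qed

lemma z_power_if_f_0_f_1:
  assumes "m \<in> M" "f 1 m = f 0 m" shows "m = z ^^ f 0 m"
proof (rule M_eqI[OF assms(1) M_pow[OF z_M]])
  fix l
  have "f l (z ^^ f 0 m) = f 0 m" by (rule f_eqI) (simp_all add: M_pow z_M f_less assms z_P)
  then show "f l m = f l (z ^^ f 0 m)" using f_eq_if_f_0_f_1[OF assms] by simp
qed

lemma commutator_central:
  assumes "m \<in> M"
  obtains c where "c \<in> M" "c \<circ> t = t \<circ> c" "t \<circ> m \<circ> pinv t = c \<circ> m" "c = t \<circ> m \<circ> pinv t \<circ> pinv m"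
proof -
  define c where "c = t \<circ> m \<circ> pinv t \<circ> pinv m"
  have c: "c \<in> M" unfolding c_def using M_comp M_inv M_conj t_in assms by blast
  have "t \<circ> m = c \<circ> (m \<circ> t)"
    unfolding c_def using M_G[OF assms] t_in by (simp add: fun_eq_iff)
  then have "c \<circ> t = t \<circ> c" using class_2[OF t_in M_G[OF assms] M_G[OF c] t_in] by blast
  moreover have "t \<circ> m \<circ> pinv t = c \<circ> m" unfolding c_def using M_G[OF assms] by (simp add: fun_eq_iff)
  ultimately show ?thesis using that c c_def by blast
qed

lemma z_mem_if_power:
  assumes D: "subgroup D \<Gamma>" and e: "z ^^ e \<in> D" "\<not> p dvd e" shows "z \<in> D"
proof -
  obtain b where "[e * b = Suc 0] (mod p)" using inverse_mod_prime[OF prime_p e(2)] by blast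
  then have "z ^^ (e * b) = z ^^ Suc 0" by (rule funpow_cong_mod[OF z_p])
  then have "z = (z ^^ e) ^^ b" by (simp add: funpow_mult)
  then show ?thesis using subgroup_pow[OF D e(1)] by metis
qed

lemma z_power_mem:
  assumes D: "subgroup D \<Gamma>" and m: "m \<in> D" "m \<in> M" "m \<noteq> id" "f 1 m = f 0 m" shows "z \<in> D"
proof -
  have z: "m = z ^^ f 0 m" using z_power_if_f_0_f_1 m by blast
  have "f 0 m \<noteq> 0" using z m(3) by (metis funpow_0 ext id_apply)
  then have "\<not> p dvd f 0 m" using f_less[OF m(2), of 0] by (auto dest: dvd_imp_le)
  then show ?thesis using z_mem_if_power[OF D] z m(1) by metis
qed

text \<open>An element of \<open>M\<close> commuting with \<open>t\<close> is a power of
  \<open>z\<close>. So \<open>D\<close> contains \<open>t\<close> and \<open>z\<close>, and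
  triviality on \<open>D\<close> makes their matrices commute.\<close>

lemma coh_trivial_if_trivial_on_noncentral:
  assumes "tower_cocycle p G i z t W" and D: "subgroup D \<Gamma>" "coh_trivial (p^2) D W"
    and m: "t \<in> D" "m \<in> D" "m \<in> M" "m \<noteq> id" "t \<circ> m = m \<circ> t"
  shows "coh_trivial (p^2) G W"
proof -
  interpret tower_cocycle p G i z t W by fact
  have "f 1 m = f 0 m" using centralizer_t(1)[OF m(3,5)] by simp
  then have "z \<in> D" using z_power_mem[OF D(1) m(2-4)] by blast
  then show ?thesis
    using coh_trivial_commute[OF D(2) m(1) _ t_in z_in z_central[OF t_in, symmetric]]
    by (intro coh_trivial_if_commute) blast
qed

text \<open>Dividing \<open>a\<close> by a power of the shear \<open>b\<close> leaves a nontrivial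
  power of \<open>z\<close>, so \<open>z\<close> lies in \<open>D\<close>. By class two the
  conjugate of \<open>b\<close> by \<open>t\<close> is \<open>b\<close> times a power of
  \<open>z\<close>, hence again in \<open>D\<close>, even if \<open>t\<close> is not; then
  \<open>commute_if_trivial_on_M\<close> applies.\<close>

lemma coh_trivial_if_trivial_in_M:
  assumes "tower_cocycle p G i z t W" and D: "subgroup D \<Gamma>" "coh_trivial (p^2) D W"
    and ab: "a \<in> D" "b \<in> D" "a \<in> M" "b \<in> M" "indep p a b" "f 1 b \<noteq> f 0 b"
  shows "coh_trivial (p^2) G W"
proof -
  interpret tower_cocycle p G i z t W by fact
  obtain k where k: "[f 1 (b ^^ k) = f 0 (b ^^ k) + 1] (mod p)" using shear_exists ab by blast
  obtain n q where n: "n \<in> M" "f 1 n = f 0 n" "a = n \<circ> (b ^^ k) ^^ q"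
    using shear_decomp[OF M_pow[OF ab(4)] k ab(3)] by blast
  have bq: "(b ^^ k) ^^ q \<in> D" using subgroup_pow[OF D(1)] ab(2) by blast
  have "(b ^^ k) ^^ q \<in> G" using bq subgroup_\<Gamma>D(1)[OF D(1)] by blast
  then have "n = a \<circ> pinv ((b ^^ k) ^^ q)" unfolding n(3) by (simp add: comp_assoc)
  then have nD: "n \<in> D" using ab(1) bq subgroup_\<Gamma>D(3,4)[OF D(1)] by metis
  have "n \<noteq> id"
  proof
    assume "n = id"
    then have "a ^^ 1 = b ^^ (k * q)" using n(3) by (simp add: funpow_mult)
    then have "p dvd 1" using ab(5) unfolding indep_def by blast
    then show False using p_gt_1 by simp
  qed
  then have zD: "z \<in> D" using z_power_mem[OF D(1) nD n(1) _ n(2)] by blast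
  obtain c where c: "c \<in> M" "c \<circ> t = t \<circ> c" "t \<circ> b \<circ> pinv t = c \<circ> b"
    using commutator_central[OF ab(4)] by blast
  have "c \<in> D" using centralizer_t(2)[OF c(1) c(2)[symmetric]] subgroup_pow[OF D(1) zD] by metis
  then have "t \<circ> b \<circ> pinv t \<in> D" unfolding c(3) using ab(2) subgroup_\<Gamma>D(3)[OF D(1)] by blast
  then show ?thesis
    using commute_if_trivial_on_M[OF D(2) subgroup_\<Gamma>D(1)[OF D(1)] zD ab(2) _ ab(4)] ab(6)
    by (intro coh_trivial_if_commute) metis
qed

section \<open>The generating class\<close>

definition sh :: "nat \<Rightarrow> (nat \<Rightarrow> nat) \<Rightarrow> nat" where
  "sh l g = col (g (P l 0))"

text \<open>If \<open>h\<close> moves blocks by \<open>b\<close>, then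
  \<open>sh l (g \<circ> h) = sh (l + b) g + sh l h\<close> modulo \<open>p\<close>. Summing over
  the first \<open>n\<close> blocks gives the analogous rule for \<open>Q\<close> up to
  \<open>Q b g\<close>, which does not depend on \<open>n\<close>: it becomes the scalar of a
  projective representation.\<close>

definition Q :: "nat \<Rightarrow> (nat \<Rightarrow> nat) \<Rightarrow> nat" where
  "Q n g = (\<Sum>l<n. sh l g)"

text \<open>The monomial matrix over \<open>t\<close> is a permutation matrix, and the one over \<open>z\<close> is scaled on block \<open>l\<close> by
  \<open>\<zeta>\<^sup>l\<close> with \<open>\<zeta> = exp (2 \<pi> \<i> / p)\<close>; so their commutator is nontrivial.\<close>

definition \<beta>1 :: "(nat \<Rightarrow> nat) \<Rightarrow> nat \<Rightarrow> real" where
  "\<beta>1 g x = real (Q (row (pinv g x)) g) / real p"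

lemma col_P': "col (P l j) = j mod p"
  using col_P[of "l mod p" j] P_period[OF t_p_id, of l j] by simp

lemma row_P': "row (P l j) = l mod p"
  using row_P[of "l mod p" j] P_period[OF t_p_id, of l j] by simp

lemma G_act:
  assumes "g \<in> G"
  obtains a m where "m \<in> M" "g = t ^^ a \<circ> m" "\<And>l. sh l g = f l m" "\<And>l j. g (P l j) = P (l + a) (j + sh l g)"
proof -
  obtain a m where m: "m \<in> M" "g = t ^^ a \<circ> m" using G_decomp[OF assms] by blast
  have act: "g (P l j) = P (l + a) (j + f l m)" for l j
    unfolding m(2) using M_P[OF m(1)] by (simp add: t_P)
  have "sh l g = f l m" for l unfolding sh_def act col_P' using f_less[OF m(1)] by simp
  then show ?thesis using that m act by metis
qed

lemma sh_t: "sh l t = 0" unfolding sh_def t_P1 col_P' by simp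

lemma sh_z: "sh l z = 1" unfolding sh_def z_P1 col_P' using p_gt_1 by simp

lemma Q_t: "Q n t = 0" unfolding Q_def sh_t by simp

lemma Q_z: "Q n z = n" unfolding Q_def sh_z by simp

text \<open>Let \<open>m\<close> in \<open>M\<close> have the shifts of \<open>g\<close>. The
  \<open>p\<close>-th power of \<open>t \<circ> m\<close> walks once through all blocks and collects
  the total shift \<open>Q p g\<close>; exponent \<open>p\<close> makes this total vanish. Hence
  \<open>Q\<close> depends on the row only modulo \<open>p\<close>.\<close>

lemma p_dvd_Q_p:
  assumes "g \<in> G" shows "p dvd Q p g"
proof -
  obtain a m where m: "m \<in> M" "\<And>l. sh l g = f l m" using G_act[OF assms] by metis
  have "((t \<circ> m) ^^ n) (P 0 0) = P n (Q n g)" for n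
  proof (induction n)
    case (Suc n)
    then show ?case by (simp add: M_P[OF m(1)] t_P1 Q_def m(2))
  qed (simp add: Q_def)
  moreover have "(t \<circ> m) ^^ p = id" using exponent_p G_comp t_in M_G m(1) by blast
  ultimately have "P p (Q p g) = P 0 0" by (metis id_apply)
  then have "P 0 (Q p g) = P 0 0" using P_period[OF t_p_id, of p "Q p g"] by simp
  then show ?thesis unfolding P_eq by (simp add: cong_0_iff)
qed

lemma Q_mod:
  assumes "g \<in> G" shows "[Q (n mod p) g = Q n g] (mod p)"
proof -
  have sh: "sh (p + l) g = sh l g" for l
    unfolding sh_def using P_period[OF t_p_id, of "p + l" 0] P_period[OF t_p_id, of l 0] by simp
  have 1: "[Q (p + n) g = Q n g] (mod p)" for n
  proof (induction n)
    case 0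
    then show ?case using p_dvd_Q_p[OF assms] by (simp add: Q_def cong_0_iff)
  next
    case (Suc n)
    have "[Q (p + n) g + sh (p + n) g = Q n g + sh n g] (mod p)"
      unfolding sh using Suc by (intro cong_add cong_refl)
    then show ?case by (simp add: Q_def)
  qed
  have "[Q (n + p * q) g = Q n g] (mod p)" for n q
  proof (induction q)
    case (Suc q)
    have "n + p * Suc q = p + (n + p * q)" by simp
    then show ?case using 1[of "n + p * q"] Suc cong_trans by metis
  qed simp
  from this[of "n mod p" "n div p"] show ?thesis by (simp add: cong_sym)
qed

lemma Q_comp:
  assumes g: "g \<in> G" and h: "h \<in> G"
  obtains b where "\<And>y. y < p^2 \<Longrightarrow> [Q (row y) (g \<circ> h) + Q b g = Q (row (h y)) g + Q (row y) h] (mod p)"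
proof -
  obtain a where ga: "\<And>l j. g (P l j) = P (l + a) (j + sh l g)" using G_act[OF g] by metis
  obtain b where hb: "\<And>l j. h (P l j) = P (l + b) (j + sh l h)" using G_act[OF h] by metis
  have sh: "[sh l (g \<circ> h) = sh (l + b) g + sh l h] (mod p)" for l
  proof -
    have "(g \<circ> h) (P l 0) = P (l + b + a) (sh l h + sh (l + b) g)" by (simp add: hb ga)
    then show ?thesis unfolding sh_def[of l "g \<circ> h"] by (simp add: col_P' cong_def add.commute)
  qed
  have Q: "[Q n (g \<circ> h) + Q b g = Q (n + b) g + Q n h] (mod p)" for n
  proof (induction n)
    case (Suc n)
    have "[(Q n (g \<circ> h) + Q b g) + sh n (g \<circ> h) = (Q (n + b) g + Q n h) + (sh (n + b) g + sh n h)] (mod p)"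
      using Suc sh by (rule cong_add)
    then show ?case by (simp only: Q_def sum.lessThan_Suc add_Suc add_Suc_right add_ac)
  qed (simp add: Q_def)
  show ?thesis
  proof (rule that[of b])
    fix y assume y: "y < p^2"
    have hy: "row (h y) = (row y + b) mod p"
      using hb[of "row y" "col y"] P_row_col[OF y] row_P' by simp
    have "[Q (row y) (g \<circ> h) + Q b g = Q (row y + b) g + Q (row y) h] (mod p)" by (rule Q)
    also have "[Q (row y + b) g + Q (row y) h = Q (row (h y)) g + Q (row y) h] (mod p)"
      unfolding hy using Q_mod[OF g] by (intro cong_add cong_refl) (rule cong_sym)
    finally show "[Q (row y) (g \<circ> h) + Q b g = Q (row (h y)) g + Q (row y) h] (mod p)" .
  qed
qed

text \<open>By \<open>Q_comp\<close> the coboundary of \<open>\<beta>1\<close> is integral up to a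
  constant depending on \<open>g\<close> and \<open>h\<close>. Subtracting the value at
  \<open>i\<close> removes it, so on \<open>G\<close> and the cosets of \<open>H\<close> the floor
  is taken of an integer.\<close>

definition c1 :: "(nat \<Rightarrow> nat) \<Rightarrow> (nat \<Rightarrow> nat) \<Rightarrow> (nat \<Rightarrow> nat) set \<Rightarrow> int" where
  "c1 g h C = (if g \<in> G \<and> h \<in> G \<and> C \<in> lcosets\<^bsub>\<Gamma>\<^esub> H then \<lfloor>d1 \<beta>1 g h (pt C) - d1 \<beta>1 g h i\<rfloor> else 0)"

lemma d1_\<beta>1_int:
  assumes g: "g \<in> G" and h: "h \<in> G" and x: "x < p^2"
  shows "d1 \<beta>1 g h x - d1 \<beta>1 g h i \<in> \<int>"
proof -
  obtain b where b: "\<And>y. y < p^2 \<Longrightarrow> [Q (row y) (g \<circ> h) + Q b g = Q (row (h y)) g + Q (row y) h] (mod p)"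
    using Q_comp[OF g h] by blast
  have inv: "pinv (g \<circ> h) = pinv h \<circ> pinv g" using o_inv_distrib G_bij g h by blast
  have "\<exists>k::int. d1 \<beta>1 g h x = real (Q b g) / real p + k" if x: "x < p^2" for x
  proof -
    define y where "y = pinv h (pinv g x)"
    have y: "y < p^2" unfolding y_def using inv_less g h x by blast
    have hy: "h y = pinv g x" unfolding y_def using h by simp
    have "[int (Q (row y) (g \<circ> h)) + int (Q b g) = int (Q (row (h y)) g) + int (Q (row y) h)] (mod int p)"
      using b[OF y] by (metis cong_int_iff of_nat_add)
    then obtain k where k: "int (Q (row (h y)) g) + int (Q (row y) h) = int (Q (row y) (g \<circ> h)) + int (Q b g) + int p * k"
      unfolding cong_iff_lin by blast
    have "real_of_int (int (Q (row (h y)) g) + int (Q (row y) h)) = real_of_int (int (Q (row y) (g \<circ> h)) + int (Q b g) + int p * k)"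
      unfolding k ..
    then have k': "real (Q (row (h y)) g) + real (Q (row y) h) = real (Q (row y) (g \<circ> h)) + real (Q b g) + real p * real_of_int k"
      by simp
    have "d1 \<beta>1 g h x = (real (Q (row (h y)) g) + real (Q (row y) h) - real (Q (row y) (g \<circ> h))) / real p"
      unfolding d1_def \<beta>1_def inv using hy y_def by (simp add: diff_divide_distrib add_divide_distrib)
    also have "\<dots> = (real (Q b g) + real p * real_of_int k) / real p" using k' by simp
    also have "\<dots> = real (Q b g) / real p + k" using p_gt_1 by (simp add: add_divide_distrib)
    finally show ?thesis by blast
  qed
  then obtain k l :: int where "d1 \<beta>1 g h x = real (Q b g) / real p + k" "d1 \<beta>1 g h i = real (Q b g) / real p + l"
    using x i by blast
  then show ?thesis by simp
qed

lemma c1_cochains2: "c1 \<in> cochains2 \<Gamma> H G"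
  unfolding cochains2_def c1_def by (auto simp: fun_eq_iff)

lemma represents_c1: "represents c1 \<beta>1"
  unfolding represents_def
proof (intro ballI)
  fix g h assume g: "g \<in> G" and h: "h \<in> G"
  have "real_of_int (c1 g h (cs x)) = d1 \<beta>1 g h x + (- d1 \<beta>1 g h i)" if x: "x < p^2" for x
  proof -
    have "cs x \<in> lcosets\<^bsub>\<Gamma>\<^esub> H" unfolding lcosets_\<Gamma> using x by blast
    then have "c1 g h (cs x) = \<lfloor>d1 \<beta>1 g h x - d1 \<beta>1 g h i\<rfloor>"
      unfolding c1_def using g h by (simp add: pt_cs[OF x])
    then show ?thesis using d1_\<beta>1_int[OF g h x] by simp
  qed
  then show "\<exists>r. \<forall>x<p^2. real_of_int (c1 g h (cs x)) = d1 \<beta>1 g h x + r" by blast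
qed

text \<open>If \<open>g\<close> fixes points in two different blocks, its affine shifts have two
  zeros modulo \<open>p\<close> and vanish, and so does \<open>Q\<close>. Within one block the entry
  is constant by construction.\<close>

lemma fix_const_\<beta>1: "fix_const (p^2) G (Wr \<beta>1)"
  unfolding fix_const_def
proof (intro ballI allI impI)
  fix g x y assume g: "g \<in> G" and x: "x < p^2" "g x = x" and y: "y < p^2" "g y = y"
  obtain a m where m: "m \<in> M" "\<And>l. sh l g = f l m" "\<And>l j. g (P l j) = P (l + a) (j + sh l g)"
    using G_act[OF g] by metis
  have "(row x + a) mod p = row x"
    using m(3)[of "row x" "col x"] P_row_col[OF x(1)] x(2) row_P' by metis
  then have "(row x + a) mod p = row x mod p" using row_less[OF x(1)] by simp
  then have "p dvd a" by (metis cong_def cong_add_lcancel_0_nat cong_0_iff)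
  then obtain q where q: "a = p * q" by blast
  have Pa: "P (l + a) j = P l j" for l j
    using P_period[OF t_p_id, of "l + a" j] P_period[OF t_p_id, of l j] q by simp
  have fz: "f (row w) m = 0" if w: "w < p^2" "g w = w" for w
  proof -
    have "P (row w) (col w + f (row w) m) = P (row w) (col w)"
      using m(3)[of "row w" "col w"] P_row_col[OF w(1)] w(2) Pa m(2) by metis
    then have "[f (row w) m = 0] (mod p)" unfolding P_eq by (simp add: cong_add_lcancel_0_nat)
    then show ?thesis using f_less[OF m(1)] by (simp add: cong_def)
  qed
  have "Q (row x) g = Q (row y) g"
  proof (cases "row x = row y")
    case False
    have e: "[0 = int (f 0 m) + int (row w) * (int (f 1 m) - int (f 0 m))] (mod int p)" if "w < p^2" "g w = w" for w
      using affine[unfolded affine_def, rule_format, OF m(1), of "row w"] fz[OF that] by simp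
    have "[0 - 0 = (int (f 0 m) + int (row x) * (int (f 1 m) - int (f 0 m)))
        - (int (f 0 m) + int (row y) * (int (f 1 m) - int (f 0 m)))] (mod int p)"
      using e[OF x] e[OF y] by (rule cong_diff)
    then have "int p dvd (int (row x) - int (row y)) * (int (f 1 m) - int (f 0 m))"
      by (simp add: cong_iff_dvd_diff algebra_simps dvd_diff_commute)
    moreover have "Factorial_Ring.prime (int p)" using prime_p by simp
    ultimately have "int p dvd int (row x) - int (row y) \<or> int p dvd int (f 1 m) - int (f 0 m)"
      using prime_dvd_multD by blast
    moreover have "\<not> int p dvd int (row x) - int (row y)"
    proof
      assume "int p dvd int (row x) - int (row y)"
      then have "[row x = row y] (mod p)" by (simp add: cong_iff_dvd_diff flip: cong_int_iff)
      then show False using False row_less x(1) y(1) by (simp add: cong_def)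
    qed
    ultimately have "[int (f 1 m) = int (f 0 m)] (mod int p)" by (simp add: cong_iff_dvd_diff)
    then have "f 1 m = f 0 m" using f_eq_iff[OF m(1) m(1)] by blast
    then have "f l m = f 0 m" for l using f_eq_if_f_0_f_1[OF m(1)] by blast
    then have "f l m = 0" for l using fz[OF x] by metis
    then show ?thesis unfolding Q_def m(2) by simp
  qed simp
  then show "Wr \<beta>1 g x = Wr \<beta>1 g y"
    unfolding Wr_def \<beta>1_def using g by simp
qed

text \<open>The logarithm of the commutator of the monomial matrices over \<open>t\<close> and \<open>z\<close>; this is the
  obstruction to triviality.\<close>

definition Ecom :: "((nat \<Rightarrow> nat) \<Rightarrow> nat \<Rightarrow> real) \<Rightarrow> real" where
  "Ecom \<beta> = \<beta> t (t (z i)) + \<beta> z (z i) - \<beta> z (z (t i)) - \<beta> t (t i)"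

lemma Ecom_add_scale: "Ecom (\<lambda>g x. \<beta> g x + r * \<beta>' g x) = Ecom \<beta> + r * Ecom \<beta>'"
  unfolding Ecom_def by (simp add: algebra_simps)

text \<open>The point \<open>i\<close> lies in row 0 and \<open>t i\<close> in row 1, where
  \<open>Q\<close> takes the values 0 and 1 at \<open>z\<close>; at \<open>t\<close> it is 0
  throughout.\<close>

lemma Ecom_\<beta>1: "Ecom \<beta>1 = - 1 / real p"
proof -
  have "P 0 1 = z i" "P 0 0 = i" "P 1 0 = t i" unfolding P_def by simp_all
  then have "row (z i) = 0" "row i = 0" "row (t i) = 1"
    using row_P'[of 0 1] row_P'[of 0 0] row_P'[of 1 0] p_gt_1 by simp_all
  then show ?thesis unfolding Ecom_def \<beta>1_def Q_t Q_z using t_in z_in by simp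
qed

lemma Wr_commutator:
  "Wr \<beta> t (z i) * Wr \<beta> z i = cis (2 * pi * Ecom \<beta>) * (Wr \<beta> z (t i) * Wr \<beta> t i)"
  unfolding Wr_def cis_mult Ecom_def by (simp add: algebra_simps)

lemma tower_cocycleI:
  assumes "represents c \<beta>" "fix_const (p^2) G (Wr \<beta>)" shows "tower_cocycle p G i z t (Wr \<beta>)"
  by unfold_locales (use Wr_proj_cocycle[OF assms(1)] assms(2) in auto)

text \<open>\<open>Ecom\<close> is linear in \<open>\<beta>\<close>; with values in the multiples of
  1/p and triviality detected modulo integers, it embeds the classes in question into a group of
  order \<open>p\<close>.\<close>

lemma Ecom_obstruction:
  assumes rep: "represents c \<beta>" and fc: "fix_const (p^2) G (Wr \<beta>)"
  shows "coh_trivial (p^2) G (Wr \<beta>) \<longleftrightarrow> Ecom \<beta> \<in> \<int>" "real p * Ecom \<beta> \<in> \<int>"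
proof -
  interpret tower_cocycle p G i z t "Wr \<beta>" by (rule tower_cocycleI[OF rep fc])
  obtain c where c: "c ^ p = 1"
    "\<And>x. x < p^2 \<Longrightarrow> Wr \<beta> t (z x) * Wr \<beta> z x = c * (Wr \<beta> z (t x) * Wr \<beta> t x)"
    using commutator_root_of_unity by blast
  have nz: "Wr \<beta> z (t i) * Wr \<beta> t i \<noteq> 0" by (simp add: Wr_def)
  have cE: "c = cis (2 * pi * Ecom \<beta>)"
    using c(2)[OF i] Wr_commutator[of \<beta>] nz by simp
  have "cis (2 * pi * (real p * Ecom \<beta>)) = c ^ p"
    unfolding cE DeMoivre by (simp add: algebra_simps)
  then show "real p * Ecom \<beta> \<in> \<int>" using c(1) cis_2pi_eqD by metis
  show "coh_trivial (p^2) G (Wr \<beta>) \<longleftrightarrow> Ecom \<beta> \<in> \<int>"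
  proof
    assume "coh_trivial (p^2) G (Wr \<beta>)"
    then have "Wr \<beta> t (z i) * Wr \<beta> z i = Wr \<beta> z (t i) * Wr \<beta> t i"
      using coh_trivial_commute[OF _ t_in z_in t_in z_in z_central[OF t_in, symmetric] i] by blast
    then have "c = 1" using c(2)[OF i] nz by simp
    then show "Ecom \<beta> \<in> \<int>" using cE cis_2pi_eqD by metis
  next
    assume "Ecom \<beta> \<in> \<int>"
    then have "c = 1" unfolding cE by (rule cis_multiple_2pi)
    then show "coh_trivial (p^2) G (Wr \<beta>)" using c(2) by (intro coh_trivial_if_commute) simp
  qed
qed

text \<open>On cyclic groups constancy on fixed points already implies triviality, so
  \<open>c1\<close> satisfies all conditions. \<open>Ecom\<close> separates its multiples modulo
  \<open>p\<close>, and every class differs from one of them by a class with integral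
  \<open>Ecom\<close>.\<close>

lemma Sha2_iso_if_cyclic:
  assumes adm: "admissible \<Gamma> DD"
    and cyc: "\<And>D. D \<in> DD \<Longrightarrow> \<exists>d\<in>D. D = range (\<lambda>n. d ^^ n)"
  shows "Sha2 \<Gamma> H DD \<cong> integer_mod_group p"
proof -
  note DD = admissibleD[OF adm]
  have c1: "c1 \<in> sha DD"
    unfolding sha_def
  proof (intro CollectI conjI ballI)
    show "c1 \<in> Z2 \<Gamma> H G" by (rule represents_Z2[OF c1_cochains2 represents_c1])
    fix D assume D: "D \<in> DD"
    obtain d where d: "d \<in> D" "D = range (\<lambda>n. d ^^ n)" using cyc[OF D] by blast
    have dG: "d \<in> G" using d DD(3)[OF D] by blast
    interpret tower_cocycle p G i z t "Wr \<beta>1" by (rule tower_cocycleI[OF represents_c1 fix_const_\<beta>1])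
    have "coh_trivial (p^2) D (Wr \<beta>1)"
      unfolding d(2) using W_fixD[OF dG] by (intro coh_trivial_cyclic dG exponent_p) blast
    then show "restr2 D c1 \<in> B2 \<Gamma> H D"
      using restr2_B2_iff[OF c1_cochains2 represents_c1 subgroup_\<Gamma>D(2,1,3)[OF DD(1)[OF D]]] by blast
  qed
  have B: "c \<in> Bg \<longleftrightarrow> Ecom \<beta> \<in> \<int>" "real p * Ecom \<beta> \<in> \<int>" if "c \<in> sha DD" "represents c \<beta>" for c \<beta>
    using Ecom_obstruction[OF that(2) sha_fix_const[OF DD(2) that]] sha_B2[OF that] by auto
  have zero: "represents (\<lambda>_ _ _. 0) (\<lambda>_ _. 0)"
    unfolding represents_def d1_def by auto
  define mc where "mc l = (\<lambda>g h C. l * c1 g h C)" for l :: int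
  have mc: "mc l \<in> sha DD" for l
    using sha_add_scale[OF DD(3) zero_sha[OF DD(3)] c1, of l] by (simp add: mc_def)
  have mcZ: "mc l \<in> Z2 \<Gamma> H G" for l using mc unfolding sha_def by blast
  have mcB: "mc l \<in> Bg \<longleftrightarrow> int p dvd l" for l
  proof -
    have "represents (mc l) (\<lambda>g x. 0 + real_of_int l * \<beta>1 g x)"
      using represents_add_scale[OF zero represents_c1, of l] by (simp add: mc_def)
    then have "mc l \<in> Bg \<longleftrightarrow> Ecom (\<lambda>g x. 0 + real_of_int l * \<beta>1 g x) \<in> \<int>" by (rule B(1)[OF mc])
    also have "Ecom (\<lambda>g x. 0 + real_of_int l * \<beta>1 g x) = - (real_of_int l / real p)"
      unfolding Ecom_add_scale Ecom_\<beta>1 by (simp add: Ecom_def)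
    also have "- (real_of_int l / real p) \<in> \<int> \<longleftrightarrow> int p dvd l"
    proof
      assume "- (real_of_int l / real p) \<in> \<int>"
      then obtain k where "- (real_of_int l / real p) = real_of_int k" by (rule Ints_cases)
      then have "real_of_int l = real_of_int (int p * (- k))" using p_gt_1 by (simp add: field_simps)
      then have "l = int p * (- k)" by (simp only: of_int_eq_iff)
      then show "int p dvd l" by simp
    next
      assume "int p dvd l"
      then obtain k where "l = int p * k" by blast
      then have "- (real_of_int l / real p) = real_of_int (- k)" using p_gt_1 by simp
      then show "- (real_of_int l / real p) \<in> \<int>" by simp
    qed
    finally show ?thesis .
  qed
  have mc_diff: "cls (mc l) = cls (mc l') \<longleftrightarrow> int p dvd l - l'" for l l'
  proof -
    have "(\<lambda>g h C. mc l g h C - mc l' g h C) = mc (l - l')" by (simp add: mc_def algebra_simps)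
    then show ?thesis using cls_eq_iff[OF mcZ mcZ] mcB by simp
  qed
  have carS: "carrier (Sha2 \<Gamma> H DD) = cls ` sha DD"
    unfolding sha_def by (rule Sha2_carrier) (rule DD(3))
  have carI: "carrier (integer_mod_group p) = {0..<int p}"
    using p_gt_1 by (simp add: carrier_integer_mod_group)
  have "(\<lambda>l. cls (mc l)) \<in> iso (integer_mod_group p) (Sha2 \<Gamma> H DD)"
    unfolding iso_def
  proof (intro CollectI conjI homI)
    show "cls (mc l) \<in> carrier (Sha2 \<Gamma> H DD)" for l unfolding carS using mc by blast
    fix l l'
    have "cls (mc ((l + l') mod int p)) = cls (mc (l + l'))"
      unfolding mc_diff by (simp add: mod_eq_dvd_iff[symmetric])
    also have "\<dots> = cls (mc l) \<otimes>\<^bsub>Sha2 \<Gamma> H DD\<^esub> cls (mc l')"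
      unfolding cls_mult[OF mcZ mcZ] by (simp add: mc_def algebra_simps)
    finally show "cls (mc (l \<otimes>\<^bsub>integer_mod_group p\<^esub> l')) = cls (mc l) \<otimes>\<^bsub>Sha2 \<Gamma> H DD\<^esub> cls (mc l')" by simp
  next
    show "bij_betw (\<lambda>l. cls (mc l)) (carrier (integer_mod_group p)) (carrier (Sha2 \<Gamma> H DD))"
      unfolding bij_betw_def
    proof
      show "inj_on (\<lambda>l. cls (mc l)) (carrier (integer_mod_group p))"
        by (intro inj_onI) (auto simp: carI mc_diff mod_eq_dvd_iff[symmetric])
      show "(\<lambda>l. cls (mc l)) ` carrier (integer_mod_group p) = carrier (Sha2 \<Gamma> H DD)"
      proof
        show "(\<lambda>l. cls (mc l)) ` carrier (integer_mod_group p) \<subseteq> carrier (Sha2 \<Gamma> H DD)"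
          unfolding carS using mc by blast
        show "carrier (Sha2 \<Gamma> H DD) \<subseteq> (\<lambda>l. cls (mc l)) ` carrier (integer_mod_group p)"
        proof
          fix u assume "u \<in> carrier (Sha2 \<Gamma> H DD)"
          then obtain c where c: "c \<in> sha DD" "u = cls c" unfolding carS by blast
          obtain \<beta> where rep: "represents c \<beta>" using sha_E[OF c(1)] by blast
          obtain n where n: "real p * Ecom \<beta> = real_of_int n" using B(2)[OF c(1) rep] by (rule Ints_cases)
          \<comment> \<open>The sign comes from \<open>Ecom \<beta>1 = - 1 / real p\<close>:
            subtracting \<open>l\<close> times \<open>c1\<close> adds \<open>l / p\<close> to
            \<open>Ecom\<close>.\<close>
          define l where "l = (- n) mod int p"
          have "int p dvd l - (- n)" unfolding l_def mod_eq_dvd_iff[symmetric] by simp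
          then obtain k where k: "l = - n + int p * k" by (metis add.commute diff_add_cancel dvdE)
          have "Ecom (\<lambda>g x. \<beta> g x + real_of_int (- l) * \<beta>1 g x) = real_of_int n / real p + real_of_int l / real p"
            unfolding Ecom_add_scale Ecom_\<beta>1 n[symmetric] using p_gt_1 by simp
          also have "\<dots> = real_of_int k" unfolding k using p_gt_1 by (simp add: field_simps)
          finally have "Ecom (\<lambda>g x. \<beta> g x + real_of_int (- l) * \<beta>1 g x) \<in> \<int>" by simp
          then have "(\<lambda>g h C. c g h C + (- l) * c1 g h C) \<in> Bg"
            using B(1)[OF sha_add_scale[OF DD(3) c(1) c1] represents_add_scale[OF rep represents_c1]] by blast
          then have "(\<lambda>g h C. c g h C - mc l g h C) \<in> Bg" by (simp add: mc_def)
          then have "cls c = cls (mc l)" using cls_eq_iff[OF _ mcZ] c(1) unfolding sha_def by blast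
          moreover have "l \<in> carrier (integer_mod_group p)" unfolding carI l_def using p_gt_1 by simp
          ultimately show "u \<in> (\<lambda>l. cls (mc l)) ` carrier (integer_mod_group p)" using c(2) by blast
        qed
      qed
    qed
  qed
  then have "integer_mod_group p \<cong> Sha2 \<Gamma> H DD" unfolding is_iso_def by blast
  then show ?thesis by (rule group.iso_sym[OF group_integer_mod_group])
qed

end

section \<open>Subgroups with and without a copy of \<open>(C_p)^2\<close>\<close>

context perm_pgroup_class_2
begin

text \<open>\<open>M\<close> is determined by \<open>z\<close>, and every element of
  \<open>G\<close> outside \<open>M\<close> moves the block of \<open>i\<close>. So an element of a
  given subgroup can take over the role of \<open>t\<close>.\<close>

lemma towerI:
  assumes "tower p G i z t0" "t \<in> G" "t \<notin> tower.M p G z"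
  shows "tower p G i z t"
proof -
  interpret tower p G i z t0 by fact
  have "t i \<noteq> (z ^^ j) i" for j using M_I[OF assms(2) i] assms(3) unfolding blk_def by blast
  then show ?thesis
    by unfold_locales (use i z_in z_id z_p z_central assms(2) in auto)
qed

text \<open>If one of the two generators \<open>a\<close>, \<open>b\<close> moves blocks, it becomes
  the new \<open>t\<close>, and the other one times a power of it is a nontrivial power of
  \<open>z\<close> in \<open>D\<close>. If both lie in \<open>M\<close>, independence prevents both
  from being powers of \<open>z\<close>, so at least one is a shear.\<close>

lemma coh_trivial_if_contains_Cp2:
  assumes rep: "represents c \<beta>" and fc: "fix_const (p^2) G (Wr \<beta>)"
    and D: "subgroup D \<Gamma>" "contains_Cp2 \<Gamma> p D" "coh_trivial (p^2) D (Wr \<beta>)"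
  shows "coh_trivial (p^2) G (Wr \<beta>)"
proof -
  obtain a b where ab: "a \<in> D" "b \<in> D" "a \<circ> b = b \<circ> a" "indep p a b"
    using contains_Cp2_indep[OF D(2)] by blast
  obtain z t where tow: "tower p G i z t" using exists_tower i by blast
  interpret T: tower_class_2 p G i z t
    using tow perm_pgroup_class_2_axioms by (simp add: tower_class_2_def)
  have DG: "D \<subseteq> G" using subgroup_\<Gamma>D(1)[OF D(1)] .
  have noncentral: "coh_trivial (p^2) G (Wr \<beta>)"
    if ab: "a \<in> D" "b \<in> D" "a \<circ> b = b \<circ> a" "indep p a b" "a \<notin> T.M" for a b
  proof -
    have aG: "a \<in> G" and bG: "b \<in> G" using ab DG by auto
    interpret A: tower_class_2 p G i z a
      using towerI[OF tow aG ab(5)] perm_pgroup_class_2_axioms by (simp add: tower_class_2_def)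
    obtain n m where m: "m \<in> A.M" "b = a ^^ n \<circ> m" using A.G_decomp[OF bG] by blast
    have an: "a ^^ n \<in> G" using G_pow[OF aG] .
    have m': "m = pinv (a ^^ n) \<circ> b" unfolding m(2) using an by (simp add: fun_eq_iff)
    have "m \<in> D" unfolding m' using subgroup_\<Gamma>D[OF D(1)] subgroup_pow[OF D(1) ab(1)] ab(2) by blast
    moreover have "m \<noteq> id"
    proof
      assume "m = id"
      then have "a ^^ n = b ^^ 1" using m(2) by simp
      then have "p dvd 1" using ab(4) unfolding indep_def by blast
      then show False using p_gt_1 by simp
    qed
    moreover have "a \<circ> m = m \<circ> a"
    proof -
      have "a ^^ n \<circ> (a \<circ> m) = a \<circ> b" unfolding m(2) by (simp add: fun_eq_iff funpow_swap1)
      also have "\<dots> = b \<circ> a" by (rule ab(3))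
      also have "\<dots> = a ^^ n \<circ> (m \<circ> a)" unfolding m(2) by (simp only: comp_assoc)
      finally show ?thesis using G_inj[OF an] by (simp add: fun_eq_iff)
    qed
    ultimately show ?thesis
      using A.coh_trivial_if_trivial_on_noncentral[OF A.tower_cocycleI[OF rep fc] D(1,3) ab(1) _ m(1)] by blast
  qed
  have inM: "coh_trivial (p^2) G (Wr \<beta>)"
    if "a \<in> D" "b \<in> D" "a \<in> T.M" "b \<in> T.M" "indep p a b" "T.f 1 b \<noteq> T.f 0 b" for a b
    using T.coh_trivial_if_trivial_in_M[OF T.tower_cocycleI[OF rep fc] D(1,3) that] .
  show ?thesis
  proof (cases "a \<in> T.M \<and> b \<in> T.M")
    case False
    then show ?thesis using noncentral ab indep_sym by metis
  next
    case True
    have "T.f 1 a \<noteq> T.f 0 a \<or> T.f 1 b \<noteq> T.f 0 b"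
    proof (rule ccontr)
      assume "\<not> ?thesis"
      then have za: "a = z ^^ T.f 0 a" and zb: "b = z ^^ T.f 0 b"
        using T.z_power_if_f_0_f_1 True by auto
      have "a ^^ T.f 0 b = z ^^ (T.f 0 a * T.f 0 b)" by (subst za) (simp add: funpow_mult)
      moreover have "b ^^ T.f 0 a = z ^^ (T.f 0 b * T.f 0 a)" by (subst zb) (simp add: funpow_mult)
      ultimately have "a ^^ T.f 0 b = b ^^ T.f 0 a" by (simp only: mult.commute)
      then have "p dvd T.f 0 a" using ab(4) unfolding indep_def by blast
      then have "T.f 0 a = 0" using T.f_less[of a 0] True by (auto dest: dvd_imp_le)
      then have "z ^^ T.f 0 a = id" by (simp add: fun_eq_iff)
      then have "a = id" using za by metis
      then have "a ^^ 1 = b ^^ 0" by (simp add: fun_eq_iff)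
      then have "p dvd 1" using ab(4) unfolding indep_def by blast
      then show False using p_gt_1 by simp
    qed
    then show ?thesis using inM ab True indep_sym by metis
  qed
qed

text \<open>Whatever commutes in \<open>D\<close> with some \<open>a \<noteq> id\<close> of
  \<open>D\<close> is a power of \<open>a\<close>. For \<open>D\<close> inside the abelian
  \<open>M\<close> this suffices. Otherwise take \<open>t\<close> in \<open>D\<close> outside
  \<open>M\<close>: a nontrivial element of \<open>D\<close> in \<open>M\<close> commuting with
  \<open>t\<close> would have \<open>t\<close> among its powers, which lie in \<open>M\<close>. By
  class two this rules out first nontrivial commutators of \<open>t\<close> with elements of
  \<open>D\<close> in \<open>M\<close>, then those elements themselves, so \<open>t\<close>
  generates \<open>D\<close>.\<close>

lemma cyclic_if_not_contains_Cp2: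
  assumes D: "subgroup D \<Gamma>" and nc: "\<not> contains_Cp2 \<Gamma> p D"
  shows "\<exists>d\<in>D. D = range (\<lambda>n. d ^^ n)"
proof -
  have DG: "D \<subseteq> G" using subgroup_\<Gamma>D(1)[OF D] .
  have gen: "b \<in> range (\<lambda>n. a ^^ n)" if "a \<in> D" "b \<in> D" "a \<noteq> id" "a \<circ> b = b \<circ> a" for a b
  proof (rule ccontr)
    assume "b \<notin> range (\<lambda>n. a ^^ n)"
    then have "indep p a b"
      using that DG exponent_p by (intro indepI prime_p) auto
    then show False using nc indep_contains_Cp2[OF D that(1,2,4)] exponent_p that DG by blast
  qed
  have pow: "range (\<lambda>n. a ^^ n) \<subseteq> D" if "a \<in> D" for a using subgroup_pow[OF D that] by blast
  obtain z t0 where tow: "tower p G i z t0" using exists_tower i by blast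
  interpret T: tower_class_2 p G i z t0
    using tow perm_pgroup_class_2_axioms by (simp add: tower_class_2_def)
  show ?thesis
  proof (cases "D \<subseteq> T.M")
    case True
    show ?thesis
    proof (cases "D = {id}")
      case False
      then obtain a where a: "a \<in> D" "a \<noteq> id" using subgroup_\<Gamma>D(2)[OF D] by blast
      have "D \<subseteq> range (\<lambda>n. a ^^ n)" using gen[OF a(1) _ a(2)] T.M_commute True a(1) by blast
      then show ?thesis using pow a(1) by blast
    next
      case True
      have "id ^^ n = (id :: nat \<Rightarrow> nat)" for n by (induction n) simp_all
      then show ?thesis using True by (intro bexI[of _ id]) auto
    qed
  next
    case False
    then obtain t where t: "t \<in> D" "t \<notin> T.M" by blast
    have tG: "t \<in> G" using t(1) DG by blast
    interpret A: tower_class_2 p G i z t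
      using towerI[OF tow tG t(2)] perm_pgroup_class_2_axioms by (simp add: tower_class_2_def)
    have no: "b = id" if b: "b \<in> D" "b \<in> A.M" "b \<circ> t = t \<circ> b" for b
    proof (rule ccontr)
      assume "b \<noteq> id"
      then obtain n where "t = b ^^ n" using gen[OF b(1) t(1) _ b(3)] by blast
      then have "t \<in> A.M" using A.M_pow[OF b(2)] by metis
      then show False using t(2) by simp
    qed
    have "D \<subseteq> range (\<lambda>n. t ^^ n)"
    proof
      fix k assume k: "k \<in> D"
      obtain n m where m: "m \<in> A.M" "k = t ^^ n \<circ> m" using A.G_decomp k DG by blast
      have "m = pinv (t ^^ n) \<circ> k" unfolding m(2) using G_pow[OF tG] by (simp add: fun_eq_iff)
      then have mD: "m \<in> D" using subgroup_\<Gamma>D[OF D] subgroup_pow[OF D t(1)] k by metis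
      obtain c where c: "c \<in> A.M" "c \<circ> t = t \<circ> c" "t \<circ> m \<circ> pinv t = c \<circ> m" "c = t \<circ> m \<circ> pinv t \<circ> pinv m"
        using A.commutator_central[OF m(1)] by blast
      have "c \<in> D" unfolding c(4) using subgroup_\<Gamma>D[OF D] t(1) mD by metis
      then have "c = id" using no c by blast
      then have "t \<circ> m \<circ> pinv t = m" using c(3) by simp
      then have "t \<circ> m \<circ> (pinv t \<circ> t) = m \<circ> t" by (simp only: comp_assoc[symmetric])
      then have "m \<circ> t = t \<circ> m" using tG by simp
      then have "m = id" using no mD m(1) by blast
      then show "k \<in> range (\<lambda>n. t ^^ n)" using m(2) by simp
    qed
    then show ?thesis using pow t(1) by blast
  qed
qed

theorem Sha2_cases:
  assumes adm: "admissible \<Gamma> DD"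
  shows "if \<exists>D\<in>DD. contains_Cp2 \<Gamma> p D
    then carrier (Sha2 \<Gamma> H DD) = {\<one>\<^bsub>Sha2 \<Gamma> H DD\<^esub>}
    else Sha2 \<Gamma> H DD \<cong> integer_mod_group p"
proof (cases "\<exists>D\<in>DD. contains_Cp2 \<Gamma> p D")
  case True
  then obtain D where D: "D \<in> DD" "contains_Cp2 \<Gamma> p D" by blast
  have "c \<in> Bg" if c: "c \<in> sha DD" for c
  proof -
    obtain \<beta> where rep: "represents c \<beta>" using sha_E[OF c] by blast
    have fc: "fix_const (p^2) G (Wr \<beta>)" by (rule sha_fix_const[OF admissibleD(2)[OF adm] c rep])
    have sD: "subgroup D \<Gamma>" using admissibleD(1)[OF adm D(1)] .
    then have "coh_trivial (p^2) D (Wr \<beta>)" using sha_trivial_on[OF c rep D(1)] by blast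
    then show ?thesis using coh_trivial_if_contains_Cp2[OF rep fc sD D(2)] sha_B2[OF c rep] by blast
  qed
  then have "carrier (Sha2 \<Gamma> H DD) = {\<one>\<^bsub>Sha2 \<Gamma> H DD\<^esub>}"
    by (intro Sha2_trivial admissibleD(3)[OF adm]) (auto simp: sha_def)
  then show ?thesis using True by simp
next
  case False
  obtain z t where tow: "tower p G i z t" using exists_tower i by blast
  interpret T: tower_class_2 p G i z t
    using tow perm_pgroup_class_2_axioms by (simp add: tower_class_2_def)
  have "Sha2 \<Gamma> H DD \<cong> integer_mod_group p"
    using cyclic_if_not_contains_Cp2 admissibleD(1)[OF adm] False
    by (intro T.Sha2_iso_if_cyclic[OF adm]) blast
  then show ?thesis using False by simp
qed

end

theorem theorem4p14:
  fixes p :: nat and G :: "(nat \<Rightarrow> nat) set" and i :: nat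
  assumes "Factorial_Ring.prime p" and "p > 2"
    and "subgroup G (perm_grp (p^2))"
    and "transitive_on (p^2) G"
    and "i < p^2"
    and "\<exists>k. card G = p ^ k"
  defines "\<Gamma> \<equiv> (perm_grp (p^2))\<lparr>carrier := G\<rparr>"
    and "H \<equiv> {\<sigma> \<in> G. \<sigma> i = i}"
  shows "(carrier (Sha2 \<Gamma> H (cyclic_subgroups \<Gamma>)) \<noteq> {\<one>\<^bsub>Sha2 \<Gamma> H (cyclic_subgroups \<Gamma>)\<^esub>}
            \<longrightarrow> (\<exists>n\<in>{1,2}. \<Gamma> \<cong> P' p n))
       \<and> (\<forall>n\<in>{1,2}. \<Gamma> \<cong> P' p n \<longrightarrow>
            (\<forall>DD. admissible \<Gamma> DD \<longrightarrow>
               (if \<exists>D\<in>DD. contains_Cp2 \<Gamma> p D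
                then carrier (Sha2 \<Gamma> H DD) = {\<one>\<^bsub>Sha2 \<Gamma> H DD\<^esub>}
                else Sha2 \<Gamma> H DD \<cong> integer_mod_group p)))"
proof -
  have odd: "odd p" using prime_odd_nat assms(1,2) by simp
  interpret perm_pgroup_point p G i
    by (intro perm_pgroup_point.intro perm_pgroup.intro perm_pgroup_point_axioms.intro assms)
  show ?thesis unfolding \<Gamma>_def H_def
  proof (intro conjI impI ballI allI)
    assume "carrier (Sha2 ((perm_grp (p^2))\<lparr>carrier := G\<rparr>) {\<sigma> \<in> G. \<sigma> i = i} (cyclic_subgroups ((perm_grp (p^2))\<lparr>carrier := G\<rparr>)))
      \<noteq> {\<one>\<^bsub>Sha2 ((perm_grp (p^2))\<lparr>carrier := G\<rparr>) {\<sigma> \<in> G. \<sigma> i = i} (cyclic_subgroups ((perm_grp (p^2))\<lparr>carrier := G\<rparr>))\<^esub>}"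
    then show "\<exists>n\<in>{1, 2}. (perm_grp (p^2))\<lparr>carrier := G\<rparr> \<cong> P' p n"
      by (rule iso_P'_if_Sha2_nontrivial[OF odd])
  next
    fix n DD assume n: "n \<in> {1, 2}" and iso: "(perm_grp (p^2))\<lparr>carrier := G\<rparr> \<cong> P' p n"
      and adm: "admissible ((perm_grp (p^2))\<lparr>carrier := G\<rparr>) DD"
    interpret perm_pgroup_class_2 p G i
      by unfold_locales (use iso_P'_properties[OF assms(1) odd n iso assms(3)] in blast)+
    show "if \<exists>D\<in>DD. contains_Cp2 ((perm_grp (p^2))\<lparr>carrier := G\<rparr>) p D
      then carrier (Sha2 ((perm_grp (p^2))\<lparr>carrier := G\<rparr>) {\<sigma> \<in> G. \<sigma> i = i} DD)
        = {\<one>\<^bsub>Sha2 ((perm_grp (p^2))\<lparr>carrier := G\<rparr>) {\<sigma> \<in> G. \<sigma> i = i} DD\<^esub>}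
      else Sha2 ((perm_grp (p^2))\<lparr>carrier := G\<rparr>) {\<sigma> \<in> G. \<sigma> i = i} DD \<cong> integer_mod_group p"
      by (rule Sha2_cases[OF adm])
  qed
qed

end
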